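(* If a connected graph is quasi-isometric to a connected outerplanar graph, then it is $(1,K)$-quasi-isometric to a cactus for some constant $K$.
   Context: A cactus is a connected graph in which any two distinct simple cycles have at most one vertex in common. Graphs are endowed with their path metrics (every edge has length one). "Quasi-isometric" has its usual meaning, with arbitrary multiplicative and additive constants. A map $F:X\to Y$ of metric spaces is a $(1,K)$-quasi-isometry if $|d_Y(F(x),F(y))-d_X(x,y)|\le K$ for all $x,y\in X$ and every point of $Y$ lies at distance at most $K$ from $F(X)$. $X$ is $(1,K)$-quasi-isometric to $Y$ if there is a $(1,K)$-quasi-isometry $X\to Y$. *)

theory Defs
  imports "HOL-Analysis.Analysis"
begin

section \<open>Graphs\<close>

text \<open>Graphs are simple and undirected, and may be infinite; connected graphs are nonempty.\<close>

record 'a ugraph =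
  verts :: "'a set"
  edges :: "'a set set"

definition simple_graph :: "'a ugraph \<Rightarrow> bool" where
  "simple_graph G \<longleftrightarrow> (\<forall>e\<in>edges G. e \<subseteq> verts G \<and> card e = 2)"

definition connected_graph :: "'a ugraph \<Rightarrow> bool" where
  "connected_graph G \<longleftrightarrow> simple_graph G \<and> verts G \<noteq> {} \<and>
     (\<forall>u\<in>verts G. \<forall>v\<in>verts G. (\<lambda>a b. {a, b} \<in> edges G)\<^sup>*\<^sup>* u v)"

text \<open>A simple cycle is a subgraph. It is represented by a cyclic enumeration \<open>xs\<close> of its
  vertices; two enumerations represent the same cycle iff they have the same edge set.\<close>

definition cycle_edges :: "'a list \<Rightarrow> 'a set set" where
  "cycle_edges xs = {{xs ! i, xs ! (Suc i mod length xs)} | i. i < length xs}"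

definition simple_cycle :: "'a ugraph \<Rightarrow> 'a list \<Rightarrow> bool" where
  "simple_cycle G xs \<longleftrightarrow> 3 \<le> length xs \<and> distinct xs \<and> cycle_edges xs \<subseteq> edges G"

definition cactus :: "'a ugraph \<Rightarrow> bool" where
  "cactus G \<longleftrightarrow> connected_graph G \<and>
     (\<forall>xs ys. simple_cycle G xs \<and> simple_cycle G ys \<and> cycle_edges xs \<noteq> cycle_edges ys
        \<longrightarrow> card (set xs \<inter> set ys) \<le> 1)"


section \<open>Outerplanar graphs\<close>

definition plane_drawing :: "'a ugraph \<Rightarrow> ('a \<Rightarrow> complex) \<Rightarrow> ('a set \<Rightarrow> real \<Rightarrow> complex) \<Rightarrow> bool" where
  "plane_drawing G p \<gamma> \<longleftrightarrow> inj_on p (verts G) \<and>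
     (\<forall>e\<in>edges G. arc (\<gamma> e) \<and> {pathstart (\<gamma> e), pathfinish (\<gamma> e)} = p ` e \<and>
        path_image (\<gamma> e) \<inter> p ` verts G \<subseteq> p ` e) \<and>
     (\<forall>e\<in>edges G. \<forall>f\<in>edges G. e \<noteq> f \<longrightarrow>
        path_image (\<gamma> e) \<inter> path_image (\<gamma> f) \<subseteq> p ` (e \<inter> f))"

definition drawing_image :: "'a ugraph \<Rightarrow> ('a \<Rightarrow> complex) \<Rightarrow> ('a set \<Rightarrow> real \<Rightarrow> complex) \<Rightarrow> complex set" where
  "drawing_image G p \<gamma> = p ` verts G \<union> (\<Union>e\<in>edges G. path_image (\<gamma> e))"

text \<open>All vertices lie on the boundary of one unbounded face. A finite drawing has exactly one
  unbounded face; for infinite graphs there may be several (e.g. a line separating the plane),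
  and any one of them may serve as the outer face. No local finiteness of the drawing is
  required.\<close>

definition outerplanar :: "'a ugraph \<Rightarrow> bool" where
  "outerplanar G \<longleftrightarrow> simple_graph G \<and>
     (\<exists>p \<gamma>. plane_drawing G p \<gamma> \<and>
        (\<exists>F\<in>components (- drawing_image G p \<gamma>). \<not> bounded F \<and> p ` verts G \<subseteq> frontier F))"


section \<open>Graphs as metric spaces\<close>

text \<open>The geometric realization, in barycentric coordinates: a vertex \<open>v\<close> is the indicator
  function of \<open>{v}\<close>, and the points of an edge \<open>{u, v}\<close> are the functions
  \<open>x \<ge> 0\<close> supported on \<open>{u, v}\<close> with \<open>x u + x v = 1\<close>.\<close>

definition cell :: "'a set \<Rightarrow> ('a \<Rightarrow> real) set" where
  "cell e = {x. (\<forall>v. 0 \<le> x v) \<and> (\<forall>v. v \<notin> e \<longrightarrow> x v = 0) \<and> (\<Sum>v\<in>e. x v) = 1}"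

definition points :: "'a ugraph \<Rightarrow> ('a \<Rightarrow> real) set" where
  "points G = (\<Union>v\<in>verts G. cell {v}) \<union> (\<Union>e\<in>edges G. cell e)"

text \<open>\<open>path_length G x y l\<close>: some path from \<open>x\<close> to \<open>y\<close>, a concatenation of finitely many
  segments each contained in an edge, has length \<open>l\<close>. If \<open>y\<close> and \<open>z\<close> are on the edge
  \<open>e\<close> of length one, their segment has length \<open>\<bar>y v - z v\<bar>\<close> for either end \<open>v\<close> of \<open>e\<close>.\<close>

inductive path_length :: "'a ugraph \<Rightarrow> ('a \<Rightarrow> real) \<Rightarrow> ('a \<Rightarrow> real) \<Rightarrow> real \<Rightarrow> bool"
  for G :: "'a ugraph" where
  path_length_refl: "x \<in> points G \<Longrightarrow> path_length G x x 0"
| path_length_step: "path_length G x y l \<Longrightarrow> e \<in> edges G \<Longrightarrow> y \<in> cell e \<Longrightarrow> z \<in> cell e \<Longrightarrow> v \<in> e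
     \<Longrightarrow> path_length G x z (l + \<bar>y v - z v\<bar>)"

definition path_dist :: "'a ugraph \<Rightarrow> ('a \<Rightarrow> real) \<Rightarrow> ('a \<Rightarrow> real) \<Rightarrow> real" where
  "path_dist G x y = Inf {l. path_length G x y l}"


section \<open>Quasi-isometries\<close>

definition quasi_isometric ::
  "'x set \<Rightarrow> ('x \<Rightarrow> 'x \<Rightarrow> real) \<Rightarrow> 'y set \<Rightarrow> ('y \<Rightarrow> 'y \<Rightarrow> real) \<Rightarrow> bool" where
  "quasi_isometric X dX Y dY \<longleftrightarrow> (\<exists>F\<in>X \<rightarrow> Y. \<exists>L\<ge>1. \<exists>A\<ge>0.
     (\<forall>x\<in>X. \<forall>y\<in>X. dX x y / L - A \<le> dY (F x) (F y) \<and> dY (F x) (F y) \<le> L * dX x y + A) \<and>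
     (\<forall>y\<in>Y. \<exists>x\<in>X. dY y (F x) \<le> A))"

definition one_quasi_isometric ::
  "real \<Rightarrow> 'x set \<Rightarrow> ('x \<Rightarrow> 'x \<Rightarrow> real) \<Rightarrow> 'y set \<Rightarrow> ('y \<Rightarrow> 'y \<Rightarrow> real) \<Rightarrow> bool" where
  "one_quasi_isometric K X dX Y dY \<longleftrightarrow> (\<exists>F\<in>X \<rightarrow> Y.
     (\<forall>x\<in>X. \<forall>y\<in>X. \<bar>dY (F x) (F y) - dX x y\<bar> \<le> K) \<and>
     (\<forall>y\<in>Y. \<exists>x\<in>X. dY y (F x) \<le> K))"

end

theory Submission imports Defs
begin

text \<open>If \<open>H\<close> is outerplanar, then \<open>G\<close> contains no fat \<open>K\<^sub>2\<^sub>,\<^sub>3\<close>: thickening its image in \<open>H\<close> would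
  give a theta graph all of whose arcs have an inner vertex on the boundary of one face, which
  the Jordan curve theorem forbids. Now fix a root \<open>r\<close> and cut every sphere around \<open>r\<close> into
  clusters, the traces of the components of the complement of the open ball. The absence of a fat
  \<open>K\<^sub>2\<^sub>,\<^sub>3\<close> implies that a cluster either has bounded diameter or consists of two bounded pieces
  far apart, and that at most one component above a cluster of the second kind touches both pieces.
  Hence the quotient of \<open>G\<close> by the pieces is a cactus: each of its cycles consists of two
  descending sides between a top and a bottom. The quotient map is 1-Lipschitz and
  preserves the distance to \<open>r\<close>. A geodesic of the cactus that descends and ascends once
  lifts to \<open>G\<close> at bounded cost along geodesics to \<open>r\<close>; otherwise it runs over the top
  \<open>z\<close> of a cycle, and then both halves, from \<open>z\<close> to its ends, are of that kind.\<close>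

section \<open>Theta curves in the plane\<close>

text \<open>What keeps the multiplicative constant at one: the quotient preserves distances to
  \<open>r\<close>, so a lifted path loses length only when it moves sideways inside a piece, at
  most \<open>15 * M\<close> each time. A geodesic of the cactus may traverse arbitrarily many
  cycles, and a lift cycle by cycle would add up these losses without bound. Following geodesics to
  \<open>r\<close> instead costs one sideways move for a descent followed by an ascent. With two
  such halves and one more move inside the piece at the common top there are three, whence
  \<open>45 * M\<close>. The constants depend on each other. Spokes of length \<open>M\<close> must
  stay \<open>M\<close> apart, so three points of a cluster cannot be pairwise more than
  \<open>3 * M\<close> apart. A piece with a partner in its cluster thus has diameter at most
  \<open>3 * M\<close>, and vertices that have climbed \<open>M\<close> levels above it are within
  \<open>4 * M\<close> of each of its points; two hubs of that radius stay \<open>M\<close> apart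
  because different pieces are more than \<open>9 * M\<close> apart. The diameter bound of an
  arbitrary piece is \<open>15 * M\<close>, that is \<open>3 * M + 9 * M + 3 * M\<close>.\<close>

text \<open>The third arc has a point in the closure of \<open>F\<close>, hence enters the inside of
  the closed curve and divides it into two regions. The connected set \<open>F\<close> lies in one
  of them, and the closure of that region misses the open arc, first or second, that bounds only the
  other.\<close>

lemma theta_inside:
  fixes c1 c2 c3 :: "real \<Rightarrow> complex"
  assumes arcs: "arc c1" "arc c2" "arc c3"
    and ends: "pathstart c1 = a" "pathfinish c1 = b" "pathstart c2 = a" "pathfinish c2 = b"
      "pathstart c3 = a" "pathfinish c3 = b"
    and int: "path_image c1 \<inter> path_image c2 = {a, b}" "path_image c1 \<inter> path_image c3 = {a, b}"
      "path_image c2 \<inter> path_image c3 = {a, b}"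
    and F: "connected F" "F \<inter> (path_image c1 \<union> path_image c2 \<union> path_image c3) = {}"
    and q: "q1 \<in> path_image c1 - {a, b}" "q2 \<in> path_image c2 - {a, b}" "q3 \<in> path_image c3 - {a, b}"
    and cl: "q1 \<in> closure F" "q2 \<in> closure F" "q3 \<in> closure F"
    and sub: "F \<subseteq> inside (path_image c1 \<union> path_image c2)"
  shows False
proof -
  let ?I = "\<lambda>c d. inside (path_image c \<union> path_image d)"
  have ab: "a \<noteq> b"
    using arcs(1) ends(1,2) by (metis arc_distinct_ends)
  have closed: "closed (path_image c \<union> path_image d)" if "arc c" "arc d" for c d :: "real \<Rightarrow> complex"
    using that by (simp add: closed_arc_image closed_Un)
  have clI: "closure (?I c d) \<subseteq> ?I c d \<union> path_image c \<union> path_image d" if "arc c" "arc d" for c d :: "real \<Rightarrow> complex"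
    using closure_inside_subset[OF closed[OF that]] by auto
  have q3: "q3 \<in> ?I c1 c2"
    using cl(3) closure_mono[OF sub] clI[OF arcs(1,2)] q(3) int by blast
  have "?I c1 c3 \<inter> ?I c2 c3 = {} \<and> ?I c1 c3 \<union> ?I c2 c3 \<union> (path_image c3 - {a, b}) = ?I c1 c2"
  proof (rule split_inside_simple_closed_curve[of c1 a b c2 c3])
    show "path_image c3 \<inter> ?I c1 c2 \<noteq> {}" using q3 q(3) by blast
  qed (use arcs ends ab int in \<open>auto intro: arc_imp_simple_path\<close>)
  then have disj: "?I c1 c3 \<inter> ?I c2 c3 = {}"
    and un: "?I c1 c3 \<union> ?I c2 c3 \<union> (path_image c3 - {a, b}) = ?I c1 c2" by auto
  have op: "open (?I c1 c3)" "open (?I c2 c3)"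
    using open_inside closed arcs by blast+
  have "F \<subseteq> ?I c1 c3 \<union> ?I c2 c3"
    using sub un F(2) by blast
  then have "F \<subseteq> ?I c1 c3 \<or> F \<subseteq> ?I c2 c3"
    using connectedD[OF F(1) op] disj by blast
  then show False
  proof
    assume "F \<subseteq> ?I c1 c3"
    then have "q2 \<in> ?I c1 c3"
      using cl(2) closure_mono[of F] clI[OF arcs(1,3)] q(2) int by blast
    then have "q2 \<in> ?I c1 c2" using un by blast
    then show False using q(2) inside_no_overlap by blast
  next
    assume "F \<subseteq> ?I c2 c3"
    then have "q1 \<in> ?I c2 c3"
      using cl(1) closure_mono[of F] clI[OF arcs(2,3)] q(1) int by blast
    then have "q1 \<in> ?I c1 c2" using un by blast
    then show False using q(1) inside_no_overlap by blast
  qed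
qed

text \<open>If \<open>F\<close> lies outside the closed curve formed by the first two arcs, an inversion at a point
  inside that curve reduces to the previous case.\<close>

lemma theta_no_common_face:
  fixes c1 c2 c3 :: "real \<Rightarrow> complex"
  assumes arcs: "arc c1" "arc c2" "arc c3"
    and ends: "pathstart c1 = a" "pathfinish c1 = b" "pathstart c2 = a" "pathfinish c2 = b"
      "pathstart c3 = a" "pathfinish c3 = b"
    and int: "path_image c1 \<inter> path_image c2 = {a, b}" "path_image c1 \<inter> path_image c3 = {a, b}"
      "path_image c2 \<inter> path_image c3 = {a, b}"
    and F: "connected F" "F \<inter> (path_image c1 \<union> path_image c2 \<union> path_image c3) = {}"
    and q: "q1 \<in> path_image c1 - {a, b}" "q2 \<in> path_image c2 - {a, b}" "q3 \<in> path_image c3 - {a, b}"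
    and cl: "q1 \<in> closure F" "q2 \<in> closure F" "q3 \<in> closure F"
  shows False
proof -
  define S where "S = path_image c1 \<union> path_image c2"
  have ab: "a \<noteq> b"
    using arcs(1) ends(1,2) by (metis arc_distinct_ends)
  have clS: "closed S" unfolding S_def using arcs by (simp add: closed_arc_image closed_Un)
  have sp: "simple_path (c1 +++ reversepath c2)"
    using arcs ends int by (subst simple_path_join_loop_eq) (auto simp: arc_reversepath)
  have S_eq: "S = path_image (c1 +++ reversepath c2)"
    unfolding S_def using ends by (subst path_image_join) auto
  have loop: "pathfinish (c1 +++ reversepath c2) = pathstart (c1 +++ reversepath c2)"
    using ends by simp
  note J = Jordan_inside_outside[OF sp loop, folded S_eq]
  have "F \<subseteq> inside S \<or> F \<subseteq> outside S"
    using inside_outside_intersect_connected[OF F(1), of S] F(2) inside_Un_outside[of S]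
    unfolding S_def by blast
  then show False
  proof
    assume "F \<subseteq> inside S"
    then show False using theta_inside[OF arcs ends int F q cl] by (simp add: S_def)
  next
    assume out: "F \<subseteq> outside S"
    obtain z0 where z0: "z0 \<in> inside S" using J by blast
    have z0S: "z0 \<notin> S" using z0 inside_no_overlap by blast
    have "closure F \<subseteq> outside S \<union> S"
      using closure_mono[OF out] closure_outside_subset[OF clS] by blast
    then have q3o: "q3 \<in> outside S" using q(3) cl(3) int unfolding S_def by blast
    \<comment> \<open>The inversion is defined along the third arc only if that arc avoids
      \<open>z0\<close>, so the whole open arc is first placed outside.\<close>
    have "connected (path_image c3 - {a, b})"
      using connected_simple_path_endless[OF arc_imp_simple_path[OF arcs(3)]] ends by simp
    moreover have "(path_image c3 - {a, b}) \<inter> S = {}" unfolding S_def using int by blast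
    ultimately have "path_image c3 - {a, b} \<subseteq> outside S"
      using inside_outside_intersect_connected[of "path_image c3 - {a, b}" S] q3o q(3)
        inside_Un_outside[of S] by blast
    moreover have "a \<in> S" "b \<in> S" unfolding S_def using int by auto
    ultimately have z0c: "z0 \<notin> path_image c1" "z0 \<notin> path_image c2" "z0 \<notin> path_image c3"
      using z0 z0S inside_Int_outside[of S] S_def by blast+
    have z0F: "z0 \<notin> F" using out z0 inside_Int_outside[of S] by blast
    define \<phi> where "\<phi> = (\<lambda>z::complex. inverse (z - z0))"
    \<comment> \<open>The convention \<open>inverse 0 = 0\<close> makes \<open>\<phi>\<close>
      injective on the whole plane; only continuity has to keep away from \<open>z0\<close>.\<close>
    have inj: "inj_on \<phi> X" for X unfolding \<phi>_def inj_on_def by simp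
    have cont: "continuous_on X \<phi>" if "z0 \<notin> X" for X
      unfolding \<phi>_def using that by (intro continuous_intros) auto
    have arc\<phi>: "arc (\<phi> \<circ> c)" if "arc c" "z0 \<notin> path_image c" for c
      using that inj unfolding arc_def
      by (auto intro!: path_continuous_image cont comp_inj_on)
    note pi = path_image_compose
    have im: "\<phi> ` X \<inter> \<phi> ` Y = \<phi> ` (X \<inter> Y)" for X Y
      using inj[of UNIV] by (simp add: image_Int)
    have clo: "\<phi> q \<in> closure (\<phi> ` F)" if "q \<in> closure F" "q \<noteq> z0" for q
    proof -
      have "isCont \<phi> q" unfolding \<phi>_def using that by (intro continuous_intros) auto
      then show ?thesis using that(1) unfolding closure_sequential
        by (metis (no_types, lifting) comp_apply continuous_at_sequentially image_eqI)
    qed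
    have qz: "q1 \<noteq> z0" "q2 \<noteq> z0" "q3 \<noteq> z0" using q z0c by auto
    \<comment> \<open>If \<open>\<phi> x\<close> were outside the inverted curve, pulling that outer
      region back would give a connected set avoiding \<open>S\<close> that contains
      \<open>x\<close>, which is outside \<open>S\<close>, and points close to \<open>z0\<close>,
      which are inside: points far out correspond to points near \<open>z0\<close>.\<close>
    have in': "\<phi> ` F \<subseteq> inside (path_image (\<phi> \<circ> c1) \<union> path_image (\<phi> \<circ> c2))"
    proof
      fix w assume w: "w \<in> \<phi> ` F"
      then obtain x where x: "x \<in> F" "w = \<phi> x" by blast
      have SS: "path_image (\<phi> \<circ> c1) \<union> path_image (\<phi> \<circ> c2) = \<phi> ` S"
        by (auto simp: pi S_def)
      have wS: "w \<notin> \<phi> ` S" using x F(2) inj[of UNIV] unfolding S_def by (auto dest: injD)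
      have comp: "compact (\<phi> ` S)"
        by (intro compact_continuous_image cont z0S) (simp add: S_def arcs compact_Un compact_arc_image)
      show "w \<in> inside (path_image (\<phi> \<circ> c1) \<union> path_image (\<phi> \<circ> c2))"
      proof (rule ccontr)
        assume "w \<notin> inside (path_image (\<phi> \<circ> c1) \<union> path_image (\<phi> \<circ> c2))"
        then have wo: "w \<in> outside (\<phi> ` S)"
          using wS SS by (metis ComplI UnE inside_Un_outside)
        \<comment> \<open>The point 0 corresponds to infinity, and \<open>inverse\<close> is
          discontinuous there; an open connected subset of the plane stays connected when a point is
          deleted.\<close>
        define O' where "O' = outside (\<phi> ` S) - {0}"
        have "connected (outside (\<phi> ` S))"
          using comp by (simp add: connected_outside compact_imp_bounded)
        moreover have "open (outside (\<phi> ` S))" using comp by (simp add: open_outside compact_imp_closed)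
        ultimately have cO: "connected O'" unfolding O'_def
          by (intro connected_open_delete) auto
        define \<psi> where "\<psi> = (\<lambda>w::complex. z0 + inverse w)"
        have "continuous_on O' \<psi>" unfolding \<psi>_def O'_def by (intro continuous_intros) auto
        then have cpsi: "connected (\<psi> ` O')" using cO connected_continuous_image by blast
        have "\<psi> (\<phi> x) = x" unfolding \<psi>_def \<phi>_def by simp
        moreover have "w \<noteq> 0" using x z0F unfolding \<phi>_def by auto
        ultimately have xO: "x \<in> \<psi> ` O'" using x wo unfolding O'_def by force
        have "\<not> bounded (outside (\<phi> ` S))"
          using comp by (simp add: compact_imp_bounded unbounded_outside)
        then have unb: "\<exists>y\<in>outside (\<phi> ` S). B < norm y" for B
          unfolding bounded_iff by (meson not_le)
        obtain e where e: "e > 0" "ball z0 e \<subseteq> inside S"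
          using z0 open_inside[OF clS] open_contains_ball by blast
        obtain y where y: "y \<in> outside (\<phi> ` S)" "1/e < norm y" using unb by blast
        have y0: "norm y > 0" using y(2) e(1) by (smt (verit) divide_pos_pos)
        have "1 / norm y < e" using y(2) e(1) y0 by (simp add: field_simps)
        then have "norm (inverse y) < e" by (simp add: norm_inverse inverse_eq_divide norm_divide)
        then have "\<psi> y \<in> ball z0 e" unfolding \<psi>_def by (simp add: dist_norm)
        then have "\<psi> y \<in> inside S" "\<psi> y \<in> \<psi> ` O'" using e y y0 unfolding O'_def by auto
        moreover have "\<psi> ` O' \<inter> S = {}"
        proof -
          have "\<psi> u \<notin> S" if "u \<in> O'" for u
          proof
            assume "\<psi> u \<in> S"
            moreover have "\<phi> (\<psi> u) = u" unfolding \<phi>_def \<psi>_def by simp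
            ultimately have "u \<in> \<phi> ` S" by force
            then show False using that outside_no_overlap unfolding O'_def by blast
          qed
          then show ?thesis by blast
        qed
        moreover have "x \<in> outside S" using x out by blast
        ultimately show False
          using inside_outside_intersect_connected[OF cpsi, of S] xO by blast
      qed
    qed
    have im2: "path_image (\<phi> \<circ> c) \<inter> path_image (\<phi> \<circ> d) = {\<phi> a, \<phi> b}"
      if "path_image c \<inter> path_image d = {a, b}" for c d
      using that by (simp add: pi im)
    have q2: "\<phi> u \<in> path_image (\<phi> \<circ> c) - {\<phi> a, \<phi> b}" if "u \<in> path_image c - {a, b}" for u c
      using that inj[of UNIV] by (auto simp: pi dest: injD)
    show False
    proof (rule theta_inside[of "\<phi> \<circ> c1" "\<phi> \<circ> c2" "\<phi> \<circ> c3" "\<phi> a" "\<phi> b" "\<phi> ` F" "\<phi> q1" "\<phi> q2" "\<phi> q3"])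
      show "\<phi> ` F \<inter> (path_image (\<phi> \<circ> c1) \<union> path_image (\<phi> \<circ> c2) \<union> path_image (\<phi> \<circ> c3)) = {}"
        using F(2) im[of F] by (simp add: pi flip: image_Un)
      show "connected (\<phi> ` F)" using F(1) z0F cont connected_continuous_image by blast
    qed (use arcs z0c in' im2 int q2[OF q(1)] q2[OF q(2)] q2[OF q(3)] clo cl qz ends in
          \<open>simp_all add: arc\<phi> pathstart_compose pathfinish_compose\<close>)
  qed
qed

section \<open>Paths in outerplanar graphs\<close>

definition adj :: "'a ugraph \<Rightarrow> 'a \<Rightarrow> 'a \<Rightarrow> bool" where
  "adj G u v \<longleftrightarrow> {u, v} \<in> edges G"

text \<open>The conjunct \<open>x \<in> S\<close> excludes the empty walk at a vertex outside
  \<open>S\<close>, so both ends always lie in \<open>S\<close>.\<close>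

definition linked :: "'a ugraph \<Rightarrow> 'a set \<Rightarrow> 'a \<Rightarrow> 'a \<Rightarrow> bool" where
  "linked G S x y \<longleftrightarrow> x \<in> S \<and> (\<lambda>u v. adj G u v \<and> u \<in> S \<and> v \<in> S)\<^sup>*\<^sup>* x y"

definition connected_in :: "'a ugraph \<Rightarrow> 'a set \<Rightarrow> bool" where
  "connected_in G S \<longleftrightarrow> S \<subseteq> verts G \<and> (\<forall>x\<in>S. \<forall>y\<in>S. linked G S x y)"

definition is_path :: "'a ugraph \<Rightarrow> 'a \<Rightarrow> 'a list \<Rightarrow> 'a \<Rightarrow> bool" where
  "is_path G x xs y \<longleftrightarrow> xs \<noteq> [] \<and> hd xs = x \<and> last xs = y \<and> distinct xs \<and> successively (adj G) xs"

fun path_edges :: "'a list \<Rightarrow> 'a set set" where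
  "path_edges (u # v # xs) = insert {u, v} (path_edges (v # xs))"
| "path_edges _ = {}"

lemma adj_sym: "adj G u v \<longleftrightarrow> adj G v u"
  by (simp add: adj_def insert_commute)

lemma adjD:
  assumes "simple_graph G" "adj G u v"
  shows "u \<in> verts G" "v \<in> verts G" "u \<noteq> v"
  using assms unfolding simple_graph_def adj_def by (auto dest!: bspec)

lemma linked_refl: "x \<in> S \<Longrightarrow> linked G S x x"
  by (simp add: linked_def)

lemma linked_step: "linked G S x y \<Longrightarrow> adj G y z \<Longrightarrow> z \<in> S \<Longrightarrow> linked G S x z"
  unfolding linked_def
  by (metis (mono_tags, lifting) rtranclp.simps)

lemma linked_induct [consumes 1, case_names refl step]:
  assumes "linked G S x y"
    and "x \<in> S \<Longrightarrow> P x"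
    and "\<And>y z. linked G S x y \<Longrightarrow> P y \<Longrightarrow> adj G y z \<Longrightarrow> z \<in> S \<Longrightarrow> P z"
  shows "P y"
proof -
  have "(\<lambda>u v. adj G u v \<and> u \<in> S \<and> v \<in> S)\<^sup>*\<^sup>* x y" "x \<in> S" using assms(1) by (auto simp: linked_def)
  then show ?thesis
  proof (induction rule: rtranclp_induct)
    case base then show ?case using assms(2) by blast
  next
    case (step y z)
    then show ?case using assms(3)[of y z] by (simp add: linked_def)
  qed
qed

lemma linked_in: "linked G S x y \<Longrightarrow> x \<in> S \<and> y \<in> S"
  by (induction rule: linked_induct) (auto simp: linked_def)

lemma linked_trans:
  assumes "linked G S x y" "linked G S y z" shows "linked G S x z"
  using assms(2,1) by (induction rule: linked_induct) (auto intro: linked_step)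

lemma linked_sym:
  assumes "linked G S x y" shows "linked G S y x"
  using assms
proof (induction rule: linked_induct)
  case refl then show ?case by (rule linked_refl)
next
  case (step y z)
  then have "linked G S z y" using linked_step[OF linked_refl[of z S G], of y]
    by (metis adj_sym linked_in)
  then show ?case using step linked_trans by metis
qed

lemma linked_mono: "linked G S x y \<Longrightarrow> S \<subseteq> T \<Longrightarrow> linked G T x y"
proof (induction rule: linked_induct)
  case refl then show ?case by (auto intro: linked_refl)
next
  case (step y z) then show ?case by (auto intro: linked_step)
qed

lemma connected_in_linked:
  assumes "S \<subseteq> verts G" shows "connected_in G {y. linked G S x y}"
proof -
  have "linked G {y. linked G S x y} x y" if "linked G S x y" for y
    using that
  proof (induction rule: linked_induct)
    case refl then show ?case by (simp add: linked_refl)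
  next
    case (step y z)
    then show ?case using linked_step[of G S x y z] linked_step[of G _ x y z] by blast
  qed
  then show ?thesis unfolding connected_in_def
    using assms linked_in[of G S x] by (blast intro: linked_trans linked_sym)
qed

lemma connected_inI:
  assumes "S \<subseteq> verts G" "\<And>y. y \<in> S \<Longrightarrow> linked G S x y"
  shows "connected_in G S"
  using assms unfolding connected_in_def by (blast intro: linked_trans linked_sym)

text \<open>The walk is kept simple while it grows: a step to a vertex already visited cuts the path
  back to that vertex.\<close>

lemma linked_path:
  assumes "linked G S x y"
  shows "\<exists>xs. is_path G x xs y \<and> set xs \<subseteq> S"
  using assms
proof (induction rule: linked_induct)
  case refl
  then have "is_path G x [x] x \<and> set [x] \<subseteq> S" by (simp add: is_path_def)
  then show ?case by blast
next
  case (step y z)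
  then obtain xs where xs: "is_path G x xs y" "set xs \<subseteq> S" by blast
  show ?case
  proof (cases "z \<in> set xs")
    case True
    then obtain us vs where "xs = us @ z # vs" by (meson split_list)
    then have "is_path G x (us @ [z]) z" "set (us @ [z]) \<subseteq> S"
      using xs unfolding is_path_def by (auto simp: successively_append_iff hd_append split: if_splits)
    then show ?thesis by blast
  next
    case False
    then have "is_path G x (xs @ [z]) z" "set (xs @ [z]) \<subseteq> S"
      using xs step unfolding is_path_def by (auto simp: successively_append_iff)
    then show ?thesis by blast
  qed
qed

lemma is_path_rev: "is_path G x xs y \<Longrightarrow> is_path G y (rev xs) x"
  unfolding is_path_def by (auto simp: hd_rev last_rev adj_sym elim: successively_mono)

lemma is_path_append:
  "is_path G x xs y \<Longrightarrow> is_path G y (y # zs) z \<Longrightarrow> set xs \<inter> set zs = {} \<Longrightarrow> is_path G x (xs @ zs) z"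
  unfolding is_path_def by (auto simp: successively_append_iff successively_Cons)

text \<open>Cut at the last visit to \<open>A\<close>, then at the first later visit to
  \<open>B\<close>. Since \<open>A\<close> and \<open>B\<close> are not adjacent, something remains
  in between.\<close>

lemma path_between:
  assumes p: "is_path G x xs y" and xy: "x \<in> A" "y \<in> B"
    and AB: "A \<inter> B = {}" "\<And>a b. a \<in> A \<Longrightarrow> b \<in> B \<Longrightarrow> \<not> adj G a b"
  obtains a ws b where "a \<in> A" "b \<in> B" "ws \<noteq> []" "set ws \<inter> (A \<union> B) = {}"
    "is_path G a (a # ws @ [b]) b" "set (a # ws @ [b]) \<subseteq> set xs"
proof -
  have xs: "xs \<noteq> []" "hd xs = x" "last xs = y" using p by (auto simp: is_path_def)
  then have "\<exists>x\<in>set xs. x \<in> A" using xy(1) hd_in_set by metis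
  then obtain ys a zs where 1: "xs = ys @ a # zs" "a \<in> A" "\<forall>z\<in>set zs. z \<notin> A"
    by (rule split_list_last_propE) blast
  have "y \<notin> A" using xy(2) AB(1) by blast
  then have "zs \<noteq> []" using 1(1,2) xs(3) by auto
  then have "y \<in> set zs" using 1(1) xs(3) by auto
  then have "\<exists>x\<in>set zs. x \<in> B" using xy(2) by blast
  then obtain ws b us where 2: "zs = ws @ b # us" "b \<in> B" "\<forall>z\<in>set ws. z \<notin> B"
    by (rule split_list_first_propE) blast
  have path: "is_path G a (a # ws @ [b]) b"
    using p unfolding 1(1) 2(1) is_path_def
    by (auto simp: successively_append_iff successively_Cons hd_append split: if_splits)
  moreover have "ws \<noteq> []" using path AB(2)[OF 1(2) 2(2)] by (auto simp: is_path_def)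
  moreover have "set ws \<inter> (A \<union> B) = {}" "set (a # ws @ [b]) \<subseteq> set xs"
    using 1(1,3) 2(1,3) by auto
  ultimately show ?thesis using that[OF 1(2) 2(2)] by blast
qed

text \<open>Join \<open>a1\<close> to \<open>a2\<close>, then follow a path from \<open>a3\<close>
  until it first meets that join; the meeting point is \<open>c\<close>. A leg may consist of
  \<open>c\<close> alone.\<close>

lemma tripod:
  assumes A: "connected_in G A" and a: "a1 \<in> A" "a2 \<in> A" "a3 \<in> A"
  obtains c xs1 xs2 xs3 where
    "is_path G c xs1 a1" "is_path G c xs2 a2" "is_path G c xs3 a3"
    "set xs1 \<subseteq> A" "set xs2 \<subseteq> A" "set xs3 \<subseteq> A"
    "set xs1 \<inter> set xs2 = {c}" "set xs1 \<inter> set xs3 = {c}" "set xs2 \<inter> set xs3 = {c}"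
proof -
  obtain ps where ps: "is_path G a1 ps a2" "set ps \<subseteq> A"
    using A a linked_path unfolding connected_in_def by metis
  obtain qs where qs: "is_path G a3 qs a1" "set qs \<subseteq> A"
    using A a linked_path unfolding connected_in_def by metis
  have "a1 \<in> set ps" "a1 \<in> set qs" using ps qs unfolding is_path_def by (metis hd_in_set, metis last_in_set)
  then have "\<exists>x\<in>set qs. x \<in> set ps" by blast
  then obtain ys c zs where 1: "qs = ys @ c # zs" "c \<in> set ps" "\<forall>y\<in>set ys. y \<notin> set ps"
    by (rule split_list_first_propE) blast
  obtain us vs where 2: "ps = us @ c # vs" using 1(2) by (meson split_list)
  have prefix: "is_path G x (us @ [c]) c" "is_path G c (c # vs) y"
    if "is_path G x (us @ c # vs) y" for x y us vs
    using that unfolding is_path_def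
    by (auto simp: successively_append_iff successively_Cons hd_append split: if_splits)
  have "is_path G a1 (us @ [c]) c" "is_path G a3 (ys @ [c]) c" and "is_path G c (c # vs) a2"
    using prefix[of a1 us vs a2] prefix[of a3 ys zs a1] ps(1) qs(1) unfolding 1(1) 2 by simp_all
  then have "is_path G c (rev (us @ [c])) a1" "is_path G c (c # vs) a2" "is_path G c (rev (ys @ [c])) a3"
    by (simp_all only: is_path_rev)
  then show ?thesis
  proof (rule that)
    show "set (rev (us @ [c])) \<inter> set (c # vs) = {c}" using ps(1) unfolding 2 is_path_def by auto
    show "set (rev (us @ [c])) \<inter> set (rev (ys @ [c])) = {c}" "set (c # vs) \<inter> set (rev (ys @ [c])) = {c}"
      using 1(3) unfolding 2 by auto
  qed (use ps(2) qs(2) 1(1) 2 in auto)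
qed

lemma path_edges_subset: "e \<in> path_edges xs \<Longrightarrow> e \<subseteq> set xs"
  by (induction xs rule: path_edges.induct) auto

lemma path_edges_graph: "successively (adj G) xs \<Longrightarrow> path_edges xs \<subseteq> edges G"
  by (induction xs rule: path_edges.induct) (auto simp: adj_def)

lemma path_edges_cover:
  "2 \<le> length xs \<Longrightarrow> x \<in> set xs \<Longrightarrow> \<exists>e\<in>path_edges xs. x \<in> e"
proof (induction xs rule: path_edges.induct)
  case (1 u v xs) then show ?case by (cases xs) auto
qed auto

text \<open>Two paths that meet only in their ends could still share the edge between these ends; an
  inner vertex rules this out.\<close>

lemma path_edges_ends:
  assumes "is_path G x xs y" "w \<in> set xs - {x, y}"
  shows "{x, y} \<notin> path_edges xs"
proof
  assume e: "{x, y} \<in> path_edges xs"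
  obtain v us where xs: "xs = x # v # us"
    using assms unfolding is_path_def by (cases xs; cases "tl xs") auto
  have "x \<notin> set (v # us)" using assms unfolding xs is_path_def by auto
  then have "{x, y} = {x, v}" using e path_edges_subset[of "{x, y}" "v # us"] unfolding xs by auto
  then have "y = v" by (auto simp: doubleton_eq_iff)
  then have "us = []" using assms(1) unfolding xs is_path_def by (auto split: if_splits)
  then show False using assms(2) \<open>y = v\<close> xs by auto
qed

lemma plane_drawing_Int:
  "plane_drawing G p \<gamma> \<Longrightarrow> e \<in> edges G \<Longrightarrow> f \<in> edges G \<Longrightarrow> e \<noteq> f \<Longrightarrow>
    path_image (\<gamma> e) \<inter> path_image (\<gamma> f) \<subseteq> p ` (e \<inter> f)"
  by (simp add: plane_drawing_def)

lemma arc_of_path: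
  assumes D: "plane_drawing G p \<gamma>" and "is_path G x xs y" "x \<noteq> y"
  shows "\<exists>g. arc g \<and> pathstart g = p x \<and> pathfinish g = p y \<and>
    path_image g = (\<Union>e\<in>path_edges xs. path_image (\<gamma> e))"
  using assms(2,3)
proof (induction xs arbitrary: x)
  case Nil then show ?case by (simp add: is_path_def)
next
  case (Cons x0 xs)
  then have [simp]: "x0 = x" by (simp add: is_path_def)
  obtain v us where xs: "xs = v # us"
    using Cons.prems unfolding is_path_def by (cases xs) auto
  have e: "{x, v} \<in> edges G" using Cons.prems xs unfolding is_path_def adj_def by auto
  then have "arc (\<gamma> {x, v})" "{pathstart (\<gamma> {x, v}), pathfinish (\<gamma> {x, v})} = {p x, p v}"
    using D unfolding plane_drawing_def by auto
  \<comment> \<open>The drawing gives the ends of an arc as an unordered pair, so the arc may have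
    to be reversed.\<close>
  then have "\<exists>g. arc g \<and> pathstart g = p x \<and> pathfinish g = p v \<and> path_image g = path_image (\<gamma> {x, v})"
    by (metis arc_reversepath doubleton_eq_iff path_image_reversepath pathfinish_reversepath
        pathstart_reversepath)
  then obtain g where g: "arc g" "pathstart g = p x" "pathfinish g = p v"
    "path_image g = path_image (\<gamma> {x, v})" by blast
  show ?case
  proof (cases "v = y")
    case True
    then have "us = []" using Cons.prems unfolding xs is_path_def by (auto split: if_splits)
    then show ?thesis using g True xs by auto
  next
    case False
    moreover have path: "is_path G v xs y" using Cons.prems unfolding xs is_path_def by auto
    ultimately obtain h where h: "arc h" "pathstart h = p v" "pathfinish h = p y"
      "path_image h = (\<Union>e\<in>path_edges xs. path_image (\<gamma> e))" using Cons.IH by blast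
    have "path_image (\<gamma> {x, v}) \<inter> path_image (\<gamma> f) \<subseteq> {p v}" if f: "f \<in> path_edges xs" for f
    proof -
      have "x \<notin> f" using path_edges_subset[OF f] Cons.prems unfolding is_path_def by auto
      then have "f \<noteq> {x, v}" "{x, v} \<inter> f \<subseteq> {v}" by auto
      moreover have "f \<in> edges G"
        using f path path_edges_graph unfolding is_path_def by blast
      ultimately have "path_image (\<gamma> {x, v}) \<inter> path_image (\<gamma> f) \<subseteq> p ` ({x, v} \<inter> f)"
        using plane_drawing_Int[OF D e] by metis
      also have "\<dots> \<subseteq> {p v}" using \<open>{x, v} \<inter> f \<subseteq> {v}\<close> by blast
      finally show ?thesis .
    qed
    then have "arc (g +++ h)" using g h by (intro arc_join) auto
    then show ?thesis using g h
      by (intro exI[of _ "g +++ h"]) (auto simp: path_image_join xs)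
  qed
qed

text \<open>The drawing turns the three paths into a theta curve that avoids the face
  \<open>F\<close>; as all vertices lie on the frontier of \<open>F\<close>, the inner vertices are
  the three points required in its closure.\<close>

lemma outerplanar_no_theta:
  assumes "outerplanar G" and cd: "c \<noteq> d"
    and path: "is_path G c xs1 d" "is_path G c xs2 d" "is_path G c xs3 d"
    and int: "set xs1 \<inter> set xs2 = {c, d}" "set xs1 \<inter> set xs3 = {c, d}" "set xs2 \<inter> set xs3 = {c, d}"
    and w: "w1 \<in> set xs1 - {c, d}" "w2 \<in> set xs2 - {c, d}" "w3 \<in> set xs3 - {c, d}"
  shows False
proof -
  obtain p \<gamma> F where D: "plane_drawing G p \<gamma>" and G: "simple_graph G"
    and F: "F \<in> components (- drawing_image G p \<gamma>)" "p ` verts G \<subseteq> frontier F"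
    using assms(1) unfolding outerplanar_def by blast
  define I where "I = (\<lambda>xs. \<Union>e\<in>path_edges xs. path_image (\<gamma> e))"
  have edge: "path_edges xs \<subseteq> edges G" if "is_path G c xs d" for xs
    using that path_edges_graph unfolding is_path_def by blast
  have long: "2 \<le> length xs" if "is_path G c xs d" for xs
    using that cd unfolding is_path_def by (cases xs; cases "tl xs") auto
  have vert: "v \<in> verts G \<and> p v \<in> I xs" if P: "is_path G c xs d" "v \<in> set xs" for v xs
  proof -
    obtain e where e: "e \<in> path_edges xs" "v \<in> e"
      using path_edges_cover[OF long[OF P(1)] P(2)] by blast
    then have eG: "e \<in> edges G" using edge P(1) by blast
    then have "p v \<in> {pathstart (\<gamma> e), pathfinish (\<gamma> e)}"
      using D e(2) unfolding plane_drawing_def by blast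
    then have "p v \<in> path_image (\<gamma> e)" by auto
    then have "p v \<in> I xs" using e(1) unfolding I_def by blast
    moreover have "e \<subseteq> verts G" using G eG unfolding simple_graph_def by simp
    ultimately show ?thesis using e(2) by blast
  qed
  have cds: "c \<in> set xs" "d \<in> set xs" if "is_path G c xs d" for xs
    using that unfolding is_path_def by auto
  have II: "I xs \<inter> I ys = {p c, p d}"
    if P: "is_path G c xs d" "is_path G c ys d" "set xs \<inter> set ys = {c, d}" "v \<in> set xs - {c, d}" for xs ys v
  proof
    show "{p c, p d} \<subseteq> I xs \<inter> I ys" using vert cds P by simp
    show "I xs \<inter> I ys \<subseteq> {p c, p d}"
    proof
      fix q assume "q \<in> I xs \<inter> I ys"
      then obtain e f where ef: "e \<in> path_edges xs" "f \<in> path_edges ys"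
        "q \<in> path_image (\<gamma> e) \<inter> path_image (\<gamma> f)" unfolding I_def by blast
      have efG: "e \<in> edges G" "f \<in> edges G" using ef edge P by blast+
      have sub: "e \<inter> f \<subseteq> {c, d}" using ef path_edges_subset P(3) by blast
      have "e \<noteq> f"
      proof
        assume "e = f"
        then have "e \<subseteq> {c, d}" "card e = 2" using sub G efG unfolding simple_graph_def by auto
        then have "e = {c, d}" using cd card_subset_eq[of "{c, d}" e] by simp
        then show False using path_edges_ends P(1,4) ef(1) by metis
      qed
      then have "q \<in> p ` (e \<inter> f)" using plane_drawing_Int[OF D efG] ef(3) by blast
      then show "q \<in> {p c, p d}" using sub by blast
    qed
  qed
  have cl: "p v \<in> closure F" "p v \<in> I xs - {p c, p d}" if "is_path G c xs d" "v \<in> set xs - {c, d}" for v xs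
  proof -
    have inj: "inj_on p (verts G)" using D unfolding plane_drawing_def by blast
    show "p v \<in> closure F" using F(2) vert that unfolding frontier_def by blast
    have "c \<in> verts G" "d \<in> verts G" "v \<in> verts G" "p v \<in> I xs" using vert that cds by auto
    then show "p v \<in> I xs - {p c, p d}" using inj that(2) by (auto dest: inj_onD)
  qed
  have FI: "F \<inter> I xs = {}" if "is_path G c xs d" for xs
    using in_components_subset[OF F(1)] edge[OF that] unfolding drawing_image_def I_def by blast
  obtain g1 where g1: "arc g1" "pathstart g1 = p c" "pathfinish g1 = p d" "path_image g1 = I xs1"
    using arc_of_path[OF D path(1) cd] unfolding I_def by blast
  obtain g2 where g2: "arc g2" "pathstart g2 = p c" "pathfinish g2 = p d" "path_image g2 = I xs2"
    using arc_of_path[OF D path(2) cd] unfolding I_def by blast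
  obtain g3 where g3: "arc g3" "pathstart g3 = p c" "pathfinish g3 = p d" "path_image g3 = I xs3"
    using arc_of_path[OF D path(3) cd] unfolding I_def by blast
  show False
  proof (rule theta_no_common_face[of g1 g2 g3 "p c" "p d" F "p w1" "p w2" "p w3"])
    show "connected F" using F(1) in_components_connected by blast
    show "F \<inter> (path_image g1 \<union> path_image g2 \<union> path_image g3) = {}"
      using FI path by (simp add: g1 g2 g3 Int_Un_distrib)
  qed (use g1 g2 g3 II cl path int w in auto)
qed

text \<open>The spokes may run inside the hubs, so each is trimmed to a path whose interior avoids
  both. Tripods in \<open>A\<close> and \<open>B\<close> to the trimmed ends supply the branch
  vertices \<open>c\<close> and \<open>d\<close>, and the nonempty interiors supply the inner
  vertices of a theta graph.\<close>

lemma outerplanar_no_K23: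
  assumes "outerplanar G" and A: "connected_in G A" and B: "connected_in G B"
    and P: "connected_in G P1" "connected_in G P2" "connected_in G P3"
    and AB: "A \<inter> B = {}" "\<And>a b. a \<in> A \<Longrightarrow> b \<in> B \<Longrightarrow> \<not> adj G a b"
    and disj: "P1 \<inter> P2 = {}" "P1 \<inter> P3 = {}" "P2 \<inter> P3 = {}"
    and meet: "P1 \<inter> A \<noteq> {}" "P2 \<inter> A \<noteq> {}" "P3 \<inter> A \<noteq> {}"
      "P1 \<inter> B \<noteq> {}" "P2 \<inter> B \<noteq> {}" "P3 \<inter> B \<noteq> {}"
  shows False
proof -
  have ex: "\<exists>a ws b. a \<in> A \<and> b \<in> B \<and> ws \<noteq> [] \<and> set ws \<inter> (A \<union> B) = {} \<and>
      is_path G a (a # ws @ [b]) b \<and> set (a # ws @ [b]) \<subseteq> P"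
    if Q: "connected_in G P" "P \<inter> A \<noteq> {}" "P \<inter> B \<noteq> {}" for P
  proof -
    obtain x y where "x \<in> P" "x \<in> A" "y \<in> P" "y \<in> B" using Q by blast
    then obtain xs where "is_path G x xs y" "set xs \<subseteq> P"
      using Q(1) linked_path unfolding connected_in_def by metis
    then show ?thesis
      using path_between[OF \<open>is_path G x xs y\<close> \<open>x \<in> A\<close> \<open>y \<in> B\<close> AB] by (smt (verit) subset_trans)
  qed
  obtain a1 ws1 b1 where 1: "a1 \<in> A" "b1 \<in> B" "ws1 \<noteq> []" "set ws1 \<inter> (A \<union> B) = {}"
      "is_path G a1 (a1 # ws1 @ [b1]) b1" "set (a1 # ws1 @ [b1]) \<subseteq> P1"
    using ex[OF P(1)] meet by blast
  obtain a2 ws2 b2 where 2: "a2 \<in> A" "b2 \<in> B" "ws2 \<noteq> []" "set ws2 \<inter> (A \<union> B) = {}"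
      "is_path G a2 (a2 # ws2 @ [b2]) b2" "set (a2 # ws2 @ [b2]) \<subseteq> P2"
    using ex[OF P(2)] meet by blast
  obtain a3 ws3 b3 where 3: "a3 \<in> A" "b3 \<in> B" "ws3 \<noteq> []" "set ws3 \<inter> (A \<union> B) = {}"
      "is_path G a3 (a3 # ws3 @ [b3]) b3" "set (a3 # ws3 @ [b3]) \<subseteq> P3"
    using ex[OF P(3)] meet by blast
  obtain c xs1 xs2 xs3 where xs:
    "is_path G c xs1 a1" "is_path G c xs2 a2" "is_path G c xs3 a3"
    "set xs1 \<subseteq> A" "set xs2 \<subseteq> A" "set xs3 \<subseteq> A"
    "set xs1 \<inter> set xs2 = {c}" "set xs1 \<inter> set xs3 = {c}" "set xs2 \<inter> set xs3 = {c}"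
    by (rule tripod[OF A 1(1) 2(1) 3(1)])
  obtain d ys1 ys2 ys3 where ys:
    "is_path G d ys1 b1" "is_path G d ys2 b2" "is_path G d ys3 b3"
    "set ys1 \<subseteq> B" "set ys2 \<subseteq> B" "set ys3 \<subseteq> B"
    "set ys1 \<inter> set ys2 = {d}" "set ys1 \<inter> set ys3 = {d}" "set ys2 \<inter> set ys3 = {d}"
    by (rule tripod[OF B 1(2) 2(2) 3(2)])
  have cd: "c \<in> A" "d \<in> B" using xs(4,7) ys(4,7) by blast+
  then have "c \<noteq> d" using AB(1) by blast
  have path: "is_path G c (xs @ ws @ rev ys) d"
    if "is_path G c xs a" "is_path G d ys b" "is_path G a (a # ws @ [b]) b" "ws \<noteq> []"
      "set xs \<subseteq> A" "set ys \<subseteq> B" "set ws \<inter> (A \<union> B) = {}" for xs ys ws a b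
  proof -
    have "is_path G b (rev ys) d" by (rule is_path_rev[OF that(2)])
    then obtain us where us: "rev ys = b # us"
      unfolding is_path_def by (metis list.collapse)
    then have us': "is_path G b (b # us) d" "b \<in> B" "set us \<subseteq> B" "b \<notin> set us"
      using \<open>is_path G b (rev ys) d\<close> that(6) unfolding is_path_def
      by (simp_all flip: set_rev[of ys])
    have a: "a \<in> A" using that(1,5) unfolding is_path_def by auto
    have "is_path G c (xs @ ws @ [b]) b"
    proof (rule is_path_append[OF that(1,3)])
      show "set xs \<inter> set (ws @ [b]) = {}" using that(5,7) us'(2) AB(1) by auto
    qed
    then have "is_path G c ((xs @ ws @ [b]) @ us) d"
    proof (rule is_path_append[OF _ us'(1)])
      show "set (xs @ ws @ [b]) \<inter> set us = {}" using that(5,7) us'(3,4) AB(1) by auto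
    qed
    then show ?thesis using us by simp
  qed
  have ne: "\<exists>w. w \<in> set ws" if "ws \<noteq> []" for ws :: "'a list" using that by (cases ws) auto
  obtain w1 w2 w3 where w: "w1 \<in> set ws1" "w2 \<in> set ws2" "w3 \<in> set ws3"
    using ne[OF 1(3)] ne[OF 2(3)] ne[OF 3(3)] by blast
  have ws: "set ws1 \<inter> set ws2 = {}" "set ws1 \<inter> set ws3 = {}" "set ws2 \<inter> set ws3 = {}"
    using 1(6) 2(6) 3(6) disj by auto
  have wc: "w \<in> set (xs @ ws @ rev ys) - {c, d}" if "w \<in> set ws" "set ws \<inter> (A \<union> B) = {}" for w xs ws ys
    using that cd by auto
  show False
  proof (rule outerplanar_no_theta[OF assms(1) \<open>c \<noteq> d\<close>])
    show "is_path G c (xs1 @ ws1 @ rev ys1) d" by (rule path[OF xs(1) ys(1) 1(5,3) xs(4) ys(4) 1(4)])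
    show "is_path G c (xs2 @ ws2 @ rev ys2) d" by (rule path[OF xs(2) ys(2) 2(5,3) xs(5) ys(5) 2(4)])
    show "is_path G c (xs3 @ ws3 @ rev ys3) d" by (rule path[OF xs(3) ys(3) 3(5,3) xs(6) ys(6) 3(4)])
    have int: "set (xs @ ws @ rev ys) \<inter> set (xs' @ ws' @ rev ys') = {c, d}"
      if "set xs \<inter> set xs' = {c}" "set ys \<inter> set ys' = {d}" "set xs \<subseteq> A" "set ys \<subseteq> B"
        "set xs' \<subseteq> A" "set ys' \<subseteq> B" "set ws \<inter> (A \<union> B) = {}" "set ws' \<inter> (A \<union> B) = {}"
        "set ws \<inter> set ws' = {}" for xs ys ws xs' ys' ws' :: "'a list"
    proof -
      have "set (xs @ ws @ rev ys) \<inter> set (xs' @ ws' @ rev ys') = (set xs \<inter> set xs') \<union> (set ys \<inter> set ys')"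
        using that(3-9) AB(1) by auto
      then show ?thesis using that by auto
    qed
    show "set (xs1 @ ws1 @ rev ys1) \<inter> set (xs2 @ ws2 @ rev ys2) = {c, d}"
      by (rule int[OF xs(7) ys(7) xs(4) ys(4) xs(5) ys(5) 1(4) 2(4) ws(1)])
    show "set (xs1 @ ws1 @ rev ys1) \<inter> set (xs3 @ ws3 @ rev ys3) = {c, d}"
      by (rule int[OF xs(8) ys(8) xs(4) ys(4) xs(6) ys(6) 1(4) 3(4) ws(2)])
    show "set (xs2 @ ws2 @ rev ys2) \<inter> set (xs3 @ ws3 @ rev ys3) = {c, d}"
      by (rule int[OF xs(9) ys(9) xs(5) ys(5) xs(6) ys(6) 2(4) 3(4) ws(3)])
    show "w1 \<in> set (xs1 @ ws1 @ rev ys1) - {c, d}" by (rule wc[OF w(1) 1(4)])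
    show "w2 \<in> set (xs2 @ ws2 @ rev ys2) - {c, d}" by (rule wc[OF w(2) 2(4)])
    show "w3 \<in> set (xs3 @ ws3 @ rev ys3) - {c, d}" by (rule wc[OF w(3) 3(4)])
  qed
qed

section \<open>Graph metrics and quasi-isometries\<close>

definition gdist :: "'a ugraph \<Rightarrow> 'a \<Rightarrow> 'a \<Rightarrow> nat" where
  "gdist G u v = (LEAST n. (adj G ^^ n) u v)"

locale connected_ugraph =
  fixes G :: "'a ugraph"
  assumes connected: "connected_graph G"
begin

lemma simple: "simple_graph G"
  using connected unfolding connected_graph_def by blast

lemmas adj_verts = adjD[OF simple]

lemma gdist_walk: "u \<in> verts G \<Longrightarrow> v \<in> verts G \<Longrightarrow> (adj G ^^ gdist G u v) u v"
proof -
  assume "u \<in> verts G" "v \<in> verts G"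
  then have "(adj G)\<^sup>*\<^sup>* u v"
    using connected unfolding connected_graph_def adj_def[abs_def] by blast
  then show ?thesis unfolding gdist_def by (metis LeastI rtranclp_imp_relpowp)
qed

lemma gdist_le: "(adj G ^^ n) u v \<Longrightarrow> gdist G u v \<le> n"
  unfolding gdist_def by (rule Least_le)

lemma gdist_self [simp]: "gdist G u u = 0"
  using gdist_le[of 0 u u] by simp

lemma gdist_eq_0: "u \<in> verts G \<Longrightarrow> v \<in> verts G \<Longrightarrow> gdist G u v = 0 \<Longrightarrow> u = v"
  using gdist_walk[of u v] by simp

lemma relpowp_adj_sym: "(adj G ^^ n) u v \<Longrightarrow> (adj G ^^ n) v u"
proof (induction n arbitrary: v)
  case (Suc n)
  then obtain w where "(adj G ^^ n) u w" "adj G w v" by auto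
  then show ?case using Suc.IH relpowp_Suc_I2[of "adj G" v w n u] by (metis adj_sym)
qed simp

lemma gdist_sym: "u \<in> verts G \<Longrightarrow> v \<in> verts G \<Longrightarrow> gdist G u v = gdist G v u"
  by (rule le_antisym; rule gdist_le, rule relpowp_adj_sym, rule gdist_walk)

lemma gdist_triangle:
  "u \<in> verts G \<Longrightarrow> v \<in> verts G \<Longrightarrow> w \<in> verts G \<Longrightarrow> gdist G u w \<le> gdist G u v + gdist G v w"
  by (rule gdist_le[OF relpowp_trans[OF gdist_walk gdist_walk]])

lemma gdist_adj: "adj G u v \<Longrightarrow> gdist G u v \<le> 1"
  using gdist_le[of 1 u v] by (simp only: relpowp_1)

lemma gdist_Suc: "u \<in> verts G \<Longrightarrow> adj G v w \<Longrightarrow> gdist G u w \<le> gdist G u v + 1"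
  using gdist_triangle[of u v w] gdist_adj[of v w] adj_verts[of v w] by simp

lemma gdist_between:
  assumes "u \<in> verts G" "v \<in> verts G" "i \<le> gdist G u v"
  obtains w where "w \<in> verts G" "gdist G u w = i" "gdist G w v = gdist G u v - i"
proof -
  have "(adj G ^^ (i + (gdist G u v - i))) u v" using gdist_walk assms by simp
  then obtain w where w: "(adj G ^^ i) u w" "(adj G ^^ (gdist G u v - i)) w v"
    unfolding relpowp_add by auto
  have "w \<in> verts G"
  proof (cases "i = 0")
    case True then show ?thesis using w assms by simp
  next
    case False
    then show ?thesis using w(1) adj_verts by (cases i) auto
  qed
  moreover from this have "gdist G u v \<le> gdist G u w + gdist G w v" using gdist_triangle assms by blast
  ultimately show ?thesis using that gdist_le[OF w(1)] gdist_le[OF w(2)] assms(3) by auto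
qed

lemma gdist_prev:
  assumes "u \<in> verts G" "v \<in> verts G" "u \<noteq> v"
  obtains w where "w \<in> verts G" "adj G w v" "gdist G u v = Suc (gdist G u w)"
proof -
  have "gdist G u v \<noteq> 0" using gdist_eq_0 assms by blast
  then obtain w where w: "w \<in> verts G" "gdist G u w = gdist G u v - 1" "gdist G w v = 1"
    using gdist_between[of u v "gdist G u v - 1"] assms by auto
  then have "adj G w v" using gdist_walk[of w v] assms by (simp only: relpowp_1)
  then show ?thesis using that w \<open>gdist G u v \<noteq> 0\<close> by auto
qed

text \<open>\<open>S\<close> only has to contain the vertices on geodesics from \<open>u\<close> to
  \<open>v\<close>. Dropping the last vertex of a geodesic preserves this, since a vertex between
  \<open>u\<close> and \<open>v'\<close> is also between \<open>u\<close> and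
  \<open>v\<close>.\<close>

lemma linked_geodesic:
  assumes "u \<in> verts G" "v \<in> verts G"
    and "\<And>w. w \<in> verts G \<Longrightarrow> gdist G u w + gdist G w v = gdist G u v \<Longrightarrow> w \<in> S"
  shows "linked G S u v"
  using assms
proof (induction "gdist G u v" arbitrary: v)
  case 0
  then have "u = v" using gdist_eq_0 by metis
  then show ?case using 0 by (auto intro: linked_refl)
next
  case (Suc n)
  then have "u \<noteq> v" by auto
  then obtain v' where v': "v' \<in> verts G" "adj G v' v" "gdist G u v = Suc (gdist G u v')"
    using gdist_prev Suc.prems by metis
  have "linked G S u v'"
  proof (rule Suc.hyps(1))
    fix w assume w: "w \<in> verts G" "gdist G u w + gdist G w v' = gdist G u v'"
    have "gdist G w v \<le> Suc (gdist G w v')" using gdist_Suc[OF w(1) v'(2)] by simp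
    moreover have "gdist G u v \<le> gdist G u w + gdist G w v" using gdist_triangle w Suc.prems by blast
    ultimately show "w \<in> S" using Suc.prems(3)[OF w(1)] w(2) v'(3) by simp
  qed (use Suc v' in auto)
  then show ?case using linked_step[OF _ v'(2)] Suc.prems by simp
qed

lemma connected_in_ball:
  assumes c: "c \<in> verts G"
  shows "connected_in G {w \<in> verts G. gdist G c w \<le> k}"
  by (rule connected_inI[of _ _ c]) (auto intro!: linked_geodesic c)

end

section \<open>Fat \<open>K23\<close> minors and coarse maps\<close>

definition far :: "'a ugraph \<Rightarrow> nat \<Rightarrow> 'a set \<Rightarrow> 'a set \<Rightarrow> bool" where
  "far G M X Y \<longleftrightarrow> (\<forall>x\<in>X. \<forall>y\<in>Y. M \<le> gdist G x y)"

text \<open>A spoke combines a vertex of degree two with its two edges. It may overlap the hubs;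
  distance is demanded only between the two hubs and between different spokes.\<close>

definition fat_K23 :: "'a ugraph \<Rightarrow> nat \<Rightarrow> bool" where
  "fat_K23 G M \<longleftrightarrow> (\<exists>A B P1 P2 P3. (\<forall>S\<in>{A, B, P1, P2, P3}. connected_in G S) \<and>
     far G M A B \<and> far G M P1 P2 \<and> far G M P1 P3 \<and> far G M P2 P3 \<and>
     (\<forall>P\<in>{P1, P2, P3}. P \<inter> A \<noteq> {} \<and> P \<inter> B \<noteq> {}))"

text \<open>The \<open>N\<close>-neighbourhood of the image of a connected set is connected, as
  \<open>f\<close> moves adjacent vertices at most \<open>N\<close> apart. If two such
  neighbourhoods came within distance one, the images of two vertices would be at distance at most
  \<open>2 * N + 1\<close>, and the vertices themselves at distance less than \<open>M\<close>. So
  the neighbourhoods of far sets are disjoint and not adjacent.\<close>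

lemma no_fat_K23:
  fixes G :: "'a ugraph" and H :: "'b ugraph"
  assumes G: "connected_graph G" and H: "connected_graph H" and "outerplanar H"
    and f: "\<And>x. x \<in> verts G \<Longrightarrow> f x \<in> verts H"
    and up: "\<And>x y. adj G x y \<Longrightarrow> gdist H (f x) (f y) \<le> N"
    and low: "\<And>x y. x \<in> verts G \<Longrightarrow> y \<in> verts G \<Longrightarrow> gdist G x y \<le> N * gdist H (f x) (f y) + N"
    and M: "M > N * (2 * N + 1) + N"
  shows "\<not> fat_K23 G M"
proof
  assume "fat_K23 G M"
  then obtain A B P1 P2 P3 where conn: "\<forall>S\<in>{A, B, P1, P2, P3}. connected_in G S"
    and far: "far G M A B" "far G M P1 P2" "far G M P1 P3" "far G M P2 P3"
    and meet: "\<forall>P\<in>{P1, P2, P3}. P \<inter> A \<noteq> {} \<and> P \<inter> B \<noteq> {}"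
    unfolding fat_K23_def by (elim exE conjE) (rule that)
  interpret H: connected_ugraph H by (unfold_locales) (rule H)
  define T where "T = (\<lambda>X. \<Union>x\<in>X. {w \<in> verts H. gdist H (f x) w \<le> N})"
  have sub: "X \<subseteq> verts G" if "X \<in> {A, B, P1, P2, P3}" for X
    using conn that unfolding connected_in_def by blast
  have fT: "f x \<in> T X" if "x \<in> X" "X \<subseteq> verts G" for x X
    unfolding T_def using that f by (intro UN_I[of x]) auto
  have T: "connected_in H (T X)" if "connected_in G X" "x0 \<in> X" for X x0
  proof (rule connected_inI[of _ _ "f x0"])
    show "T X \<subseteq> verts H" unfolding T_def by auto
    have X: "X \<subseteq> verts G" using that unfolding connected_in_def by blast
    have ball: "linked H (T X) (f x) w" if "x \<in> X" "w \<in> verts H" "gdist H (f x) w \<le> N" for x w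
    proof -
      have "linked H {w \<in> verts H. gdist H (f x) w \<le> N} (f x) w"
        using H.connected_in_ball[of "f x" N] f X that unfolding connected_in_def by auto
      then show ?thesis by (rule linked_mono) (use that in \<open>auto simp: T_def\<close>)
    qed
    fix w assume "w \<in> T X"
    then obtain x where x: "x \<in> X" "w \<in> verts H" "gdist H (f x) w \<le> N" unfolding T_def by auto
    have "linked G X x0 x" using that x unfolding connected_in_def by blast
    then have "linked H (T X) (f x0) (f x)"
    proof (induction rule: linked_induct)
      case refl then show ?case using fT X linked_refl by metis
    next
      case (step y z)
      then have "linked H (T X) (f y) (f z)"
        using ball[of y "f z"] up[of y z] f[of z] X linked_in[of G X x0 y] by (simp add: subset_iff)
      then show ?case using step linked_trans by metis
    qed
    then show "linked H (T X) (f x0) w" using ball[OF x] linked_trans by metis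
  qed
  have close: "gdist H a b > 1" if XY: "far G M X Y" "X \<subseteq> verts G" "Y \<subseteq> verts G" "a \<in> T X" "b \<in> T Y"
    for X Y a b
  proof (rule ccontr)
    assume ab: "\<not> 1 < gdist H a b"
    obtain x y where xy: "x \<in> X" "a \<in> verts H" "gdist H (f x) a \<le> N" "y \<in> Y" "b \<in> verts H"
      "gdist H (f y) b \<le> N" using XY(4,5) unfolding T_def by auto
    have fxy: "f x \<in> verts H" "f y \<in> verts H" using xy f XY by auto
    have "gdist H (f x) (f y) \<le> gdist H (f x) a + gdist H a (f y)"
      "gdist H a (f y) \<le> gdist H a b + gdist H b (f y)"
      using H.gdist_triangle xy fxy by blast+
    then have "gdist H (f x) (f y) \<le> 2 * N + 1"
      using xy ab H.gdist_sym[OF fxy(2) xy(5)] by linarith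
    then have "N * gdist H (f x) (f y) + N \<le> N * (2 * N + 1) + N"
      by (intro add_right_mono mult_le_mono2)
    then have "gdist G x y < M" using low[of x y] xy XY M by (meson le_less_trans subsetD)
    then show False using XY(1) xy unfolding far_def by (meson leD)
  qed
  have disj: "T X \<inter> T Y = {}" if "far G M X Y" "X \<subseteq> verts G" "Y \<subseteq> verts G" for X Y
  proof (rule ccontr)
    assume "T X \<inter> T Y \<noteq> {}"
    then obtain a where "a \<in> T X" "a \<in> T Y" by blast
    then show False using close[OF that, of a a] by simp
  qed
  have int: "T P \<inter> T X \<noteq> {}" if "P \<inter> X \<noteq> {}" "P \<subseteq> verts G" "X \<subseteq> verts G" for P X
    using fT[OF _ that(2)] fT[OF _ that(3)] that(1) by blast
  have ex: "\<exists>x. x \<in> X" if "X \<in> {A, B, P1, P2, P3}" for X using meet that by auto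
  have TT: "connected_in H (T X)" if "X \<in> {A, B, P1, P2, P3}" for X
    using T[of X] conn ex[OF that] that by metis
  show False
  proof (rule outerplanar_no_K23[OF \<open>outerplanar H\<close>, of "T A" "T B" "T P1" "T P2" "T P3"])
    show "\<not> adj H a b" if "a \<in> T A" "b \<in> T B" for a b
      using close[OF far(1) sub sub that] H.gdist_adj[of a b] by force
  qed (simp_all add: TT disj[OF far(1)] disj[OF far(2)] disj[OF far(3)] disj[OF far(4)] sub int meet)
qed

section \<open>Path metrics compared with distances between vertices\<close>

definition vertex_pt :: "'a \<Rightarrow> 'a \<Rightarrow> real" where
  "vertex_pt v = (\<lambda>u. if u = v then 1 else 0)"

lemma vertex_pt_cell: "finite e \<Longrightarrow> v \<in> e \<Longrightarrow> vertex_pt v \<in> cell e"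
  unfolding cell_def vertex_pt_def by auto

lemma cell_support: "x \<in> cell e \<Longrightarrow> 0 < x v \<Longrightarrow> v \<in> e"
  by (rule ccontr) (auto simp: cell_def)

lemma cell_singleton: "x \<in> cell {v} \<Longrightarrow> x = vertex_pt v"
  unfolding cell_def vertex_pt_def by auto

context connected_ugraph
begin

lemma vertex_pt_points: "v \<in> verts G \<Longrightarrow> vertex_pt v \<in> points G"
  unfolding points_def using vertex_pt_cell[of "{v}" v] by blast

lemma edge_ex:
  assumes "e \<in> edges G"
  shows "\<exists>a b. e = {a, b} \<and> a \<noteq> b \<and> a \<in> verts G \<and> b \<in> verts G \<and> adj G a b"
proof -
  have "e \<subseteq> verts G" "card e = 2" using simple assms unfolding simple_graph_def by auto
  then obtain a b where "e = {a, b}" "a \<noteq> b" unfolding card_2_iff by blast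
  then show ?thesis using assms \<open>e \<subseteq> verts G\<close> unfolding adj_def by blast
qed

lemma points_cases:
  assumes "x \<in> points G"
  obtains v where "v \<in> verts G" "x = vertex_pt v"
  | e where "e \<in> edges G" "x \<in> cell e"
proof -
  consider "\<exists>v\<in>verts G. x \<in> cell {v}" | "\<exists>e\<in>edges G. x \<in> cell e"
    using assms unfolding points_def by blast
  then show ?thesis
    by cases (use that(1) cell_singleton in fast, use that(2) in fast)
qed

lemma points_support: "x \<in> points G \<Longrightarrow> \<exists>v\<in>verts G. 0 < x v"
proof (erule points_cases)
  fix e assume e: "e \<in> edges G" "x \<in> cell e"
  obtain a b where ab: "e = {a, b}" "a \<noteq> b" "a \<in> verts G" "b \<in> verts G" using edge_ex[OF e(1)] by blast
  then have "x a + x b = 1" "0 \<le> x a" "0 \<le> x b" using e unfolding cell_def by auto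
  then have "0 < x a \<or> 0 < x b" by linarith
  then show ?thesis using ab by blast
qed (auto simp: vertex_pt_def)

definition near :: "('a \<Rightarrow> real) \<Rightarrow> 'a" where
  "near x = (SOME v. v \<in> verts G \<and> 0 < x v)"

lemma near: "x \<in> points G \<Longrightarrow> near x \<in> verts G \<and> 0 < x (near x)"
  unfolding near_def using someI_ex[of "\<lambda>v. v \<in> verts G \<and> 0 < x v"] points_support by blast

lemma near_vertex_pt: "v \<in> verts G \<Longrightarrow> near (vertex_pt v) = v"
  unfolding near_def vertex_pt_def by (rule some_equality) (auto split: if_splits)

text \<open>A function that is 1-Lipschitz along paths, which gives the lower bound for path lengths.\<close>

definition interp :: "'a \<Rightarrow> ('a \<Rightarrow> real) \<Rightarrow> real" where
  "interp u x = (\<Sum>v | x v \<noteq> 0. x v * real (gdist G u v))"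

lemma interp_vertex_pt: "interp u (vertex_pt v) = real (gdist G u v)"
  unfolding interp_def vertex_pt_def by simp

lemma interp_cell:
  assumes "x \<in> cell {a, b}" "a \<noteq> b"
  shows "interp u x = x a * real (gdist G u a) + x b * real (gdist G u b)"
proof -
  have "{v. x v \<noteq> 0} \<subseteq> {a, b}" using assms unfolding cell_def by auto
  then have "interp u x = (\<Sum>v\<in>{a, b}. x v * real (gdist G u v))"
    unfolding interp_def by (intro sum.mono_neutral_left) auto
  then show ?thesis using assms(2) by simp
qed

lemma gdist_adj_diff:
  "u \<in> verts G \<Longrightarrow> adj G a b \<Longrightarrow> \<bar>real (gdist G u a) - real (gdist G u b)\<bar> \<le> 1"
  using gdist_Suc[of u a b] gdist_Suc[of u b a] adj_sym[of G a b] by auto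

text \<open>On an edge \<open>interp u\<close> is affine in either coordinate, with slope the
  difference of the distances from \<open>u\<close> to the two ends, hence at most one in absolute
  value.\<close>

lemma interp_segment:
  assumes u: "u \<in> verts G" and e: "e \<in> edges G" "y \<in> cell e" "z \<in> cell e" "v \<in> e"
  shows "\<bar>interp u y - interp u z\<bar> \<le> \<bar>y v - z v\<bar>"
proof -
  obtain a b where ab: "e = {a, b}" "a \<noteq> b" "adj G a b" using edge_ex[OF e(1)] by blast
  have "y a + y b = 1" "z a + z b = 1" using e ab unfolding cell_def by auto
  then have s: "y b = 1 - y a" "z b = 1 - z a" by linarith+
  have "interp u y - interp u z = (y a - z a) * (real (gdist G u a) - real (gdist G u b))"
    using interp_cell[of y a b u] interp_cell[of z a b u] e(2,3) ab(1,2) s by (simp add: algebra_simps)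
  then have "\<bar>interp u y - interp u z\<bar> = \<bar>y a - z a\<bar> * \<bar>real (gdist G u a) - real (gdist G u b)\<bar>"
    by (simp add: abs_mult)
  also have "\<dots> \<le> \<bar>y a - z a\<bar> * 1" using gdist_adj_diff[OF u ab(3)] by (intro mult_left_mono) auto
  also have "\<bar>y a - z a\<bar> = \<bar>y v - z v\<bar>" using s e(4) ab(1) by auto
  finally show ?thesis by simp
qed

lemma interp_path_length:
  assumes "u \<in> verts G" "path_length G x y l"
  shows "\<bar>interp u x - interp u y\<bar> \<le> l"
  using assms(2)
proof (induction rule: path_length.induct)
  case (path_length_step x y l e z v)
  have "\<bar>interp u y - interp u z\<bar> \<le> \<bar>y v - z v\<bar>"
    by (rule interp_segment[OF assms(1) path_length_step.hyps(2-5)])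
  then show ?case using path_length_step.IH by linarith
qed simp

lemma interp_near:
  assumes u: "u \<in> verts G" and x: "x \<in> points G" "0 < x v"
  shows "\<bar>interp u x - real (gdist G u v)\<bar> \<le> 1"
  using x(1)
proof (cases rule: points_cases)
  case (1 w)
  then have "w = v" using x(2) by (auto simp: vertex_pt_def split: if_splits)
  then show ?thesis using 1 by (simp add: interp_vertex_pt)
next
  case (2 e)
  obtain a b where ab: "e = {a, b}" "a \<noteq> b" "adj G a b" using edge_ex[OF 2(1)] by blast
  have v: "v \<in> e" by (rule cell_support[OF 2(2) x(2)])
  have "finite e" using ab by simp
  then have "\<bar>interp u x - interp u (vertex_pt v)\<bar> \<le> \<bar>x v - vertex_pt v v\<bar>"
    using interp_segment[OF u 2 vertex_pt_cell v] v by blast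
  moreover have "x a + x b = 1" "0 \<le> x a" "0 \<le> x b" using 2 ab unfolding cell_def by auto
  then have "0 \<le> x v" "x v \<le> 1" using v ab by auto
  moreover have "vertex_pt v v = 1" by (simp add: vertex_pt_def)
  ultimately show ?thesis by (simp add: interp_vertex_pt)
qed

lemma path_length_vertex_pt:
  "(adj G ^^ n) u v \<Longrightarrow> path_length G x (vertex_pt u) l \<Longrightarrow> path_length G x (vertex_pt v) (l + real n)"
proof (induction n arbitrary: v)
  case (Suc n)
  then obtain w where w: "(adj G ^^ n) u w" "adj G w v" by auto
  then have "path_length G x (vertex_pt w) (l + real n)" using Suc by blast
  moreover have "{w, v} \<in> edges G" using w by (simp add: adj_def)
  ultimately have "path_length G x (vertex_pt v) (l + real n + \<bar>vertex_pt w v - vertex_pt v v\<bar>)"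
    by (intro path_length_step[of G _ _ _ "{w, v}"]) (auto intro: vertex_pt_cell)
  moreover have "w \<noteq> v" using adj_verts(3) w(2) by blast
  ultimately show ?case by (simp add: vertex_pt_def add_ac)
qed simp

lemma cell_segment:
  assumes "x \<in> points G" "0 < x v"
  shows "x = vertex_pt v \<or> (\<exists>e\<in>edges G. v \<in> e \<and> x \<in> cell e \<and> vertex_pt v \<in> cell e \<and> \<bar>x v - vertex_pt v v\<bar> \<le> 1)"
  using assms(1)
proof (cases rule: points_cases)
  case (1 w) then show ?thesis using assms(2) by (auto simp: vertex_pt_def split: if_splits)
next
  case (2 e)
  obtain a b where ab: "e = {a, b}" "a \<noteq> b" using edge_ex[OF 2(1)] by blast
  have v: "v \<in> e" by (rule cell_support[OF 2(2) assms(2)])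
  have "x a + x b = 1" "0 \<le> x a" "0 \<le> x b" using 2 ab unfolding cell_def by auto
  then have "\<bar>x v - vertex_pt v v\<bar> \<le> 1" using v ab assms(2) unfolding vertex_pt_def by auto
  then show ?thesis using 2 v ab vertex_pt_cell[of e v] by auto
qed

lemma path_length_ex:
  assumes x: "x \<in> points G" "0 < x a" and y: "y \<in> points G" "0 < y b"
    and ab: "a \<in> verts G" "b \<in> verts G"
  shows "\<exists>l \<le> real (gdist G a b) + 2. path_length G x y l"
proof -
  have "\<exists>l \<le> 1. path_length G x (vertex_pt a) l"
  proof (cases "x = vertex_pt a")
    case True then show ?thesis using path_length_refl[OF x(1)] by (intro exI[of _ 0]) simp
  next
    case False
    then obtain e where e: "e \<in> edges G" "a \<in> e" "x \<in> cell e" "vertex_pt a \<in> cell e"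
      "\<bar>x a - vertex_pt a a\<bar> \<le> 1" using cell_segment[OF x] by blast
    then have "path_length G x (vertex_pt a) (0 + \<bar>x a - vertex_pt a a\<bar>)"
      using path_length_step[OF path_length_refl[OF x(1)]] by blast
    then show ?thesis using e by auto
  qed
  then obtain l where l: "l \<le> 1" "path_length G x (vertex_pt a) l" by blast
  have l': "path_length G x (vertex_pt b) (l + real (gdist G a b))"
    using path_length_vertex_pt[OF gdist_walk[OF ab] l(2)] .
  show ?thesis
  proof (cases "y = vertex_pt b")
    case True then show ?thesis using l l' by (intro exI[of _ "l + real (gdist G a b)"]) auto
  next
    case False
    then obtain e where e: "e \<in> edges G" "b \<in> e" "y \<in> cell e" "vertex_pt b \<in> cell e"
      "\<bar>y b - vertex_pt b b\<bar> \<le> 1" using cell_segment[OF y] by blast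
    then have "path_length G x y (l + real (gdist G a b) + \<bar>vertex_pt b b - y b\<bar>)"
      using path_length_step[OF l'] by blast
    then show ?thesis using e l
      by (intro exI[of _ "l + real (gdist G a b) + \<bar>vertex_pt b b - y b\<bar>"]) auto
  qed
qed

text \<open>The error is one for each end point, since a point is within one of any vertex in its
  support. The lower bound comes from \<open>interp\<close>, the upper bound from an explicit path
  along a walk.\<close>

lemma path_dist_gdist:
  assumes x: "x \<in> points G" "0 < x a" and y: "y \<in> points G" "0 < y b"
    and ab: "a \<in> verts G" "b \<in> verts G"
  shows "\<bar>path_dist G x y - real (gdist G a b)\<bar> \<le> 2"
proof -
  have lower: "real (gdist G a b) - 2 \<le> l" if "path_length G x y l" for l
    using interp_path_length[OF ab(1) that] interp_near[OF ab(1) x] interp_near[OF ab(1) y] by simp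
  obtain l where l: "l \<le> real (gdist G a b) + 2" "path_length G x y l"
    using path_length_ex[OF assms] by blast
  have "real (gdist G a b) - 2 \<le> path_dist G x y"
    unfolding path_dist_def using lower l by (intro cInf_greatest) auto
  moreover have "path_dist G x y \<le> l"
    unfolding path_dist_def using lower l by (intro cInf_lower bdd_belowI[of _ "real (gdist G a b) - 2"]) auto
  ultimately show ?thesis using l by linarith
qed

end

text \<open>The upper bound is stated for edges alone, which is the form that keeps thickened images
  connected.\<close>

lemma quasi_isometric_gdist:
  fixes G :: "'a ugraph" and H :: "'b ugraph"
  assumes G: "connected_graph G" and H: "connected_graph H"
    and qi: "quasi_isometric (points G) (path_dist G) (points H) (path_dist H)"
  obtains f N where "\<And>x. x \<in> verts G \<Longrightarrow> f x \<in> verts H"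
    "\<And>x y. adj G x y \<Longrightarrow> gdist H (f x) (f y) \<le> N"
    "\<And>x y. x \<in> verts G \<Longrightarrow> y \<in> verts G \<Longrightarrow> gdist G x y \<le> N * gdist H (f x) (f y) + N"
proof -
  interpret G: connected_ugraph G by unfold_locales (rule G)
  interpret H: connected_ugraph H by unfold_locales (rule H)
  obtain F L A where F: "F \<in> points G \<rightarrow> points H" "L \<ge> 1" "A \<ge> 0"
    and bound: "\<forall>x\<in>points G. \<forall>y\<in>points G. path_dist G x y / L - A \<le> path_dist H (F x) (F y) \<and>
      path_dist H (F x) (F y) \<le> L * path_dist G x y + A"
    using qi unfolding quasi_isometric_def by (elim bexE exE conjE) (rule that)
  have low: "path_dist G x y / L - A \<le> path_dist H (F x) (F y)"
    and up: "path_dist H (F x) (F y) \<le> L * path_dist G x y + A" if "x \<in> points G" "y \<in> points G" for x y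
    using bound that by simp_all
  define f where "f = (\<lambda>v. H.near (F (vertex_pt v)))"
  \<comment> \<open>The value dominates \<open>L\<close>, the bound \<open>3 * L + A + 2\<close> for
    the images of adjacent vertices, and the additive error \<open>L * (2 + A) + 2\<close> of the
    lower bound.\<close>
  define N where "N = nat \<lceil>L * (3 + A) + A + 4\<rceil>"
  have N: "L * (3 + A) + A + 4 \<le> real N" unfolding N_def by linarith
  have FP: "F (vertex_pt v) \<in> points H" if "v \<in> verts G" for v using F G.vertex_pt_points[OF that] by blast
  have f: "f v \<in> verts H" "0 < F (vertex_pt v) (f v)" if "v \<in> verts G" for v
    using H.near[OF FP[OF that]] unfolding f_def by auto
  have dG: "\<bar>path_dist G (vertex_pt x) (vertex_pt y) - real (gdist G x y)\<bar> \<le> 2"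
    if "x \<in> verts G" "y \<in> verts G" for x y
    using that by (intro G.path_dist_gdist G.vertex_pt_points) (auto simp: vertex_pt_def)
  have dH: "\<bar>path_dist H (F (vertex_pt x)) (F (vertex_pt y)) - real (gdist H (f x) (f y))\<bar> \<le> 2"
    if "x \<in> verts G" "y \<in> verts G" for x y
    using that by (intro H.path_dist_gdist FP f)
  show ?thesis
  proof (rule that[of f N])
    fix x y assume xy: "adj G x y"
    then have V: "x \<in> verts G" "y \<in> verts G" using G.adj_verts by auto
    have "real (gdist G x y) \<le> 1" using G.gdist_adj[OF xy] by simp
    then have "path_dist G (vertex_pt x) (vertex_pt y) \<le> 3" using dG[OF V] by linarith
    then have "L * path_dist G (vertex_pt x) (vertex_pt y) \<le> L * 3" using F(2) by (intro mult_left_mono) auto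
    moreover have "L * 3 \<le> L * (3 + A)" using F by (intro mult_left_mono) auto
    ultimately have "real (gdist H (f x) (f y)) \<le> real N"
      using N dH[OF V] up[OF V[THEN G.vertex_pt_points]] F(3) by linarith
    then show "gdist H (f x) (f y) \<le> N" by simp
  next
    fix x y assume V: "x \<in> verts G" "y \<in> verts G"
    have "path_dist G (vertex_pt x) (vertex_pt y) / L \<le> real (gdist H (f x) (f y)) + 2 + A"
      using dH[OF V] low[OF V[THEN G.vertex_pt_points]] by linarith
    then have "path_dist G (vertex_pt x) (vertex_pt y) \<le> L * (real (gdist H (f x) (f y)) + (2 + A))"
      using F(2) by (simp add: field_simps)
    also have "\<dots> = L * real (gdist H (f x) (f y)) + L * (2 + A)" by (simp add: algebra_simps)
    finally have "real (gdist G x y) \<le> L * real (gdist H (f x) (f y)) + (L * (2 + A) + 2)"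
      using dG[OF V] by linarith
    moreover have "L * 1 \<le> L * (3 + A)" "L * (2 + A) \<le> L * (3 + A)" using F by (intro mult_left_mono; simp)+
    moreover from this have "L * real (gdist H (f x) (f y)) \<le> real N * real (gdist H (f x) (f y))"
      using N F(3) by (intro mult_right_mono) auto
    ultimately have "real (gdist G x y) \<le> real N * real (gdist H (f x) (f y)) + real N"
      using N F(3) by linarith
    then show "gdist G x y \<le> N * gdist H (f x) (f y) + N"
      by (metis of_nat_add of_nat_le_iff of_nat_mult)
  qed (rule f(1))
qed

text \<open>The additional 4 is the rounding to vertices, 2 in each graph.\<close>

lemma one_quasi_isometricI:
  fixes G :: "'a ugraph" and C :: "'b ugraph"
  assumes G: "connected_graph G" and C: "connected_graph C"
    and f: "f ` verts G = verts C"
    and up: "\<And>x y. x \<in> verts G \<Longrightarrow> y \<in> verts G \<Longrightarrow> gdist C (f x) (f y) \<le> gdist G x y + K"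
    and low: "\<And>x y. x \<in> verts G \<Longrightarrow> y \<in> verts G \<Longrightarrow> gdist G x y \<le> gdist C (f x) (f y) + K"
  shows "one_quasi_isometric (real K + 4) (points G) (path_dist G) (points C) (path_dist C)"
proof -
  interpret G: connected_ugraph G by unfold_locales (rule G)
  interpret C: connected_ugraph C by unfold_locales (rule C)
  define F where "F = (\<lambda>x. vertex_pt (f (G.near x)) :: 'b \<Rightarrow> real)"
  have V: "G.near x \<in> verts G" "0 < x (G.near x)" if "x \<in> points G" for x using G.near[OF that] by auto
  have fV: "f v \<in> verts C" if "v \<in> verts G" for v using f that by blast
  have "\<bar>path_dist C (F x) (F y) - path_dist G x y\<bar> \<le> real K + 4" if xy: "x \<in> points G" "y \<in> points G" for x y
  proof -
    note v = V[OF xy(1)] V[OF xy(2)]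
    have "\<bar>path_dist G x y - real (gdist G (G.near x) (G.near y))\<bar> \<le> 2"
      by (intro G.path_dist_gdist xy v)
    moreover have "\<bar>path_dist C (F x) (F y) - real (gdist C (f (G.near x)) (f (G.near y)))\<bar> \<le> 2"
      unfolding F_def by (intro C.path_dist_gdist C.vertex_pt_points fV v) (auto simp: vertex_pt_def)
    ultimately show ?thesis using up[OF v(1,3)] low[OF v(1,3)] by linarith
  qed
  moreover have "\<exists>x\<in>points G. path_dist C y (F x) \<le> real K + 4" if y: "y \<in> points C" for y
  proof -
    obtain w where w: "w \<in> verts C" "0 < y w" using C.points_support[OF y] by blast
    then obtain v where v: "v \<in> verts G" "w = f v" using f by blast
    have "F (vertex_pt v) = vertex_pt w" unfolding F_def using G.near_vertex_pt v by simp
    moreover have "\<bar>path_dist C y (vertex_pt w) - real (gdist C w w)\<bar> \<le> 2"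
      by (intro C.path_dist_gdist C.vertex_pt_points w y) (simp add: vertex_pt_def)
    ultimately show ?thesis
      by (intro bexI[of _ "vertex_pt v"] G.vertex_pt_points v) simp
  qed
  moreover have "F \<in> points G \<rightarrow> points C"
    unfolding F_def by (intro funcsetI C.vertex_pt_points fV V)
  ultimately show ?thesis unfolding one_quasi_isometric_def by (intro bexI[of _ F] conjI ballI)
qed

section \<open>Clusters and pieces\<close>

lemma fat_K23I:
  assumes "connected_in G A" "connected_in G B"
    "connected_in G P1" "connected_in G P2" "connected_in G P3"
    "far G M A B" "far G M P1 P2" "far G M P1 P3" "far G M P2 P3"
    "P1 \<inter> A \<noteq> {}" "P2 \<inter> A \<noteq> {}" "P3 \<inter> A \<noteq> {}"
    "P1 \<inter> B \<noteq> {}" "P2 \<inter> B \<noteq> {}" "P3 \<inter> B \<noteq> {}"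
  shows "fat_K23 G M"
  unfolding fat_K23_def
  by (rule exI[of _ A], rule exI[of _ B], rule exI[of _ P1], rule exI[of _ P2], rule exI[of _ P3])
    (simp add: assms)

locale theta_free_ugraph = connected_ugraph G for G :: "'a ugraph" +
  fixes M :: nat and r :: 'a
  assumes no_fat: "\<not> fat_K23 G M" and r: "r \<in> verts G" and M: "1 \<le> M"
begin

abbreviation d :: "'a \<Rightarrow> 'a \<Rightarrow> nat" where "d \<equiv> gdist G"

definition height :: "'a \<Rightarrow> nat" where "height x = gdist G r x"

definition above :: "nat \<Rightarrow> 'a set" where "above n = {v \<in> verts G. n \<le> height v}"

text \<open>The classes form what is known as the layering partition with respect to
  \<open>r\<close>.\<close>

definition same_cluster :: "'a \<Rightarrow> 'a \<Rightarrow> bool" where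
  "same_cluster x y \<longleftrightarrow> height x = height y \<and> linked G (above (height x)) x y"

text \<open>The threshold \<open>9 * M\<close> is chosen so that balls of radius \<open>4 * M\<close> around two different pieces
  of a cluster are at distance at least \<open>M\<close>.\<close>

definition piece_rel :: "'a \<Rightarrow> 'a \<Rightarrow> bool" where
  "piece_rel x y \<longleftrightarrow> x \<in> verts G \<and> (\<lambda>x y. same_cluster x y \<and> d x y \<le> 9 * M)\<^sup>*\<^sup>* x y"

lemma height_adj: "adj G x y \<Longrightarrow> height y \<le> height x + 1"
  unfolding height_def using gdist_Suc r by blast

lemma height_lip: "x \<in> verts G \<Longrightarrow> y \<in> verts G \<Longrightarrow> height y \<le> height x + d x y"
  unfolding height_def using gdist_triangle r by blast

lemma height_lip': "x \<in> verts G \<Longrightarrow> y \<in> verts G \<Longrightarrow> height x \<le> height y + d x y"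
  using height_lip[of y x] gdist_sym[of x y] by simp

lemma above_mono: "n \<le> m \<Longrightarrow> above m \<subseteq> above n"
  unfolding above_def by auto

lemma linked_above_mono: "linked G (above m) x y \<Longrightarrow> n \<le> m \<Longrightarrow> linked G (above n) x y"
  using linked_mono above_mono by metis

lemma above_verts: "above n \<subseteq> verts G"
  unfolding above_def by blast

lemma linked_verts: "linked G (above n) x y \<Longrightarrow> x \<in> verts G \<and> y \<in> verts G \<and> n \<le> height x \<and> n \<le> height y"
  using linked_in[of G "above n" x y] unfolding above_def by auto

text \<open>A geodesic from \<open>r\<close> to \<open>x\<close> passes level \<open>n\<close> at
  \<open>w\<close> and does not go below it afterwards.\<close>

lemma foot:
  assumes x: "x \<in> verts G" and n: "n \<le> height x"
  obtains w where "w \<in> verts G" "height w = n" "d w x = height x - n" "linked G (above n) w x"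
proof -
  obtain w where w: "w \<in> verts G" "d r w = n" "d w x = d r x - n"
    using gdist_between[OF r x] n unfolding height_def by blast
  have "linked G (above n) w x"
  proof (rule linked_geodesic[OF w(1) x])
    fix u assume u: "u \<in> verts G" "d w u + d u x = d w x"
    have "d r x \<le> d r u + d u x" using gdist_triangle r u x by blast
    then have "n \<le> d r u" using u w n unfolding height_def by linarith
    then show "u \<in> above n" using u unfolding above_def height_def by simp
  qed
  then show ?thesis using that w unfolding height_def by blast
qed

lemma same_cluster_refl: "x \<in> verts G \<Longrightarrow> same_cluster x x"
  unfolding same_cluster_def above_def by (simp add: linked_refl)

lemma same_cluster_sym: "same_cluster x y \<Longrightarrow> same_cluster y x"
  unfolding same_cluster_def by (metis linked_sym)

lemma same_cluster_trans: "same_cluster x y \<Longrightarrow> same_cluster y z \<Longrightarrow> same_cluster x z"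
  unfolding same_cluster_def by (metis linked_trans)

lemma same_cluster_verts: "same_cluster x y \<Longrightarrow> x \<in> verts G \<and> y \<in> verts G"
  unfolding same_cluster_def using linked_verts by blast

text \<open>Go through the root. Wide clusters therefore lie at height at least \<open>M\<close>,
  where the truncated difference \<open>n - M\<close> is the true one.\<close>

lemma low_diam:
  assumes "same_cluster x y" "height x < M"
  shows "d x y < 2 * M"
proof -
  have V: "x \<in> verts G" "y \<in> verts G" using same_cluster_verts assms(1) by auto
  have "d x y \<le> d x r + d r y" using gdist_triangle V r by blast
  also have "\<dots> = height x + height y" using gdist_sym V r unfolding height_def by simp
  finally show ?thesis using assms unfolding same_cluster_def by simp
qed

text \<open>Three points of a cluster that are pairwise far apart are joined by descending geodesics to
  a ball around the root, which together with the component above the cluster gives a fat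
  \<open>K\<^sub>2\<^sub>,\<^sub>3\<close>.\<close>

lemma three_points:
  assumes "same_cluster q1 q2" "same_cluster q1 q3"
  shows "d q1 q2 \<le> 3 * M \<or> d q1 q3 \<le> 3 * M \<or> d q2 q3 \<le> 3 * M"
proof (rule ccontr)
  assume "\<not> ?thesis"
  then have big: "3 * M < d q1 q2" "3 * M < d q1 q3" "3 * M < d q2 q3" by auto
  define n where "n = height q1"
  have nM: "M \<le> n" using low_diam[OF assms(1)] big(1) unfolding n_def by linarith
  have q: "q1 \<in> verts G" "q2 \<in> verts G" "q3 \<in> verts G" "height q1 = n" "height q2 = n" "height q3 = n"
    using assms[THEN same_cluster_verts] assms unfolding n_def same_cluster_def by auto
  define A where "A = {w \<in> verts G. d r w \<le> n - M}"
  define B where "B = {y. linked G (above n) q1 y}"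
  \<comment> \<open>The last \<open>M\<close> levels of all geodesics from \<open>r\<close> to
    \<open>q\<close>. Every vertex there is within \<open>M\<close> of \<open>q\<close>, so spokes
    at points more than \<open>3 * M\<close> apart keep distance \<open>M\<close>.\<close>
  define P where "P = (\<lambda>q. {z \<in> verts G. height z + d z q = n \<and> n - M \<le> height z})"
  have A: "connected_in G A" unfolding A_def by (rule connected_in_ball[OF r])
  have B: "connected_in G B" unfolding B_def by (rule connected_in_linked[OF above_verts])
  have P: "connected_in G (P q)" if q: "q \<in> verts G" "height q = n" for q
  proof (rule connected_inI[of _ _ q])
    show "P q \<subseteq> verts G" unfolding P_def by blast
    fix z assume "z \<in> P q"
    then have z: "z \<in> verts G" "height z + d z q = n" "n - M \<le> height z" unfolding P_def by auto
    have "linked G (P q) z q"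
    proof (rule linked_geodesic[OF z(1) q(1)])
      fix w assume w: "w \<in> verts G" "d z w + d w q = d z q"
      have "height w \<le> height z + d z w" using height_lip z(1) w(1) by blast
      moreover have "n \<le> height w + d w q" using height_lip[of w q] w(1) q by simp
      moreover have "height w \<ge> n - M"
        using \<open>n \<le> height w + d w q\<close> w(2) z by linarith
      ultimately show "w \<in> P q" unfolding P_def using w z by auto
    qed
    then show "linked G (P q) q z" by (rule linked_sym)
  qed
  have PP: "far G M (P p) (P q)" if pq: "p \<in> verts G" "q \<in> verts G" "3 * M < d p q" for p q
    unfolding far_def
  proof (intro ballI)
    fix x y assume "x \<in> P p" "y \<in> P q"
    then have x: "x \<in> verts G" "d x p \<le> M" and y: "y \<in> verts G" "d y q \<le> M" unfolding P_def by auto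
    have "d p q \<le> d p x + d x q" "d x q \<le> d x y + d y q" using gdist_triangle pq x y by blast+
    then show "M \<le> d x y" using x y pq gdist_sym[OF x(1) pq(1)] by linarith
  qed
  have PA: "P q \<inter> A \<noteq> {}" if q: "q \<in> verts G" "height q = n" for q
  proof -
    obtain w where w: "w \<in> verts G" "height w = n - M" "d w q = height q - (n - M)"
      using foot[OF q(1), of "n - M"] q(2) by auto
    then have "w \<in> P q \<inter> A" unfolding P_def A_def using q nM unfolding height_def by auto
    then show ?thesis by blast
  qed
  have PB: "P q \<inter> B \<noteq> {}" if q: "same_cluster q1 q" for q
  proof -
    have "q \<in> P q" unfolding P_def using q same_cluster_verts[OF q] by (auto simp: n_def same_cluster_def)
    moreover have "q \<in> B" using q unfolding B_def n_def same_cluster_def by blast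
    ultimately show ?thesis by blast
  qed
  have "far G M A B" unfolding far_def
  proof (intro ballI)
    fix a b assume ab: "a \<in> A" "b \<in> B"
    then have "b \<in> verts G" "n \<le> height b" using linked_verts unfolding B_def by auto
    moreover have "a \<in> verts G" "height a \<le> n - M" using ab unfolding A_def height_def by auto
    ultimately show "M \<le> d a b" using height_lip[of a b] nM by linarith
  qed
  then have "fat_K23 G M"
    using PB[OF same_cluster_refl[OF q(1)]] PB[OF assms(1)] PB[OF assms(2)]
    by (intro fat_K23I[of G A B "P q1" "P q2" "P q3"]) (simp_all add: A B P q PP big PA)
  then show False using no_fat by blast
qed

lemma piece_rel_refl: "x \<in> verts G \<Longrightarrow> piece_rel x x"
  unfolding piece_rel_def by simp

lemma piece_rel_cluster: "piece_rel x y \<Longrightarrow> same_cluster x y"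
proof -
  assume "piece_rel x y"
  then have "(\<lambda>x y. same_cluster x y \<and> d x y \<le> 9 * M)\<^sup>*\<^sup>* x y" "x \<in> verts G"
    unfolding piece_rel_def by auto
  then show ?thesis
    by (induction rule: rtranclp_induct) (auto intro: same_cluster_refl same_cluster_trans)
qed

lemma piece_relI: "same_cluster x y \<Longrightarrow> d x y \<le> 9 * M \<Longrightarrow> piece_rel x y"
  unfolding piece_rel_def using same_cluster_verts by blast

lemma piece_rel_trans: "piece_rel x y \<Longrightarrow> piece_rel y z \<Longrightarrow> piece_rel x z"
  unfolding piece_rel_def by (auto intro: rtranclp_trans)

lemma piece_rel_sym: "piece_rel x y \<Longrightarrow> piece_rel y x"
proof -
  assume *: "piece_rel x y"
  then have "(\<lambda>x y. same_cluster x y \<and> d x y \<le> 9 * M)\<^sup>*\<^sup>* x y" unfolding piece_rel_def by auto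
  then have "(\<lambda>x y. same_cluster x y \<and> d x y \<le> 9 * M)\<^sup>*\<^sup>* y x"
  proof (induction rule: rtranclp_induct)
    case (step y z)
    then have "same_cluster z y \<and> d z y \<le> 9 * M"
      using same_cluster_sym same_cluster_verts gdist_sym by metis
    then show ?case using step.IH by (rule converse_rtranclp_into_rtranclp)
  qed simp
  moreover have "y \<in> verts G" using piece_rel_cluster[OF *] same_cluster_verts by blast
  ultimately show ?thesis unfolding piece_rel_def by blast
qed

lemma piece_rel_height: "piece_rel x y \<Longrightarrow> height x = height y"
  using piece_rel_cluster unfolding same_cluster_def by blast

lemma piece_rel_verts: "piece_rel x y \<Longrightarrow> x \<in> verts G \<and> y \<in> verts G"
  using piece_rel_cluster same_cluster_verts by blast

text \<open>If \<open>x\<close> and \<open>y\<close> were farther apart, \<open>three_points\<close>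
  would put every vertex of the cluster within \<open>3 * M\<close> of one of them. A chain with
  steps of at most \<open>9 * M\<close> starting at \<open>x\<close> could then never pass to the
  side of \<open>y\<close>, because \<open>3 * M + 9 * M + 3 * M\<close> is too short.\<close>

lemma piece_diam:
  assumes xy: "piece_rel x y"
  shows "d x y \<le> 15 * M"
proof (rule ccontr)
  assume big: "\<not> d x y \<le> 15 * M"
  have V: "x \<in> verts G" "y \<in> verts G" using piece_rel_verts xy by auto
  have dich: "d x z \<le> 3 * M \<or> d z y \<le> 3 * M" if "same_cluster x z" for z
    using three_points[OF that piece_rel_cluster[OF xy]] big by linarith
  have "(\<lambda>x y. same_cluster x y \<and> d x y \<le> 9 * M)\<^sup>*\<^sup>* x y" using xy unfolding piece_rel_def by auto
  then have "same_cluster x y \<and> d x y \<le> 3 * M"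
  proof (induction rule: rtranclp_induct)
    case base then show ?case using same_cluster_refl V by simp
  next
    case (step u v)
    then have xv: "same_cluster x v" using same_cluster_trans by blast
    have "u \<in> verts G" "v \<in> verts G" using step same_cluster_verts by auto
    then have "d x y \<le> d x u + d u y" "d u y \<le> d u v + d v y" using gdist_triangle V by blast+
    then have "\<not> d v y \<le> 3 * M" using step big by linarith
    then show ?case using xv dich by blast
  qed
  then show False using big by linarith
qed

lemma apart_far: "same_cluster x y \<Longrightarrow> \<not> piece_rel x y \<Longrightarrow> 9 * M < d x y"
  using piece_relI by (metis not_le)

text \<open>Of three points of a cluster two are within \<open>3 * M\<close>, and this pair cannot
  be \<open>x\<close> and \<open>y\<close>.\<close>

lemma two_pieces:
  assumes "same_cluster x y" "\<not> piece_rel x y" "same_cluster x z"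
  shows "piece_rel z x \<or> piece_rel z y"
proof -
  have "same_cluster z x" "same_cluster z y"
    using assms same_cluster_sym same_cluster_trans by metis+
  moreover have "d z x \<le> 9 * M \<or> d z y \<le> 9 * M"
    using three_points[OF calculation] apart_far[OF assms(1,2)] by linarith
  ultimately show ?thesis using piece_relI by blast
qed

text \<open>Both \<open>x\<close> and \<open>x'\<close> are more than \<open>9 * M\<close> from
  \<open>y\<close>, so \<open>three_points\<close> leaves only their mutual distance. This sharpens
  \<open>15 * M\<close> to \<open>3 * M\<close> for pieces that have a partner.\<close>

lemma apart_diam:
  assumes "same_cluster x y" "\<not> piece_rel x y" "piece_rel x x'"
  shows "d x x' \<le> 3 * M"
proof -
  have "same_cluster x x'" using piece_rel_cluster assms(3) by blast
  then have "same_cluster x' y" "\<not> piece_rel x' y"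
    using assms same_cluster_sym same_cluster_trans piece_rel_trans by metis+
  then show ?thesis
    using three_points[OF \<open>same_cluster x x'\<close> assms(1)] apart_far[OF assms(1,2)]
      apart_far[of x' y] by linarith
qed

section \<open>Parents of pieces and components above them\<close>

lemma parent_cluster:
  assumes xy: "same_cluster x y" and "adj G x u" "adj G y v" "height u + 1 = height x" "height v + 1 = height y"
  shows "same_cluster u v"
proof -
  define n where "n = height u"
  have h: "height x = Suc n" "height v = n" "height y = Suc n"
    using assms unfolding same_cluster_def n_def by auto
  have "linked G (above n) x y" using xy linked_above_mono[of "Suc n" x y n] h
    unfolding same_cluster_def by simp
  moreover have "u \<in> above n" "v \<in> above n"
    using assms(2,3) adj_verts h unfolding above_def n_def by auto
  moreover have "linked G (above n) u x"
    using linked_sym[OF linked_step[OF linked_refl assms(2)]] calculation(2) linked_in[OF calculation(1)] by blast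
  ultimately have "linked G (above n) u v"
    using linked_step[OF _ assms(3)] linked_trans by metis
  then show ?thesis unfolding same_cluster_def using h n_def by simp
qed

text \<open>The parents are at distance at most \<open>3 * M + 2\<close>, below the threshold of a
  piece; hence each side of a cycle descends in a unique way.\<close>

lemma parent_piece:
  assumes xy: "same_cluster x y" "\<not> piece_rel x y" and xx: "piece_rel x x'"
    and "adj G x u" "adj G x' u'" "height u + 1 = height x" "height u' + 1 = height x'"
  shows "piece_rel u u'"
proof (rule piece_relI)
  show "same_cluster u u'" using parent_cluster[OF piece_rel_cluster[OF xx] assms(4-7)] .
  have V: "u \<in> verts G" "u' \<in> verts G" "x \<in> verts G" "x' \<in> verts G" using assms adj_verts by auto
  have "d u u' \<le> d u x + d x u'" "d x u' \<le> d x x' + d x' u'" using gdist_triangle V by blast+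
  moreover have "d x x' \<le> 3 * M" using apart_diam xy xx by blast
  moreover have "d u x \<le> 1" "d x' u' \<le> 1" using assms gdist_adj adj_sym by metis+
  ultimately show "d u u' \<le> 9 * M" using M by linarith
qed

text \<open>If the parents shared a piece that has a partner, \<open>x\<close> and \<open>y\<close>
  would be at distance at most \<open>3 * M + 2\<close>. So two sides can merge only in a piece that
  is a whole cluster.\<close>

lemma parents_apart:
  assumes xy: "same_cluster x y" "\<not> piece_rel x y" and uw: "same_cluster u w" "\<not> piece_rel u w"
    and "adj G x u" "adj G y v"
  shows "\<not> piece_rel u v"
proof
  assume uv: "piece_rel u v"
  have V: "u \<in> verts G" "v \<in> verts G" "x \<in> verts G" "y \<in> verts G" using assms adj_verts by auto
  have "d x y \<le> d x u + d u y" "d u y \<le> d u v + d v y" using gdist_triangle V by blast+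
  moreover have "d u v \<le> 3 * M" using apart_diam uw uv by blast
  moreover have "d x u \<le> 1" "d v y \<le> 1" using assms gdist_adj adj_sym by metis+
  ultimately show False using apart_far[OF xy] M by linarith
qed

text \<open>A path above level \<open>n\<close> from the side of \<open>u\<close> to the side of \<open>v\<close> must climb \<open>M\<close> levels before
  it changes sides: up to that height every vertex is close to exactly one of the two pieces.\<close>

lemma crossing:
  assumes uv: "same_cluster u v" "\<not> piece_rel u v" "height u = n"
    and x: "adj G x x0" "piece_rel x0 u" "height x = Suc n"
    and y: "adj G y y0" "piece_rel y0 v" "height y = Suc n"
    and xy: "linked G (above (Suc n)) x y"
  obtains z z' where "linked G (above (Suc n)) x z" "linked G (above (n + M)) z z'"
    "d z u \<le> 4 * M" "d z' v \<le> 4 * M"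
proof -
  define near where "near = (\<lambda>u z. \<exists>l. piece_rel l u \<and> d z l \<le> M)"
  have hv: "height v = n" using uv unfolding same_cluster_def by simp
  have V: "u \<in> verts G" "v \<in> verts G" "x \<in> verts G" "y \<in> verts G" "x0 \<in> verts G" "y0 \<in> verts G"
    using same_cluster_verts[OF uv(1)] adj_verts x y by auto
  have nuv: "\<not> piece_rel v u" "same_cluster v u" using uv piece_rel_sym same_cluster_sym by blast+
  have ux: "linked G (above n) u x"
  proof -
    have "linked G (above n) x0 u" using piece_rel_cluster[OF x(2)] piece_rel_height[OF x(2)] uv(3)
      unfolding same_cluster_def by simp
    moreover have "linked G (above n) x0 x" using linked_step[OF linked_refl[of x0 "above n" G], of x] x V
        piece_rel_height[OF x(2)] uv(3) adj_sym[of G x x0] unfolding above_def by simp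
    ultimately show ?thesis using linked_sym linked_trans by metis
  qed
  have some_near: "near u z \<or> near v z" if z: "linked G (above (Suc n)) x z" "height z \<le> n + M" for z
  proof -
    have zV: "z \<in> verts G" "Suc n \<le> height z" using linked_verts z by auto
    obtain w where w: "w \<in> verts G" "height w = n" "d w z = height z - n" "linked G (above n) w z"
      using foot[OF zV(1), of n] zV(2) by auto
    have "linked G (above n) x z" using linked_above_mono[OF z(1)] by simp
    then have "linked G (above n) u w" using ux w(4) linked_sym linked_trans by metis
    then have "same_cluster u w" unfolding same_cluster_def using w uv by simp
    then have "piece_rel w u \<or> piece_rel w v" using two_pieces uv by blast
    moreover have "d z w \<le> M" using w(3) z(2) gdist_sym[OF zV(1) w(1)] by simp
    ultimately show ?thesis unfolding near_def by blast
  qed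
  \<comment> \<open>The two vertices \<open>l\<close> and \<open>l'\<close> of different pieces
    would be at distance at most \<open>2 * M + 1\<close>, against \<open>9 * M\<close>.\<close>
  have not_both: False if nn: "near u z" "near v z'" "z \<in> verts G" "z' \<in> verts G" "d z z' \<le> 1" for z z'
  proof -
    obtain l l' where l: "piece_rel l u" "d z l \<le> M" "piece_rel l' v" "d z' l' \<le> M"
      using nn unfolding near_def by blast
    have lV: "l \<in> verts G" "l' \<in> verts G" using l piece_rel_verts by auto
    have "\<not> piece_rel l l'" using l uv(2) piece_rel_sym piece_rel_trans by metis
    moreover have "same_cluster l l'"
      using l uv(1) piece_rel_cluster same_cluster_sym same_cluster_trans by metis
    ultimately have "9 * M < d l l'" using apart_far by blast
    moreover have "d l l' \<le> d l z + d z l'" "d z l' \<le> d z z' + d z' l'"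
      using gdist_triangle nn lV by blast+
    moreover have "d l z = d z l" using gdist_sym lV nn by blast
    ultimately show False using l nn M by linarith
  qed
  have near_dist: "d z u \<le> 4 * M" if nr: "near u z" "same_cluster u v" "\<not> piece_rel u v" "z \<in> verts G" for u v z
  proof -
    obtain l where l: "piece_rel l u" "d z l \<le> M" using nr unfolding near_def by blast
    then have lV: "l \<in> verts G" "u \<in> verts G" using piece_rel_verts by auto
    have "d z u \<le> d z l + d l u" using gdist_triangle lV nr by blast
    moreover have "d u l \<le> 3 * M" using apart_diam nr l piece_rel_sym by metis
    moreover have "d l u = d u l" using gdist_sym lV by blast
    ultimately show ?thesis using l by linarith
  qed
  have "\<exists>z z'. linked G (above (Suc n)) x z \<and> linked G (above (n + M)) z z' \<and>
      height z = n + M \<and> height z' = n + M \<and> near u z \<and> near v z'"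
  proof (rule ccontr)
    assume no: "\<not> ?thesis"
    \<comment> \<open>The projections of \<open>z\<close> to level \<open>n + M\<close> along
      geodesics to \<open>r\<close>; a vertex at or below that level is its own projection. The
      induction below shows that all projections along the walk stay near the piece of
      \<open>u\<close>.\<close>
    define m where "m = (\<lambda>z. {z0 \<in> verts G. height z0 = min (height z) (n + M) \<and> height z0 + d z0 z = height z})"
    have m_low: "m z = {z}" if "z \<in> verts G" "height z \<le> n + M" for z
      using that gdist_eq_0[of _ z] unfolding m_def by auto
    have m_linked: "linked G (above (n + M)) z0 z" if z: "z \<in> verts G" "n + M \<le> height z" "z0 \<in> m z" for z z0
    proof (rule linked_geodesic)
      have z0: "z0 \<in> verts G" "height z0 = n + M" "height z0 + d z0 z = height z" using z unfolding m_def by auto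
      then show "z0 \<in> verts G" by blast
      fix w assume w: "w \<in> verts G" "d z0 w + d w z = d z0 z"
      have "height z \<le> height w + d w z" using height_lip w z by blast
      then have "n + M \<le> height w" using w z0 by linarith
      then show "w \<in> above (n + M)" using w unfolding above_def by simp
    qed (use z in simp)
    have m_ex: "\<exists>z0. z0 \<in> m z" if z: "z \<in> verts G" for z
    proof -
      obtain w where "w \<in> verts G" "height w = min (height z) (n + M)" "d w z = height z - min (height z) (n + M)"
        using foot[OF z, of "min (height z) (n + M)"] by auto
      then have "w \<in> m z" unfolding m_def by auto
      then show ?thesis by blast
    qed
    have xlow: "near u x"
    proof -
      have "d x x0 \<le> M" using gdist_adj[OF x(1)] M by linarith
      then show ?thesis using x(2) unfolding near_def by blast
    qed
    have "\<forall>z0\<in>m y. near u z0"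
      using xy
    proof (induction rule: linked_induct)
      case refl
      have "height x \<le> n + M" using x(3) M by simp
      then show ?case using m_low[OF V(3)] xlow by simp
    next
      case (step z z')
      have zV: "z \<in> verts G" "z' \<in> verts G" using adj_verts step.hyps(2) by auto
      have lz: "linked G (above (Suc n)) x z" "linked G (above (Suc n)) x z'"
        using step.hyps linked_step by metis+
      \<comment> \<open>Heights change by at most one along an edge, so no edge jumps over level
        \<open>n + M\<close>.\<close>
      consider "height z \<le> n + M" "height z' \<le> n + M" | "n + M \<le> height z" "n + M \<le> height z'"
        using height_adj[OF step.hyps(2)] height_adj[of z' z] step.hyps(2) adj_sym[of G z z'] by fastforce
      then show ?case
      proof cases
        case 1
        then have "near u z" using step.IH m_low[OF zV(1)] by simp
        moreover have "d z z' \<le> 1" using gdist_adj step.hyps(2) by blast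
        ultimately have "near u z'" using some_near[OF lz(2) 1(2)] not_both zV by blast
        then show ?thesis using m_low[OF zV(2) 1(2)] by simp
      next
        case 2
        show ?thesis
        proof
          fix z0' assume z0': "z0' \<in> m z'"
          obtain z0 where z0: "z0 \<in> m z" using m_ex zV by blast
          have h: "height z0 = n + M" "height z0' = n + M" using 2 z0 z0' unfolding m_def by auto
          have l0: "linked G (above (n + M)) z0 z" "linked G (above (n + M)) z0' z'"
            using m_linked zV 2 z0 z0' by blast+
          have "linked G (above (n + M)) z z'"
            using linked_step[OF linked_refl step.hyps(2)] zV 2 unfolding above_def by simp
          then have l: "linked G (above (n + M)) z0 z0'" using l0 linked_sym linked_trans by metis
          have M': "Suc n \<le> n + M" using M by simp
          have "linked G (above (Suc n)) z0 z" "linked G (above (Suc n)) z0' z'"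
            using l0 linked_above_mono M' by blast+
          then have lx: "linked G (above (Suc n)) x z0" "linked G (above (Suc n)) x z0'"
            using lz linked_sym linked_trans by metis+
          \<comment> \<open>Otherwise \<open>z0\<close> and \<open>z0'\<close> would be the pair
            that is assumed not to exist.\<close>
          have "\<not> near v z0'" using no step.IH z0 h lx l by blast
          then show "near u z0'" using some_near[OF lx(2)] h by simp
        qed
      qed
    qed
    moreover have "m y = {y}" using m_low[OF V(4)] y(3) M by simp
    ultimately have "near u y" by simp
    moreover have "d y y0 \<le> M" using gdist_adj[OF y(1)] M by linarith
    then have "near v y" using y(2) unfolding near_def by blast
    ultimately show False using not_both[of y y] V(4) by simp
  qed
  then obtain z z' where z: "linked G (above (Suc n)) x z" "linked G (above (n + M)) z z'" "near u z" "near v z'"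
    by blast
  have "z \<in> verts G" "z' \<in> verts G" using linked_verts[OF z(2)] by auto
  then show ?thesis using that[OF z(1,2)] near_dist z(3,4) uv(1,2) nuv by blast
qed

text \<open>Otherwise there are two crossings in different components, and together with a ball around the
  root they form the spokes of a fat \<open>K\<^sub>2\<^sub>,\<^sub>3\<close> with hubs around \<open>u\<close> and \<open>v\<close>.\<close>

lemma crossing_unique:
  assumes uv: "same_cluster u v" "\<not> piece_rel u v" "height u = n"
    and x: "adj G x x0" "piece_rel x0 u" "height x = Suc n"
    and y: "adj G y y0" "piece_rel y0 v" "height y = Suc n"
    and xy: "linked G (above (Suc n)) x y"
    and x': "adj G x' x0'" "piece_rel x0' u" "height x' = Suc n"
    and y': "adj G y' y0'" "piece_rel y0' v" "height y' = Suc n"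
    and xy': "linked G (above (Suc n)) x' y'"
  shows "linked G (above (Suc n)) x x'"
proof (rule ccontr)
  assume no: "\<not> linked G (above (Suc n)) x x'"
  obtain z1 w1 where 1: "linked G (above (Suc n)) x z1" "linked G (above (n + M)) z1 w1"
    "d z1 u \<le> 4 * M" "d w1 v \<le> 4 * M" by (rule crossing[OF uv x y xy])
  obtain z2 w2 where 2: "linked G (above (Suc n)) x' z2" "linked G (above (n + M)) z2 w2"
    "d z2 u \<le> 4 * M" "d w2 v \<le> 4 * M" by (rule crossing[OF uv x' y' xy'])
  have V: "u \<in> verts G" "v \<in> verts G" "height v = n"
    using same_cluster_verts[OF uv(1)] uv unfolding same_cluster_def by auto
  have nM: "M \<le> n" using low_diam[OF uv(1)] apart_far[OF uv(1,2)] uv(3) by linarith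
  \<comment> \<open>Hubs are the balls \<open>A\<close> and \<open>B\<close>, \<open>M\<close> apart
    since \<open>9 * M - 2 * (4 * M) = M\<close>. Spokes are the ball \<open>P0\<close> around the
    root and the components \<open>P z1\<close> and \<open>P z2\<close> above level
    \<open>n + M\<close>.\<close>
  define A where "A = {w \<in> verts G. d u w \<le> 4 * M}"
  define B where "B = {w \<in> verts G. d v w \<le> 4 * M}"
  define P0 where "P0 = {w \<in> verts G. d r w \<le> n - M}"
  define P where "P = (\<lambda>z. {y. linked G (above (n + M)) z y})"
  have conn: "connected_in G A" "connected_in G B" "connected_in G P0" "connected_in G (P z)" for z
    unfolding A_def B_def P0_def P_def
    by (intro connected_in_ball V r connected_in_linked above_verts)+
  have AB: "far G M A B" unfolding far_def
  proof (intro ballI)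
    fix a b assume "a \<in> A" "b \<in> B"
    then have ab: "a \<in> verts G" "b \<in> verts G" "d u a \<le> 4 * M" "d v b \<le> 4 * M" unfolding A_def B_def by auto
    have "d u v \<le> d u a + d a v" "d a v \<le> d a b + d b v" using gdist_triangle V ab by blast+
    then show "M \<le> d a b" using ab apart_far[OF uv(1,2)] gdist_sym[OF V(2) ab(2)] by linarith
  qed
  have far0: "far G M P0 (P z)" for z unfolding far_def
  proof (intro ballI)
    fix a b assume ab: "a \<in> P0" "b \<in> P z"
    have "b \<in> verts G" "n + M \<le> height b" using linked_verts ab unfolding P_def by auto
    moreover have "a \<in> verts G" "height a \<le> n - M" using ab unfolding P0_def height_def by auto
    ultimately show "M \<le> d a b" using height_lip[of a b] nM by linarith
  qed
  \<comment> \<open>A geodesic shorter than \<open>M\<close> between vertices of height at least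
    \<open>n + M\<close> stays above level \<open>n\<close> and would join the two
    components.\<close>
  have far12: "far G M (P z1) (P z2)" unfolding far_def
  proof (intro ballI)
    fix a b assume ab: "a \<in> P z1" "b \<in> P z2"
    have aV: "a \<in> verts G" "n + M \<le> height a" and bV: "b \<in> verts G" "n + M \<le> height b"
      using linked_verts ab unfolding P_def by auto
    show "M \<le> d a b"
    proof (rule ccontr)
      assume small: "\<not> M \<le> d a b"
      have "linked G (above (Suc n)) a b"
      proof (rule linked_geodesic[OF aV(1) bV(1)])
        fix w assume w: "w \<in> verts G" "d a w + d w b = d a b"
        have "height a \<le> height w + d a w" using height_lip' aV w by blast
        then have "Suc n \<le> height w" using w aV small by linarith
        then show "w \<in> above (Suc n)" using w unfolding above_def by simp
      qed
      moreover have "linked G (above (Suc n)) z1 a" "linked G (above (Suc n)) z2 b"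
        using ab linked_above_mono[of "n + M" _ _ "Suc n"] M unfolding P_def by auto
      ultimately show False using no 1(1) 2(1) linked_sym linked_trans by metis
    qed
  qed
  have P0: "P0 \<inter> {w \<in> verts G. d u w \<le> 4 * M} \<noteq> {}" if u: "u \<in> verts G" "height u = n" for u
  proof -
    obtain w where w: "w \<in> verts G" "height w = n - M" "d w u = height u - (n - M)"
      using foot[OF u(1), of "n - M"] u(2) by auto
    have "d u w \<le> 4 * M" using w(3) u(2) gdist_sym[OF u(1) w(1)] nM by linarith
    moreover have "w \<in> P0" using w unfolding P0_def height_def by simp
    ultimately show ?thesis using w(1) by blast
  qed
  have P0AB: "P0 \<inter> A \<noteq> {}" "P0 \<inter> B \<noteq> {}" unfolding A_def B_def using P0[of u] P0[of v] V uv(3) by simp_all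
  have PAB: "P z \<inter> A \<noteq> {} \<and> P z \<inter> B \<noteq> {}"
    if "linked G (above (n + M)) z w" "d z u \<le> 4 * M" "d w v \<le> 4 * M" for z w
  proof -
    have zw: "z \<in> verts G" "w \<in> verts G" using linked_verts[OF that(1)] by auto
    have "z \<in> P z" "w \<in> P z" using that(1) linked_in[OF that(1)] unfolding P_def by (auto intro: linked_refl)
    moreover have "z \<in> A" "w \<in> B"
      using that(2,3) zw gdist_sym[OF zw(1) V(1)] gdist_sym[OF zw(2) V(2)] unfolding A_def B_def by auto
    ultimately show ?thesis by blast
  qed
  have "fat_K23 G M"
    by (rule fat_K23I[of G A B P0 "P z1" "P z2"])
      (simp_all add: conn AB far0 far12 P0AB PAB[OF 1(2-4)] PAB[OF 2(2-4)])
  then show False using no_fat by blast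
qed

end

section \<open>Cycles of a layered graph\<close>

text \<open>Periodic indexing lets a cycle be followed past the end of the list, so the closing edge
  is no special case.\<close>

definition cyc :: "'a list \<Rightarrow> nat \<Rightarrow> 'a" where
  "cyc xs k = xs ! (k mod length xs)"

lemma cyc_periodic: "cyc xs (k + length xs * m) = cyc xs k"
  by (simp add: cyc_def)

lemma cyc_mod: "cyc xs (p + k mod length xs) = cyc xs (p + k)"
  by (simp add: cyc_def mod_add_right_eq)

lemma range_cyc: "xs \<noteq> [] \<Longrightarrow> range (cyc xs) = set xs"
proof
  assume ne: "xs \<noteq> []"
  then show "range (cyc xs) \<subseteq> set xs" by (auto simp: cyc_def)
  show "set xs \<subseteq> range (cyc xs)"
  proof
    fix v assume "v \<in> set xs"
    then obtain i where "i < length xs" "v = xs ! i" by (auto simp: in_set_conv_nth)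
    then have "v = cyc xs i" by (simp add: cyc_def)
    then show "v \<in> range (cyc xs)" by blast
  qed
qed

lemma cycle_edges_cyc:
  assumes "xs \<noteq> []"
  shows "cycle_edges xs = range (\<lambda>k. {cyc xs k, cyc xs (Suc k)})"
proof -
  have "{cyc xs k, cyc xs (Suc k)} \<in> cycle_edges xs" for k
  proof -
    have "k mod length xs < length xs" using assms by simp
    moreover have "Suc (k mod length xs) mod length xs = Suc k mod length xs" by (rule mod_Suc_eq)
    ultimately show ?thesis unfolding cycle_edges_def cyc_def
      by (intro CollectI exI[of _ "k mod length xs"]) simp
  qed
  moreover have "\<exists>k. e = {cyc xs k, cyc xs (Suc k)}" if "e \<in> cycle_edges xs" for e
    using that unfolding cycle_edges_def cyc_def by force
  ultimately show ?thesis by blast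
qed

lemma cyc_eq_iff:
  assumes "distinct xs" "xs \<noteq> []"
  shows "cyc xs i = cyc xs j \<longleftrightarrow> i mod length xs = j mod length xs"
  unfolding cyc_def using assms by (simp add: nth_eq_iff_index_eq)

lemma cyc_shift_neq:
  assumes "distinct xs" "0 < j" "j < length xs"
  shows "cyc xs (p + j) \<noteq> cyc xs p"
proof
  assume "cyc xs (p + j) = cyc xs p"
  then have "(p + j) mod length xs = p mod length xs" using assms cyc_eq_iff[of xs] by (cases xs) auto
  then have "length xs dvd j" using mod_eq_dvd_iff_nat[of p "p + j" "length xs"] by simp
  then show False using assms by (auto dest: dvd_imp_le)
qed

lemma Union_cycle_edges: "xs \<noteq> [] \<Longrightarrow> \<Union> (cycle_edges xs) = set xs"
  by (auto simp: cycle_edges_cyc simp flip: range_cyc)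

text \<open>A nonempty set of edges of a cycle that leaves no vertex with degree one is closed under
  passing to the next edge, hence is everything.\<close>

lemma cycle_edges_minimal:
  assumes xs: "distinct xs" "xs \<noteq> []" and E: "E \<subseteq> cycle_edges xs" "E \<noteq> {}"
    and deg: "\<And>e v. e \<in> E \<Longrightarrow> v \<in> e \<Longrightarrow> \<exists>f\<in>E. f \<noteq> e \<and> v \<in> f"
  shows "E = cycle_edges xs"
proof -
  define n where "n = length xs"
  have n: "0 < n" using xs unfolding n_def by simp
  let ?e = "\<lambda>k. {cyc xs k, cyc xs (Suc k)}"
  have next_edge: "?e (Suc k) \<in> E" if k: "?e k \<in> E" for k
  proof -
    obtain f where f: "f \<in> E" "f \<noteq> ?e k" "cyc xs (Suc k) \<in> f" using deg[OF k, of "cyc xs (Suc k)"] by auto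
    then obtain j where j: "f = ?e j" using E(1) cycle_edges_cyc[OF xs(2)] by blast
    have "cyc xs (Suc k) \<noteq> cyc xs (Suc j)"
    proof
      assume "cyc xs (Suc k) = cyc xs (Suc j)"
      then have "Suc k mod n = Suc j mod n" using cyc_eq_iff[OF xs] unfolding n_def by blast
      then have "(Suc k + (n - 1)) mod n = (Suc j + (n - 1)) mod n" by (rule mod_add_cong) simp
      then have "k mod n = j mod n" using n by simp
      then have "cyc xs k = cyc xs j" unfolding cyc_def n_def by simp
      then show False using f(2) j \<open>cyc xs (Suc k) = cyc xs (Suc j)\<close> by simp
    qed
    then have eq: "cyc xs (Suc k) = cyc xs j" using f(3) j by blast
    then have "Suc k mod n = j mod n" using cyc_eq_iff[OF xs] unfolding n_def by blast
    then have "Suc (Suc k) mod n = Suc j mod n" by (metis mod_Suc_eq)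
    then have "cyc xs (Suc (Suc k)) = cyc xs (Suc j)" unfolding cyc_def n_def by simp
    then show ?thesis using f(1) j eq by simp
  qed
  have later: "?e (k + i) \<in> E" if "?e k \<in> E" for k i
    by (induction i) (use that next_edge in auto)
  obtain e where e: "e \<in> E" "e \<in> cycle_edges xs" using E by blast
  then obtain k where k: "?e k \<in> E" unfolding cycle_edges_cyc[OF xs(2)] by (elim rangeE) simp
  have "?e j \<in> E" for j
  proof -
    \<comment> \<open>Adding \<open>k\<close> full turns moves any index beyond \<open>k\<close>, so
      going forward suffices.\<close>
    have "k \<le> j + n * k" using n by (simp add: trans_le_add2)
    then obtain i where "j + n * k = k + i" using le_Suc_ex by blast
    then have "?e (j + n * k) \<in> E" using later[OF k, of i] by simp
    moreover have "cyc xs (j + n * k) = cyc xs j" "cyc xs (Suc (j + n * k)) = cyc xs (Suc j)"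
      using cyc_periodic[of xs j k] cyc_periodic[of xs "Suc j" k] unfolding n_def by simp_all
    ultimately show ?thesis by simp
  qed
  then show ?thesis using E(1) cycle_edges_cyc[OF xs(2)] by auto
qed

lemma cycle_neighbours:
  assumes xs: "distinct xs" "3 \<le> length xs" and v: "v \<in> set xs"
  shows "\<exists>a b. a \<noteq> b \<and> {v, a} \<in> cycle_edges xs \<and> {v, b} \<in> cycle_edges xs"
proof -
  define n where "n = length xs"
  have ne: "xs \<noteq> []" using xs by auto
  obtain k where k: "v = cyc xs k" using v range_cyc[OF ne] by blast
  \<comment> \<open>The predecessor of \<open>v\<close>, reached from its successor by
    \<open>n - 2\<close> further steps; \<open>0 < n - 2\<close> makes the two neighbours
    different.\<close>
  define a where "a = cyc xs (Suc k + (n - 2))"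
  have "a \<noteq> cyc xs (Suc k)" unfolding a_def using cyc_shift_neq[OF xs(1), of "n - 2" "Suc k"] xs(2)
    unfolding n_def by simp
  moreover have "Suc (Suc k + (n - 2)) = k + n * 1" using xs(2) unfolding n_def by simp
  then have "cyc xs (Suc (Suc k + (n - 2))) = v"
    using cyc_periodic[of xs k 1] k unfolding n_def by (simp only:)
  then have "{v, a} = {cyc xs (Suc k + (n - 2)), cyc xs (Suc (Suc k + (n - 2)))}"
    unfolding a_def by (simp only: insert_commute)
  then have "{v, a} \<in> cycle_edges xs" unfolding cycle_edges_cyc[OF ne] by blast
  moreover have "{v, cyc xs (Suc k)} \<in> cycle_edges xs" unfolding cycle_edges_cyc[OF ne] k by blast
  ultimately show ?thesis by blast
qed

text \<open>\<open>w\<close> is the only exit from \<open>S\<close>. Following the cycle from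
  \<open>v\<close> in both directions, one stays in \<open>S\<close> until \<open>w\<close> is
  reached, and a simple cycle meets \<open>w\<close> at most once.\<close>

lemma cycle_cut:
  assumes C: "simple_cycle C xs" and v: "v \<in> set xs" "v \<in> S" and w: "w \<notin> S"
    and cut: "\<And>a b. a \<in> S \<Longrightarrow> adj C a b \<Longrightarrow> b \<in> S \<or> b = w"
  shows "set xs \<subseteq> insert w S"
proof -
  have xs: "distinct xs" "3 \<le> length xs" "xs \<noteq> []" using C unfolding simple_cycle_def by auto
  have adj: "adj C (cyc xs k) (cyc xs (Suc k))" for k
    using C cycle_edges_cyc[OF xs(3)] unfolding simple_cycle_def adj_def by blast
  have shift: "\<exists>j<length xs. u = cyc xs (p + j)" if u: "u \<in> set xs" for u p
  proof -
    obtain m where m: "u = cyc xs m" using u range_cyc[OF xs(3)] by blast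
    have "p \<le> m + length xs * p" using xs(2) by (simp add: trans_le_add2)
    then obtain i where i: "m + length xs * p = p + i" using le_Suc_ex by blast
    have "u = cyc xs (p + i)" using m cyc_periodic[of xs m p] i by simp
    then have "u = cyc xs (p + i mod length xs)" by (simp add: cyc_mod)
    then show ?thesis using xs(3) by (intro exI[of _ "i mod length xs"]) simp
  qed
  show ?thesis
  proof (cases "w \<in> set xs")
    case False
    obtain k where k: "v = cyc xs k" using v range_cyc[OF xs(3)] by blast
    have "cyc xs (k + i) \<in> S" for i
    proof (induction i)
      case 0 then show ?case using k v by simp
    next
      case (Suc i)
      have "cyc xs (Suc (k + i)) \<noteq> w" using False range_cyc[OF xs(3)] by blast
      then show ?case using cut[OF Suc.IH adj] by simp
    qed
    then show ?thesis using shift[of _ k] by blast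
  next
    case True
    then obtain p where p: "w = cyc xs p" using range_cyc[OF xs(3)] by blast
    obtain j0 where j0: "j0 < length xs" "v = cyc xs (p + j0)" using shift[OF v(1)] by blast
    have j0': "0 < j0" using j0 p v w by (cases j0) auto
    have up: "j0 + i < length xs \<longrightarrow> cyc xs (p + (j0 + i)) \<in> S" for i
    proof (induction i)
      case 0 then show ?case using j0 v by simp
    next
      case (Suc i)
      show ?case
      proof
        assume lt: "j0 + Suc i < length xs"
        then have "cyc xs (p + (j0 + i)) \<in> S" using Suc.IH by simp
        then have "cyc xs (p + (j0 + Suc i)) \<in> S \<or> cyc xs (p + (j0 + Suc i)) = w"
          using cut adj[of "p + (j0 + i)"] by simp
        then show "cyc xs (p + (j0 + Suc i)) \<in> S"
          using cyc_shift_neq[OF xs(1) _ lt, of p] p by auto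
      qed
    qed
    have down: "i < j0 \<longrightarrow> cyc xs (p + (j0 - i)) \<in> S" for i
    proof (induction i)
      case 0 then show ?case using j0 v by simp
    next
      case (Suc i)
      show ?case
      proof
        assume lt: "Suc i < j0"
        then have "cyc xs (p + (j0 - i)) \<in> S" using Suc.IH by simp
        moreover have "Suc (p + (j0 - Suc i)) = p + (j0 - i)" using lt by simp
        then have "adj C (cyc xs (p + (j0 - i))) (cyc xs (p + (j0 - Suc i)))"
          using adj[of "p + (j0 - Suc i)"] adj_sym[of C] by metis
        ultimately have "cyc xs (p + (j0 - Suc i)) \<in> S \<or> cyc xs (p + (j0 - Suc i)) = w"
          using cut by blast
        then show "cyc xs (p + (j0 - Suc i)) \<in> S"
          using cyc_shift_neq[OF xs(1), of "j0 - Suc i" p] lt j0(1) p by auto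
      qed
    qed
    show ?thesis
    proof
      fix u assume "u \<in> set xs"
      then obtain j where j: "j < length xs" "u = cyc xs (p + j)" using shift by blast
      consider "j = 0" | "0 < j" "j \<le> j0" | "j0 \<le> j" by linarith
      then show "u \<in> insert w S"
      proof cases
        case 1 then show ?thesis using j p by simp
      next
        case 2 then show ?thesis using j down[of "j0 - j"] by simp
      next
        case 3 then show ?thesis using j up[of "j - j0"] by simp
      qed
    qed
  qed
qed

section \<open>Layerings that force a cactus\<close>

definition upper :: "'a ugraph \<Rightarrow> ('a \<Rightarrow> nat) \<Rightarrow> nat \<Rightarrow> 'a set" where
  "upper C lev n = {v \<in> verts C. n \<le> lev v}"

text \<open>For the quotient below, twins are two different pieces of one cluster.\<close>

definition twin :: "'a ugraph \<Rightarrow> ('a \<Rightarrow> nat) \<Rightarrow> 'a \<Rightarrow> 'a \<Rightarrow> bool" where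
  "twin C lev a b \<longleftrightarrow> a \<noteq> b \<and> lev a = lev b \<and> linked C (upper C lev (lev a)) a b"

text \<open>The axioms isolate what the cycle argument needs from the geometry. A node has at most
  one twin, a node with a twin has one lower neighbour, the common lower neighbour of twins has no
  twin, and only one component above a twin pair is attached to both. So a cycle can be continued
  upwards and downwards from any of its twin pairs in only one way.\<close>

locale cactus_layering = connected_ugraph C for C :: "'a ugraph" +
  fixes lev :: "'a \<Rightarrow> nat"
  assumes lev_adj: "adj C a b \<Longrightarrow> lev a = lev b + 1 \<or> lev b = lev a + 1"
    and down_ex: "a \<in> verts C \<Longrightarrow> 0 < lev a \<Longrightarrow> \<exists>b. adj C a b \<and> lev a = lev b + 1"
    and root_unique: "a \<in> verts C \<Longrightarrow> b \<in> verts C \<Longrightarrow> lev a = 0 \<Longrightarrow> lev b = 0 \<Longrightarrow> a = b"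
    and down_unique: "twin C lev a b \<Longrightarrow> adj C a u \<Longrightarrow> adj C a v \<Longrightarrow> lev a = lev u + 1 \<Longrightarrow>
      lev a = lev v + 1 \<Longrightarrow> u = v"
    and twin_unique: "twin C lev a b \<Longrightarrow> twin C lev a c \<Longrightarrow> b = c"
    and twin_parents: "twin C lev a b \<Longrightarrow> adj C a u \<Longrightarrow> adj C b u \<Longrightarrow> lev a = lev u + 1 \<Longrightarrow> \<not> twin C lev u w"
    and bridge_unique: "twin C lev u v \<Longrightarrow>
      adj C x u \<Longrightarrow> adj C y v \<Longrightarrow> lev x = lev u + 1 \<Longrightarrow> lev y = lev u + 1 \<Longrightarrow>
      linked C (upper C lev (lev u + 1)) x y \<Longrightarrow>
      adj C x' u \<Longrightarrow> adj C y' v \<Longrightarrow> lev x' = lev u + 1 \<Longrightarrow> lev y' = lev u + 1 \<Longrightarrow>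
      linked C (upper C lev (lev u + 1)) x' y' \<Longrightarrow>
      linked C (upper C lev (lev u + 1)) x x'"
begin

abbreviation up :: "nat \<Rightarrow> 'a set" where "up \<equiv> upper C lev"
abbreviation tw :: "'a \<Rightarrow> 'a \<Rightarrow> bool" where "tw \<equiv> twin C lev"

lemma up_mono: "linked C (up m) a b \<Longrightarrow> n \<le> m \<Longrightarrow> linked C (up n) a b"
  by (erule linked_mono) (auto simp: upper_def)

lemma tw_sym: "tw a b \<Longrightarrow> tw b a"
  unfolding twin_def using linked_sym by metis

text \<open>A cycle with top \<open>z\<close>, given by its two descending sides.\<close>

definition diamond :: "'a \<Rightarrow> nat \<Rightarrow> (nat \<Rightarrow> 'a) \<Rightarrow> (nat \<Rightarrow> 'a) \<Rightarrow> bool" where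
  "diamond z K p q \<longleftrightarrow> p 0 = z \<and> q 0 = z \<and> 2 \<le> K \<and> p K = q K \<and>
     (\<forall>k<K. adj C (p k) (p (Suc k)) \<and> lev (p k) = lev (p (Suc k)) + 1 \<and>
       adj C (q k) (q (Suc k)) \<and> lev (q k) = lev (q (Suc k)) + 1) \<and>
     (\<forall>k. 0 < k \<and> k < K \<longrightarrow> p k \<noteq> q k)"

definition diamond_edges :: "nat \<Rightarrow> (nat \<Rightarrow> 'a) \<Rightarrow> (nat \<Rightarrow> 'a) \<Rightarrow> 'a set set" where
  "diamond_edges K p q = (\<lambda>k. {p k, p (Suc k)}) ` {..<K} \<union> (\<lambda>k. {q k, q (Suc k)}) ` {..<K}"

lemma diamond_swap: "diamond z K p q \<Longrightarrow> diamond z K q p"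
  unfolding diamond_def by metis

lemma diamond_edges_swap: "diamond_edges K p q = diamond_edges K q p"
  unfolding diamond_edges_def by (rule Un_commute)

lemma diamond_step:
  assumes "diamond z K p q" "k < K"
  shows "adj C (p k) (p (Suc k))" "lev (p k) = lev (p (Suc k)) + 1"
  using assms unfolding diamond_def by simp_all

lemma diamond_start: "diamond z K p q \<Longrightarrow> p 0 = z"
  unfolding diamond_def by simp

lemma diamond_K: "diamond z K p q \<Longrightarrow> 2 \<le> K"
  unfolding diamond_def by simp

lemma diamond_end: "diamond z K p q \<Longrightarrow> p K = q K"
  unfolding diamond_def by simp

lemma diamond_neq: "diamond z K p q \<Longrightarrow> 0 < k \<Longrightarrow> k < K \<Longrightarrow> p k \<noteq> q k"
  unfolding diamond_def by simp

lemma diamond_lev: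
  assumes "diamond z K p q"
  shows "k \<le> K \<Longrightarrow> lev (p k) + k = lev z"
proof (induction k)
  case 0 then show ?case using diamond_start[OF assms] by simp
next
  case (Suc k) then show ?case using diamond_step(2)[OF assms, of k] by simp
qed

lemma diamond_verts: "diamond z K p q \<Longrightarrow> k \<le> K \<Longrightarrow> p k \<in> verts C"
  using diamond_step(1)[of z K p q k] diamond_step(1)[of z K p q "k - 1"] adj_verts diamond_K[of z K p q]
  by (cases k) auto

lemma diamond_linked:
  assumes D: "diamond z K p q"
  shows "k \<le> K \<Longrightarrow> linked C (up (lev (p k))) z (p k)"
proof (induction k)
  case 0
  then show ?case using diamond_start[OF D] diamond_verts[OF D, of 0] by (auto intro: linked_refl simp: upper_def)
next
  case (Suc k)
  then have "linked C (up (lev (p (Suc k)))) z (p k)"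
    using up_mono diamond_step(2)[OF D, of k] by simp
  moreover have "p (Suc k) \<in> up (lev (p (Suc k)))"
    using diamond_verts[OF D Suc.prems] by (simp add: upper_def)
  ultimately show ?case
    using linked_step diamond_step(1)[OF D, of k] Suc.prems by simp
qed

lemma diamond_pair:
  assumes D: "diamond z K p q" "k \<le> K"
  shows "linked C (up (lev (p k))) (p k) (q k)"
proof -
  have "lev (q k) = lev (p k)" using diamond_lev[OF D] diamond_lev[OF diamond_swap[OF D(1)] D(2)] by simp
  then show ?thesis
    using diamond_linked[OF D] diamond_linked[OF diamond_swap[OF D(1)] D(2)] linked_sym linked_trans by metis
qed

lemma diamond_twin: "diamond z K p q \<Longrightarrow> 0 < k \<Longrightarrow> k < K \<Longrightarrow> tw (p k) (q k)"
  unfolding twin_def using diamond_pair[of z K p q k] diamond_neq[of z K p q k]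
    diamond_lev[of z K p q k] diamond_lev[OF diamond_swap, of z K p q k] by simp

text \<open>A twin would force \<open>p 1 = q 1\<close> by \<open>down_unique\<close>. Thus a top is
  the only node of its level in its component.\<close>

lemma diamond_top:
  assumes D: "diamond z K p q" shows "\<not> tw z w"
proof
  assume "tw z w"
  moreover have "0 < K" "1 < K" using diamond_K[OF D] by auto
  ultimately have "p 1 = q 1"
    using down_unique[of z w "p 1" "q 1"] diamond_step[OF D, of 0] diamond_step[OF diamond_swap[OF D], of 0]
      diamond_start[OF D] diamond_start[OF diamond_swap[OF D]] by simp
  then show False using diamond_neq[OF D, of 1] \<open>1 < K\<close> by simp
qed

text \<open>The last pair before the bottom consists of twins with the bottom as common lower
  neighbour.\<close>

lemma diamond_bottom:
  assumes D: "diamond z K p q" shows "\<not> tw (p K) w"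
proof -
  obtain k where k: "K = Suc k" "0 < k" using diamond_K[OF D] by (cases K) auto
  have "adj C (q k) (p K)" using diamond_step(1)[OF diamond_swap[OF D], of k] diamond_end[OF D] k by simp
  then show ?thesis
    using twin_parents[OF diamond_twin[OF D, of k]] diamond_step[OF D, of k] k by blast
qed

text \<open>Descend from \<open>a\<close> and from \<open>b\<close> by arbitrary choices. Both
  descents end in the unique node of level 0, and their first common node is the bottom.\<close>

lemma diamond_ex:
  assumes "adj C z a" "adj C z b" "a \<noteq> b" "lev z = lev a + 1" "lev z = lev b + 1"
  shows "\<exists>K p q. diamond z K p q \<and> p 1 = a \<and> q 1 = b"
proof -
  define dn where "dn = (\<lambda>v. SOME w. adj C v w \<and> lev v = lev w + 1)"
  have dn: "adj C v (dn v) \<and> lev v = lev (dn v) + 1" if "v \<in> verts C" "0 < lev v" for v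
    unfolding dn_def using someI_ex[OF down_ex[OF that]] .
  define s where "s = (\<lambda>a k. case k of 0 \<Rightarrow> z | Suc j \<Rightarrow> (dn ^^ j) a)"
  have s: "s a k \<in> verts C \<and> lev (s a k) + k = lev z"
    if "adj C z a" "lev z = lev a + 1" "k \<le> lev z" for a k
    using that(3)
  proof (induction k)
    case 0 then show ?case using that adj_verts by (simp add: s_def)
  next
    case (Suc k)
    show ?case
    proof (cases k)
      case 0 then show ?thesis using that adj_verts by (simp add: s_def)
    next
      case (Suc j)
      then have "s a (Suc k) = dn (s a k)" by (simp add: s_def)
      then show ?thesis using Suc.IH Suc.prems dn[of "s a k"] adj_verts by fastforce
    qed
  qed
  have step: "adj C (s a k) (s a (Suc k)) \<and> lev (s a k) = lev (s a (Suc k)) + 1"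
    if "adj C z a" "lev z = lev a + 1" "k < lev z" for a k
  proof (cases k)
    case 0 then show ?thesis using that by (simp add: s_def)
  next
    case (Suc j)
    then have "s a (Suc k) = dn (s a k)" by (simp add: s_def)
    then show ?thesis using dn[of "s a k"] s[OF that(1,2), of k] that(3) by simp
  qed
  define P where "P = (\<lambda>k. 0 < k \<and> s a k = s b k)"
  have "s a (lev z) = s b (lev z)"
    using root_unique s[OF assms(1,4), of "lev z"] s[OF assms(2,5), of "lev z"] by simp
  then have ex: "P (lev z)" unfolding P_def using assms(4) by simp
  define K where "K = (LEAST k. P k)"
  have K: "P K" "K \<le> lev z" "\<And>k. k < K \<Longrightarrow> \<not> P k"
    unfolding K_def using ex by (auto intro: LeastI Least_le dest: not_less_Least)
  have s1: "s a 1 = a" "s b 1 = b" "s a 0 = z" "s b 0 = z" unfolding s_def by simp_all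
  have "K \<noteq> 1" using K(1) s1 assms(3) unfolding P_def by auto
  then have "2 \<le> K" using K(1) unfolding P_def by simp
  moreover have "s a k \<noteq> s b k" if "0 < k" "k < K" for k
    using K(3)[OF that(2)] that(1) unfolding P_def by simp
  moreover have "s a K = s b K" using K(1) unfolding P_def by simp
  ultimately have "diamond z K (s a) (s b)"
    unfolding diamond_def using s1 step[OF assms(1,4)] step[OF assms(2,5)] K(2) by simp
  then show ?thesis using s1 by blast
qed

text \<open>If the cycle left the side \<open>p\<close> of the diamond upwards at \<open>v\<close>, it would enter a component that is
  attached to the rest of the graph only at \<open>v\<close>, by the uniqueness of the bridge.\<close>

lemma chain_in_cycle:
  assumes D: "diamond z K p q" and xs: "simple_cycle C xs" and e: "{p 0, p 1} \<in> cycle_edges xs"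
  shows "k < K \<Longrightarrow> {p k, p (Suc k)} \<in> cycle_edges xs"
proof (induction k)
  case 0 then show ?case using e by simp
next
  case (Suc k)
  have xs': "distinct xs" "3 \<le> length xs" "xs \<noteq> []" "cycle_edges xs \<subseteq> edges C"
    using xs unfolding simple_cycle_def by auto
  let ?v = "p (Suc k)" and ?v' = "q (Suc k)"
  note D' = diamond_swap[OF D]
  have k: "k < K" "Suc k < K" using Suc.prems by auto
  have edge: "{p k, ?v} \<in> cycle_edges xs" using Suc by simp
  then have in_xs: "p k \<in> set xs" "?v \<in> set xs" using Union_cycle_edges[OF xs'(3)] by blast+
  obtain w where w: "w \<noteq> p k" "{?v, w} \<in> cycle_edges xs"
    using cycle_neighbours[OF xs'(1,2) in_xs(2)] by metis
  have vw: "adj C ?v w" using w xs'(4) unfolding adj_def by blast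
  have w_xs: "w \<in> set xs" using w(2) Union_cycle_edges[OF xs'(3)] by blast
  have tw: "tw ?v ?v'" using diamond_twin[OF D] k by simp
  define n where "n = lev ?v + 1"
  have levk: "lev (p k) = n" "lev (q k) = n"
    using diamond_step(2)[OF D k(1)] diamond_step(2)[OF D' k(1)] tw unfolding n_def twin_def by auto
  show ?case
  proof (cases "lev ?v = lev w + 1")
    case True
    then have "w = p (Suc (Suc k))"
      using down_unique[OF tw vw diamond_step(1)[OF D k(2)] True diamond_step(2)[OF D k(2)]] by simp
    then show ?thesis using w(2) by simp
  next
    case False
    then have lw: "lev w = n" using lev_adj[OF vw] unfolding n_def by auto
    \<comment> \<open>Otherwise \<open>w\<close> would be a twin of \<open>p k\<close>. For the top
      this is impossible; below it \<open>w\<close> is \<open>q k\<close>, whose unique lower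
      neighbour is \<open>?v'\<close> and not \<open>?v\<close>.\<close>
    have star: "\<not> linked C (up n) w (p k)"
    proof
      assume "linked C (up n) w (p k)"
      then have t: "tw (p k) w" using w(1) lw levk linked_sym unfolding twin_def by metis
      show False
      proof (cases "k = 0")
        case True then show ?thesis using t diamond_top[OF D] diamond_start[OF D] by simp
      next
        case False
        then have tk: "tw (p k) (q k)" using diamond_twin[OF D] k by simp
        then have "w = q k" using twin_unique t by blast
        then have "adj C (q k) ?v" using vw adj_sym by metis
        then have "?v = ?v'"
          using down_unique[OF tw_sym[OF tk] _ diamond_step(1)[OF D' k(1)] _ diamond_step(2)[OF D' k(1)], of ?v]
            levk unfolding n_def by simp
        then show False using tw unfolding twin_def by simp
      qed
    qed
    define S where "S = {s. linked C (up n) w s}"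
    have "w \<in> up n" using lw adj_verts(2)[OF vw] by (simp add: upper_def)
    then have wS: "w \<in> S" unfolding S_def by (simp add: linked_refl)
    have vS: "?v \<notin> S" using linked_in[of C "up n" w ?v] unfolding S_def n_def upper_def by auto
    \<comment> \<open>Another exit from \<open>S\<close> would be the twin \<open>?v'\<close> of
      \<open>?v\<close>. Then \<open>S\<close> would be attached to both twins, as is the component
      of \<open>p k\<close>, and the two would coincide.\<close>
    have cut: "t \<in> S \<or> t = ?v" if s: "s \<in> S" "adj C s t" for s t
    proof (rule ccontr)
      assume no: "\<not> (t \<in> S \<or> t = ?v)"
      have ws: "linked C (up n) w s" using s(1) unfolding S_def by simp
      have tV: "t \<in> verts C" "s \<in> verts C" using adj_verts s(2) by auto
      have "t \<notin> up n" using linked_step[OF ws s(2)] no unfolding S_def by blast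
      moreover have "n \<le> lev s" using linked_in[OF ws] by (simp add: upper_def)
      ultimately have lt: "lev t = lev ?v" "lev s = n" using lev_adj[OF s(2)] tV unfolding upper_def n_def by auto
      have "linked C (up (lev ?v)) w s" using up_mono[OF ws, of "lev ?v"] unfolding n_def by simp
      then have "linked C (up (lev ?v)) w t" using linked_step[OF _ s(2)] tV lt by (simp add: upper_def)
      moreover have "linked C (up (lev ?v)) ?v w"
        using linked_step[OF linked_refl vw] adj_verts[OF vw] lw unfolding n_def by (simp add: upper_def)
      ultimately have "tw ?v t" unfolding twin_def using no lt linked_trans by metis
      then have "t = ?v'" using twin_unique tw by blast
      then have "linked C (up (lev ?v + 1)) w (p k)"
        using bridge_unique[OF tw, of w s "p k" "q k"] vw adj_sym[of C w ?v] s(2) lw lt ws levk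
          diamond_step(1)[OF D k(1)] diamond_step(1)[OF D' k(1)] diamond_pair[OF D, of k] k
        unfolding n_def by simp
      then show False using star unfolding n_def by simp
    qed
    have "p k \<in> insert ?v S" using cycle_cut[OF xs w_xs wS vS] cut in_xs(1) by blast
    moreover have "p k \<noteq> ?v" using levk unfolding n_def by auto
    ultimately show ?thesis using star unfolding S_def by simp
  qed
qed

text \<open>At the top and at the bottom the second edge belongs to the other side, elsewhere to the
  same side. This is the degree condition of \<open>cycle_edges_minimal\<close>.\<close>

lemma diamond_degree:
  assumes D: "diamond z K p q" and k: "k < K" and v: "v \<in> {p k, p (Suc k)}"
  shows "\<exists>f\<in>diamond_edges K p q. f \<noteq> {p k, p (Suc k)} \<and> v \<in> f"
proof -
  have K: "2 \<le> K" using diamond_K[OF D] .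
  have L: "lev (p i) + i = lev z" if "i \<le> K" for i using diamond_lev[OF D that] .
  have pin: "{p i, p (Suc i)} \<in> diamond_edges K p q" "{q i, q (Suc i)} \<in> diamond_edges K p q"
    if "i < K" for i using that unfolding diamond_edges_def by auto
  consider "v = p k" "k = 0" | j where "v = p k" "k = Suc j" | "v = p (Suc k)" "Suc k < K" | "v = p (Suc k)" "Suc k = K"
  proof -
    have "Suc k < K \<or> Suc k = K" using k by linarith
    then show thesis using v that by (cases k) auto
  qed
  then show ?thesis
  proof cases
    case 1
    have "p 1 \<noteq> q 1" using diamond_neq[OF D, of 1] K by simp
    then have "{q 0, q (Suc 0)} \<noteq> {p 0, p (Suc 0)}"
      using diamond_start[OF D] diamond_start[OF diamond_swap[OF D]] by (auto simp: doubleton_eq_iff)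
    then show ?thesis using 1 pin(2)[of 0] k diamond_start[OF D] diamond_start[OF diamond_swap[OF D]]
      by (intro bexI[of _ "{q 0, q (Suc 0)}"]) auto
  next
    case (2 j)
    have "p j \<noteq> p k" "p j \<noteq> p (Suc k)" using L[of j] L[of k] L[of "Suc k"] 2 k by auto
    then show ?thesis using 2 pin(1)[of j] k by (intro bexI[of _ "{p j, p (Suc j)}"]) auto
  next
    case 3
    have "p k \<noteq> p (Suc k)" "p k \<noteq> p (Suc (Suc k))" using L[of k] L[of "Suc k"] L[of "Suc (Suc k)"] 3 by auto
    then show ?thesis using 3 pin(1)[of "Suc k"] by (intro bexI[of _ "{p (Suc k), p (Suc (Suc k))}"]) auto
  next
    case 4
    have "p k \<noteq> q k" using diamond_neq[OF D, of k] 4 K by simp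
    moreover have "p k \<noteq> p (Suc k)" using L[of k] L[of "Suc k"] 4 by auto
    moreover have "q (Suc k) = p (Suc k)" using diamond_end[OF D] 4 by simp
    ultimately show ?thesis using 4 pin(2)[of k] k by (intro bexI[of _ "{q k, q (Suc k)}"]) auto
  qed
qed

text \<open>Take a highest vertex \<open>z\<close> of the cycle. Its two neighbours lie one level
  lower, and the diamond through them is contained in the cycle by \<open>chain_in_cycle\<close>;
  having no vertex of degree one, it is the whole cycle.\<close>

lemma cycle_diamond:
  assumes xs: "simple_cycle C xs"
  shows "\<exists>z K p q. diamond z K p q \<and> cycle_edges xs = diamond_edges K p q"
proof -
  have xs': "distinct xs" "3 \<le> length xs" "xs \<noteq> []" "cycle_edges xs \<subseteq> edges C"
    using xs unfolding simple_cycle_def by auto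
  have "Max (lev ` set xs) \<in> lev ` set xs" using xs'(3) by (intro Max_in) auto
  then obtain z where z: "z \<in> set xs" "lev z = Max (lev ` set xs)" by auto
  have max: "lev y \<le> lev z" if "y \<in> set xs" for y using that z(2) by simp
  obtain a b where ab: "a \<noteq> b" "{z, a} \<in> cycle_edges xs" "{z, b} \<in> cycle_edges xs"
    using cycle_neighbours[OF xs'(1,2) z(1)] by blast
  have "a \<in> set xs" "b \<in> set xs" using ab Union_cycle_edges[OF xs'(3)] by blast+
  then have "lev a \<le> lev z" "lev b \<le> lev z" using max by auto
  moreover have adj: "adj C z a" "adj C z b" using ab xs'(4) unfolding adj_def by auto
  ultimately have "lev z = lev a + 1" "lev z = lev b + 1"
    using lev_adj[OF adj(1)] lev_adj[OF adj(2)] by auto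
  then obtain K p q where D: "diamond z K p q" and 1: "p 1 = a" "q 1 = b"
    using diamond_ex adj ab(1) by metis
  have 0: "p 0 = z" "q 0 = z" using D unfolding diamond_def by auto
  have "{p k, p (Suc k)} \<in> cycle_edges xs" "{q k, q (Suc k)} \<in> cycle_edges xs" if "k < K" for k
    using chain_in_cycle[OF D xs _ that] chain_in_cycle[OF diamond_swap[OF D] xs _ that] 0 1 ab by auto
  then have sub: "diamond_edges K p q \<subseteq> cycle_edges xs" unfolding diamond_edges_def by auto
  have "{p 0, p (Suc 0)} \<in> diamond_edges K p q" unfolding diamond_edges_def using diamond_K[OF D] by auto
  moreover have "\<exists>f\<in>diamond_edges K p q. f \<noteq> e \<and> v \<in> f" if ev: "e \<in> diamond_edges K p q" "v \<in> e" for e v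
  proof -
    consider k where "k < K" "e = {p k, p (Suc k)}" | k where "k < K" "e = {q k, q (Suc k)}"
      using ev unfolding diamond_edges_def by auto
    then show ?thesis
    proof cases
      case 1 then show ?thesis using diamond_degree[OF D] ev(2) by blast
    next
      case 2 then show ?thesis using diamond_degree[OF diamond_swap[OF D]] ev(2) diamond_edges_swap by metis
    qed
  qed
  ultimately have "diamond_edges K p q = cycle_edges xs"
    using cycle_edges_minimal[OF xs'(1,3) sub] by blast
  then show ?thesis using D by metis
qed

text \<open>Both diamonds continue in the unique component that is attached to both twins, so
  \<open>p a\<close> and \<open>p' b\<close> are equal or twins. Twins would mean
  \<open>p' b = q a\<close>, and the unique lower neighbour of \<open>q a\<close> would identify the
  twins below.\<close>

lemma diamond_up_step:
  assumes D: "diamond z K p q" and E: "diamond z' K' p' q'"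
    and a: "Suc a < K" "Suc b < K'" and eq: "p (Suc a) = p' (Suc b)" "q (Suc a) = q' (Suc b)"
  shows "p a = p' b"
proof (rule ccontr)
  assume ne: "p a \<noteq> p' b"
  note D' = diamond_swap[OF D] and E' = diamond_swap[OF E]
  let ?u = "p (Suc a)" and ?v = "q (Suc a)"
  have t: "tw ?u ?v" using diamond_twin[OF D] a by simp
  have lv: "lev ?v = lev ?u" using t unfolding twin_def by simp
  have lev: "lev (p a) = lev ?u + 1" "lev (q a) = lev ?u + 1" "lev (p' b) = lev ?u + 1" "lev (q' b) = lev ?u + 1"
    using diamond_step(2)[OF D, of a] diamond_step(2)[OF D', of a] diamond_step(2)[OF E, of b]
      diamond_step(2)[OF E', of b] a eq lv by auto
  have adj: "adj C (p a) ?u" "adj C (q a) ?v" "adj C (p' b) ?u" "adj C (q' b) ?v"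
    using diamond_step(1)[OF D, of a] diamond_step(1)[OF D', of a] diamond_step(1)[OF E, of b]
      diamond_step(1)[OF E', of b] a eq by auto
  have "linked C (up (lev ?u + 1)) (p a) (p' b)"
    using bridge_unique[OF t adj(1,2) lev(1,2) _ adj(3,4) lev(3,4)]
      diamond_pair[OF D, of a] diamond_pair[OF E, of b] lev a by simp
  then have tw: "tw (p a) (p' b)" using ne lev unfolding twin_def by simp
  show False
  proof (cases "a = 0")
    case True then show ?thesis using tw diamond_top[OF D] diamond_start[OF D] by simp
  next
    case False
    then have tk: "tw (p a) (q a)" using diamond_twin[OF D] a by simp
    then have "p' b = q a" using twin_unique tw by blast
    then have "?u = ?v" using down_unique[OF tw_sym[OF tk], of ?u ?v] adj lev lv by simp
    then show False using t unfolding twin_def by simp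
  qed
qed

text \<open>A common vertex below the top and above the bottom has a unique twin, so the diamonds
  share a pair. From there they agree upwards by \<open>diamond_up_step\<close> and downwards by
  \<open>down_unique\<close>.\<close>

lemma diamond_unique:
  assumes D: "diamond z K p q" and E: "diamond z' K' p' q'"
    and k: "0 < k" "k < K" "0 < j" "j < K'" and eq: "p k = p' j"
  shows "diamond_edges K p q = diamond_edges K' p' q'"
proof -
  note D' = diamond_swap[OF D] and E' = diamond_swap[OF E]
  have eq': "q k = q' j"
    using twin_unique diamond_twin[OF D k(1,2)] diamond_twin[OF E k(3,4)] eq by metis
  have up: "i \<le> k \<longrightarrow> i \<le> j \<longrightarrow> p (k - i) = p' (j - i) \<and> q (k - i) = q' (j - i)" for i
  proof (induction i)
    case 0 then show ?case using eq eq' by simp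
  next
    case (Suc i)
    show ?case
    proof (intro impI)
      assume i: "Suc i \<le> k" "Suc i \<le> j"
      then have s: "k - i = Suc (k - Suc i)" "j - i = Suc (j - Suc i)" by auto
      have "Suc (k - Suc i) < K" "Suc (j - Suc i) < K'" using i k by auto
      then show "p (k - Suc i) = p' (j - Suc i) \<and> q (k - Suc i) = q' (j - Suc i)"
        using diamond_up_step[OF D E, of "k - Suc i" "j - Suc i"]
          diamond_up_step[OF D' E', of "k - Suc i" "j - Suc i"] Suc.IH i s by simp
    qed
  qed
  \<comment> \<open>Had one diamond reached its top earlier, this top would be an inner vertex of
    the other and have a twin.\<close>
  have "\<not> k < j"
  proof
    assume "k < j"
    then have "z = p' (j - k)" using up[of k] diamond_start[OF D] by simp
    moreover have "tw (p' (j - k)) (q' (j - k))"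
      by (rule diamond_twin[OF E]) (use k \<open>k < j\<close> in simp_all)
    ultimately show False using diamond_top[OF D] by blast
  qed
  moreover have "\<not> j < k"
  proof
    assume "j < k"
    then have "z' = p (k - j)" using up[of j] diamond_start[OF E] by simp
    moreover have "tw (p (k - j)) (q (k - j))"
      by (rule diamond_twin[OF D]) (use k \<open>j < k\<close> in simp_all)
    ultimately show False using diamond_top[OF E] by blast
  qed
  ultimately have kj: "k = j" by simp
  have low: "p i = p' i \<and> q i = q' i" if "i \<le> k" for i
    using up[of "k - i"] that kj by simp
  have high: "k + i \<le> K \<longrightarrow> k + i \<le> K' \<longrightarrow> p (k + i) = p' (k + i) \<and> q (k + i) = q' (k + i)" for i
  proof (induction i)
    case 0 then show ?case using low by simp
  next
    case (Suc i)
    show ?case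
    proof (intro impI)
      assume i: "k + Suc i \<le> K" "k + Suc i \<le> K'"
      then have IH: "p (k + i) = p' (k + i)" "q (k + i) = q' (k + i)" using Suc.IH by auto
      have lt: "0 < k + i" "k + i < K" "k + i < K'" using i k by auto
      note t = diamond_twin[OF D lt(1,2)]
      have "p (Suc (k + i)) = p' (Suc (k + i))"
        using down_unique[OF t diamond_step(1)[OF D lt(2)] _ diamond_step(2)[OF D lt(2)]]
          diamond_step[OF E lt(3)] IH by metis
      moreover have "q (Suc (k + i)) = q' (Suc (k + i))"
        using down_unique[OF tw_sym[OF t] diamond_step(1)[OF D' lt(2)] _ diamond_step(2)[OF D' lt(2)]]
          diamond_step[OF E' lt(3)] IH by metis
      ultimately show "p (k + Suc i) = p' (k + Suc i) \<and> q (k + Suc i) = q' (k + Suc i)" by simp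
    qed
  qed
  have all: "p i = p' i \<and> q i = q' i" if "i \<le> K" "i \<le> K'" for i
    using low[of i] high[of "i - k"] that by (cases "i \<le> k") auto
  have "\<not> K < K'" using all[of K] diamond_end[OF D] diamond_neq[OF E, of K] k by auto
  moreover have "\<not> K' < K" using all[of K'] diamond_end[OF E] diamond_neq[OF D, of K'] k by auto
  ultimately have "K = K'" by simp
  then show ?thesis unfolding diamond_edges_def using all by (intro arg_cong2[of _ _ _ _ "(\<union>)"] image_cong) auto
qed

lemma diamond_meet:
  assumes D: "diamond z K p q" and E: "diamond z' K' p' q'"
    and k: "0 < k" "k < K" "0 < j" "j < K'" and v: "v = p k \<or> v = q k" "v = p' j \<or> v = q' j"
  shows "diamond_edges K p q = diamond_edges K' p' q'"
  using diamond_unique[OF D E k] diamond_unique[OF diamond_swap[OF D] E k]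
    diamond_unique[OF D diamond_swap[OF E] k] diamond_unique[OF diamond_swap[OF D] diamond_swap[OF E] k]
    diamond_edges_swap[of K p q] diamond_edges_swap[of K' p' q'] v by metis

lemma diamond_vertex:
  assumes D: "diamond z K p q" and v: "v \<in> \<Union> (diamond_edges K p q)"
  shows "v = z \<or> v = p K \<or> (\<exists>k. 0 < k \<and> k < K \<and> (v = p k \<or> v = q k))"
proof -
  have "\<exists>k\<le>K. v = p k \<or> v = q k"
    using v unfolding diamond_edges_def by (auto intro: less_imp_le Suc_leI)
  then obtain k where k: "k \<le> K" "v = p k \<or> v = q k" by blast
  consider "k = 0" | "k = K" | "0 < k" "k < K" using k by linarith
  then show ?thesis
    using k diamond_start[OF D] diamond_start[OF diamond_swap[OF D]] diamond_end[OF D] by cases auto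
qed

text \<open>If neither shared vertex has a twin, they are top and bottom of both diamonds. The nodes
  just below the common top then lie in one component, so they are equal or twins, and a vertex with
  a twin is shared after all.\<close>

lemma diamond_share_two:
  assumes D: "diamond z K p q" and E: "diamond z' K' p' q'"
    and st: "s \<noteq> t" "s \<in> \<Union> (diamond_edges K p q)" "s \<in> \<Union> (diamond_edges K' p' q')"
      "t \<in> \<Union> (diamond_edges K p q)" "t \<in> \<Union> (diamond_edges K' p' q')"
  shows "diamond_edges K p q = diamond_edges K' p' q'"
proof -
  \<comment> \<open>Being an inner vertex of a side does not depend on the diamond: it means having
    a twin.\<close>
  have twinned: "(\<exists>w. tw v w) \<longleftrightarrow> (\<exists>k. 0 < k \<and> k < K \<and> (v = p k \<or> v = q k))"
    if "diamond z K p q" "v \<in> \<Union> (diamond_edges K p q)" for z K p q v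
    using diamond_vertex[OF that] diamond_top[OF that(1)] diamond_bottom[OF that(1)]
      diamond_twin[OF that(1)] diamond_twin[OF diamond_swap[OF that(1)]] by metis
  have one: ?thesis if v: "v \<in> \<Union> (diamond_edges K p q)" "v \<in> \<Union> (diamond_edges K' p' q')" "\<exists>w. tw v w" for v
  proof -
    obtain k where k: "0 < k" "k < K" "v = p k \<or> v = q k" using twinned[OF D v(1)] v(3) by blast
    obtain j where j: "0 < j" "j < K'" "v = p' j \<or> v = q' j" using twinned[OF E v(2)] v(3) by blast
    show ?thesis using diamond_meet[OF D E k(1,2) j(1,2) k(3) j(3)] .
  qed
  show ?thesis
  proof (cases "(\<exists>w. tw s w) \<or> (\<exists>w. tw t w)")
    case True then show ?thesis using one st by blast
  next
    case False
    then have "s \<in> {z, p K}" "t \<in> {z, p K}" "s \<in> {z', p' K'}" "t \<in> {z', p' K'}"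
      using diamond_vertex[OF D] diamond_vertex[OF E] twinned[OF D] twinned[OF E] st by blast+
    moreover have "lev (p K) < lev z" "lev (p' K') < lev z'"
      using diamond_lev[OF D, of K] diamond_lev[OF E, of K'] diamond_K[OF D] diamond_K[OF E] by auto
    ultimately have zz: "z = z'" using st(1) by auto
    have K: "0 < K" "1 < K" "0 < K'" "1 < K'" using diamond_K[OF D] diamond_K[OF E] by auto
    have "lev (p 1) = lev (p' 1)"
      using diamond_lev[OF D, of 1] diamond_lev[OF E, of 1] K zz by simp
    moreover have "linked C (up (lev (p 1))) z (p 1)" "linked C (up (lev (p' 1))) z (p' 1)"
      using diamond_linked[OF D, of 1] diamond_linked[OF E, of 1] K zz by auto
    ultimately have "p 1 = p' 1 \<or> tw (p 1) (p' 1)"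
      unfolding twin_def by (metis linked_sym linked_trans)
    then have "p' 1 = p 1 \<or> p' 1 = q 1" using twin_unique diamond_twin[OF D, of 1] K by auto
    then show ?thesis using diamond_meet[OF D E _ K(2) _ K(4), of "p' 1"] by simp
  qed
qed

theorem cactus: "cactus C"
  unfolding cactus_def
proof (intro conjI allI impI)
  show "connected_graph C" by (rule connected)
next
  fix xs ys assume *: "simple_cycle C xs \<and> simple_cycle C ys \<and> cycle_edges xs \<noteq> cycle_edges ys"
  then have ne: "xs \<noteq> []" "ys \<noteq> []" unfolding simple_cycle_def by auto
  obtain z K p q where D: "diamond z K p q" "cycle_edges xs = diamond_edges K p q"
    using cycle_diamond * by blast
  obtain z' K' p' q' where E: "diamond z' K' p' q'" "cycle_edges ys = diamond_edges K' p' q'"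
    using cycle_diamond * by blast
  have "s = t" if "s \<in> set xs \<inter> set ys" "t \<in> set xs \<inter> set ys" for s t
  proof (rule ccontr)
    assume "s \<noteq> t"
    then have "cycle_edges xs = cycle_edges ys"
      using diamond_share_two[OF D(1) E(1), of s t] that Union_cycle_edges[OF ne(1)] Union_cycle_edges[OF ne(2)]
      unfolding D(2) E(2) by auto
    then show False using * by blast
  qed
  then have "card (set xs \<inter> set ys) \<le> Suc 0" by (subst card_le_Suc0_iff_eq) auto
  then show "card (set xs \<inter> set ys) \<le> 1" by simp
qed

end

section \<open>Walks and descents in a layering\<close>

context cactus_layering
begin

definition desc :: "'a \<Rightarrow> 'a \<Rightarrow> bool" where
  "desc = (\<lambda>a b. adj C a b \<and> lev a = lev b + 1)\<^sup>*\<^sup>*"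

lemma desc_step: "desc a b \<Longrightarrow> adj C b c \<Longrightarrow> lev b = lev c + 1 \<Longrightarrow> desc a c"
  unfolding desc_def by (rule rtranclp.rtrancl_into_rtrancl) auto

lemma desc_step': "adj C a b \<Longrightarrow> lev a = lev b + 1 \<Longrightarrow> desc b c \<Longrightarrow> desc a c"
  unfolding desc_def by (rule converse_rtranclp_into_rtranclp) auto

lemma desc_linked:
  assumes "desc a b" "a \<in> verts C"
  shows "lev b \<le> lev a \<and> linked C (up (lev b)) a b"
  using assms(1) unfolding desc_def
proof (induction rule: rtranclp_induct)
  case base then show ?case using assms(2) by (simp add: linked_refl upper_def)
next
  case (step b c)
  have "linked C (up (lev c)) a b" using step up_mono[of "lev b" a b "lev c"] by simp
  moreover have "c \<in> up (lev c)" using adj_verts(2)[of b c] step.hyps(2) by (simp add: upper_def)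
  ultimately show ?case using step linked_step by auto
qed

lemma desc_path:
  assumes "desc a b"
  shows "\<exists>P. P 0 = a \<and> P (lev a - lev b) = b \<and>
    (\<forall>i<lev a - lev b. adj C (P i) (P (Suc i)) \<and> lev (P i) = lev (P (Suc i)) + 1)"
proof -
  obtain n where "((\<lambda>a b. adj C a b \<and> lev a = lev b + 1) ^^ n) a b"
    using rtranclp_imp_relpowp[OF assms[unfolded desc_def]] by blast
  then obtain P where P: "P 0 = a" "P n = b" "\<forall>i<n. adj C (P i) (P (Suc i)) \<and> lev (P i) = lev (P (Suc i)) + 1"
    unfolding relpowp_fun_conv by blast
  have "i \<le> n \<longrightarrow> lev a = lev (P i) + i" for i
    by (induction i) (use P in auto)
  from this[of n] have "n = lev a - lev b" using P(2) by simp
  then show ?thesis using P by blast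
qed

lemma desc_ex:
  "a \<in> verts C \<Longrightarrow> n \<le> lev a \<Longrightarrow> \<exists>b. desc a b \<and> lev b = n"
proof (induction "lev a - n" arbitrary: a)
  case 0
  then show ?case by (intro exI[of _ a]) (simp add: desc_def)
next
  case (Suc k)
  have "0 < lev a" using Suc.hyps(2) by simp
  then obtain b where b: "adj C a b" "lev a = lev b + 1" using down_ex Suc.prems(1) by blast
  have "k = lev b - n" "n \<le> lev b" using Suc.hyps(2) b(2) by auto
  then obtain c where "desc b c" "lev c = n" using Suc.hyps(1) adj_verts(2)[OF b(1)] by blast
  then show ?case using desc_step' b by blast
qed

text \<open>A diamond through the first steps of the two descents must follow them as long as they
  stay apart, since twins have only one lower neighbour.\<close>

lemma fork_diamond:
  assumes P: "P 0 = z" "Q 0 = z" "1 \<le> K"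
    and step: "\<And>k. k < K \<Longrightarrow> adj C (P k) (P (Suc k)) \<and> lev (P k) = lev (P (Suc k)) + 1"
      "\<And>k. k < K \<Longrightarrow> adj C (Q k) (Q (Suc k)) \<and> lev (Q k) = lev (Q (Suc k)) + 1"
    and ne: "\<And>k. 0 < k \<Longrightarrow> k \<le> K \<Longrightarrow> P k \<noteq> Q k"
  shows "\<exists>K' p q. diamond z K' p q \<and> K < K' \<and> p K = P K \<and> q K = Q K"
proof -
  have K: "0 < K" using P by simp
  obtain K' p q where D: "diamond z K' p q" and 1: "p 1 = P 1" "q 1 = Q 1"
    using diamond_ex[of z "P 1" "Q 1"] step[OF K] P ne[of 1] by auto
  note D' = diamond_swap[OF D]
  have eq: "0 < k \<longrightarrow> k \<le> K \<longrightarrow> k \<le> K' \<longrightarrow> p k = P k \<and> q k = Q k" for k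
  proof (induction k)
    case (Suc k)
    show ?case
    proof (cases "k = 0")
      case True then show ?thesis using 1 by simp
    next
      case False
      show ?thesis
      proof (intro impI)
        assume k: "Suc k \<le> K" "Suc k \<le> K'"
        then have IH: "p k = P k" "q k = Q k" and lt: "k < K" "k < K'" "0 < k" using Suc.IH False by auto
        note t = diamond_twin[OF D lt(3,2)]
        show "p (Suc k) = P (Suc k) \<and> q (Suc k) = Q (Suc k)"
          using down_unique[OF t diamond_step(1)[OF D lt(2)] _ diamond_step(2)[OF D lt(2)]]
            down_unique[OF tw_sym[OF t] diamond_step(1)[OF D' lt(2)] _ diamond_step(2)[OF D' lt(2)]]
            step(1,2)[OF lt(1)] IH by metis
      qed
    qed
  qed simp
  have "K < K'"
  proof (rule ccontr)
    assume "\<not> K < K'"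
    then have "p K' = P K' \<and> q K' = Q K'" "0 < K'" "K' \<le> K" using eq[of K'] diamond_K[OF D] by auto
    moreover from this have "P K' = Q K'" using diamond_end[OF D] by metis
    ultimately show False using ne by blast
  qed
  then show ?thesis using D eq[of K] K by auto
qed

text \<open>The walk contains a last vertex above \<open>L\<close>. That vertex is also above \<open>R\<close>, and the two descending
  paths from it split at \<open>z\<close>.\<close>

lemma walk_fork:
  assumes f: "\<And>i. i < l \<Longrightarrow> adj C (f i) (f (Suc i))" and n: "\<And>i. i \<le> l \<Longrightarrow> n \<le> lev (f i)"
    and V: "f 0 \<in> verts C"
    and L: "desc (f 0) L" "lev L = n" and R: "desc (f l) R" "lev R = n" and LR: "L \<noteq> R"
  shows "\<exists>i\<le>l. \<exists>z K p q. diamond z K p q \<and> n < lev z \<and> lev z - n < K \<and>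
    p (lev z - n) = L \<and> q (lev z - n) = R \<and> linked C (up (lev z)) (f i) z"
proof -
  have fV: "i \<le> l \<Longrightarrow> f i \<in> verts C" for i using V f[of "i - 1"] adj_verts(2) by (cases i) auto
  have fl: "i \<le> l \<longrightarrow> linked C (up n) (f 0) (f i)" for i
  proof (induction i)
    case 0 then show ?case using V n[of 0] by (simp add: linked_refl upper_def)
  next
    case (Suc i)
    then show ?case using linked_step[OF _ f[of i]] fV[of "Suc i"] n[of "Suc i"] by (auto simp: upper_def)
  qed
  have dl: "linked C (up n) (f 0) w" if "i \<le> l" "desc (f i) w" "lev w = n" for i w
    using fl[of i] desc_linked[OF that(2) fV[OF that(1)]] that linked_trans by metis
  \<comment> \<open>All level-\<open>n\<close> nodes below the walk lie in one component, which
    contains the twins \<open>L\<close> and \<open>R\<close> and so no third node of that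
    level.\<close>
  have only: "w = L \<or> w = R" if "i \<le> l" "desc (f i) w" "lev w = n" for i w
  proof -
    have "linked C (up n) L w" "linked C (up n) L R"
      using dl[OF that] dl[OF _ L] dl[OF _ R] linked_sym linked_trans by (metis le0 le_refl)+
    then have "tw L R" "w \<noteq> L \<Longrightarrow> tw L w" using LR that L R unfolding twin_def by auto
    then show ?thesis using twin_unique by blast
  qed
  have "\<exists>i\<le>l. desc (f i) L \<and> desc (f i) R"
  proof -
    define i where "i = Max {i. i \<le> l \<and> desc (f i) L}"
    have fin: "finite {i. i \<le> l \<and> desc (f i) L}" "{i. i \<le> l \<and> desc (f i) L} \<noteq> {}"
      using L by auto
    have "i \<in> {i. i \<le> l \<and> desc (f i) L}" unfolding i_def by (rule Max_in[OF fin])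
    then have i: "i \<le> l" "desc (f i) L" by auto
    have last: "\<not> desc (f j) L" if "i < j" "j \<le> l" for j
      using Max_ge[OF fin(1), of j] that unfolding i_def by (metis (mono_tags, lifting) leD mem_Collect_eq)
    show ?thesis
    proof (cases "i = l")
      case True then show ?thesis using i R by blast
    next
      case False
      then have il: "i < l" using i by simp
      obtain w where w: "desc (f (Suc i)) w" "lev w = n" using desc_ex[OF fV n, of "Suc i"] il by auto
      have "w = R" using only[of "Suc i" w] w il last[of "Suc i"] by auto
      \<comment> \<open>An ascending step would place \<open>f (Suc i)\<close> above
        \<open>L\<close> as well, against the choice of \<open>i\<close>.\<close>
      moreover have "lev (f i) = lev (f (Suc i)) + 1"
      proof (rule ccontr)
        assume "\<not> lev (f i) = lev (f (Suc i)) + 1"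
        then have "lev (f (Suc i)) = lev (f i) + 1" using lev_adj[OF f[OF il]] by blast
        then have "desc (f (Suc i)) L" using desc_step' f[OF il] adj_sym[of C] i(2) by metis
        then show False using last[of "Suc i"] il by simp
      qed
      ultimately have "desc (f i) R" using desc_step' f[OF il] w by blast
      then show ?thesis using i by blast
    qed
  qed
  then obtain i where i: "i \<le> l" "desc (f i) L" "desc (f i) R" by blast
  define m where "m = lev (f i) - n"
  obtain P where P: "P 0 = f i" "P m = L" "\<forall>j<m. adj C (P j) (P (Suc j)) \<and> lev (P j) = lev (P (Suc j)) + 1"
    using desc_path[OF i(2)] L(2) unfolding m_def by auto
  obtain Q where Q: "Q 0 = f i" "Q m = R" "\<forall>j<m. adj C (Q j) (Q (Suc j)) \<and> lev (Q j) = lev (Q (Suc j)) + 1"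
    using desc_path[OF i(3)] R(2) unfolding m_def by auto
  define s where "s = Max {j. j \<le> m \<and> P j = Q j}"
  have fin: "finite {j. j \<le> m \<and> P j = Q j}" "{j. j \<le> m \<and> P j = Q j} \<noteq> {}" using P Q by auto
  have "s \<in> {j. j \<le> m \<and> P j = Q j}" unfolding s_def by (rule Max_in[OF fin])
  then have s: "s \<le> m" "P s = Q s" by auto
  have after: "P j \<noteq> Q j" if "s < j" "j \<le> m" for j
    using Max_ge[OF fin(1), of j] that unfolding s_def by (metis (mono_tags, lifting) leD mem_Collect_eq)
  define z where "z = P s"
  have "s \<noteq> m" using s P Q LR by auto
  then have sm: "s < m" using s by simp
  have levP: "j \<le> m \<longrightarrow> lev (P j) + j = lev (f i) \<and> desc (f i) (P j)" for j
  proof (induction j)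
    case 0 then show ?case using P by (simp add: desc_def)
  next
    case (Suc j)
    then show ?case using P(3) desc_step[of "f i" "P j" "P (Suc j)"] by auto
  qed
  have "lev z + s = lev (f i)" using levP[of s] s unfolding z_def by simp
  then have lz: "lev z = n + (m - s)" using s(1) n[OF i(1)] unfolding m_def by linarith
  have "\<exists>K' p q. diamond z K' p q \<and> m - s < K' \<and> p (m - s) = P (s + (m - s)) \<and> q (m - s) = Q (s + (m - s))"
    by (rule fork_diamond[where P = "\<lambda>k. P (s + k)" and Q = "\<lambda>k. Q (s + k)"])
      (use P Q s after sm in \<open>auto simp: z_def\<close>)
  then obtain K' p q where D: "diamond z K' p q" "m - s < K'" "p (m - s) = L" "q (m - s) = R"
    using s P Q by auto
  moreover have "lev z - n = m - s" "n < lev z" using lz sm by auto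
  moreover have "linked C (up (lev z)) (f i) z"
    using desc_linked[OF _ fV[OF i(1)]] levP[of s] s unfolding z_def by blast
  ultimately show ?thesis using i(1) by metis
qed

text \<open>An edge that leaves the component of \<open>z\<close> above its level starts at that
  level, and \<open>z\<close>, having no twin, is the only such node of the component.\<close>

lemma walk_through_top:
  assumes D: "diamond z K p q" and f: "\<And>i. i < l \<Longrightarrow> adj C (f i) (f (Suc i))"
    and i: "i \<le> l" "linked C (up (lev z)) (f i) z" and j: "j \<le> l" "\<not> linked C (up (lev z)) (f j) z"
  shows "\<exists>k\<le>l. f k = z"
proof -
  define S where "S = (\<lambda>k. linked C (up (lev z)) (f k) z)"
  have edge: "a = z" if "linked C (up (lev z)) a z" "adj C a b" "\<not> linked C (up (lev z)) b z" for a b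
  proof -
    have V: "a \<in> verts C" "b \<in> verts C" using adj_verts that(2) by auto
    have za: "linked C (up (lev z)) z a" using linked_sym that(1) by metis
    have "b \<notin> up (lev z)" using linked_step[OF za that(2)] that(3) linked_sym by metis
    then have "lev b < lev z" using V by (simp add: upper_def)
    moreover have "lev z \<le> lev a" using linked_in[OF that(1)] by (simp add: upper_def)
    ultimately have "lev a = lev z" using lev_adj[OF that(2)] by auto
    then show "a = z" using za diamond_top[OF D, of a] unfolding twin_def by auto
  qed
  have "\<exists>k<l. S k \<noteq> S (Suc k)"
  proof (rule ccontr)
    assume "\<not> ?thesis"
    then have "k \<le> l \<longrightarrow> S k = S 0" for k by (induction k) auto
    then show False using i j unfolding S_def by blast
  qed
  then obtain k where k: "k < l" "S k \<noteq> S (Suc k)" by blast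
  show ?thesis
  proof (cases "S k")
    case True
    then have "f k = z" using edge[of "f k" "f (Suc k)"] f k unfolding S_def by blast
    then show ?thesis using k by (intro exI[of _ k]) simp
  next
    case False
    then have "f (Suc k) = z" using edge[of "f (Suc k)" "f k"] f k adj_sym[of C] unfolding S_def by blast
    then show ?thesis using k by (intro exI[of _ "Suc k"]) simp
  qed
qed

text \<open>At each level the next node of the chain is \<open>p k\<close> or its twin
  \<open>q k\<close>, being in the component of \<open>z\<close>. It is not \<open>q k\<close>,
  whose unique lower neighbour lies on the other side.\<close>

lemma chain_left:
  assumes D: "diamond z K p q" and n: "n < lev z" "lev z - n < K"
    and c: "\<And>j. n \<le> j \<Longrightarrow> j < J \<Longrightarrow> adj C (c (Suc j)) (c j)" "\<And>j. n \<le> j \<Longrightarrow> j \<le> J \<Longrightarrow> lev (c j) = j"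
    and start: "c n = p (lev z - n)"
    and j: "n \<le> j" "j \<le> J" "j \<le> lev z" "linked C (up j) (c j) z"
  shows "c j = p (lev z - j)"
  using j
proof (induction j rule: dec_induct)
  case base then show ?case using start by simp
next
  case (step j)
  have adj: "adj C (c (Suc j)) (c j)" using c step by simp
  have lev: "lev (c j) = j" "lev (c (Suc j)) = Suc j" using c step by auto
  have "linked C (up j) (c (Suc j)) z" using up_mono[OF step.prems(3)] by simp
  moreover have "linked C (up j) (c j) (c (Suc j))"
    using linked_step[OF linked_refl, of "c j" "up j" C "c (Suc j)"] adj adj_sym[of C] adj_verts[OF adj] lev
    by (simp add: upper_def)
  ultimately have "linked C (up j) (c j) z" by (metis linked_trans)
  then have IH: "c j = p (lev z - j)" using step by simp
  show ?case
  proof (cases "Suc j = lev z")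
    case True
    then have "c (Suc j) = z" using diamond_top[OF D, of "c (Suc j)"] step.prems(3) lev linked_sym
      unfolding twin_def by metis
    then show ?thesis using True diamond_start[OF D] by simp
  next
    case False
    define k where "k = lev z - Suc j"
    have k: "0 < k" "Suc k < K" "Suc k = lev z - j" using False step n unfolding k_def by auto
    note t = diamond_twin[OF D k(1) Suc_lessD[OF k(2)]]
    have lk: "lev (p k) = Suc j" using diamond_lev[OF D, of k] k step.prems unfolding k_def by simp
    have "linked C (up (Suc j)) (p k) (c (Suc j))"
      using diamond_linked[OF D, of k] lk k step.prems(3) linked_sym linked_trans by (metis Suc_lessD less_imp_le)
    then have "c (Suc j) = p k \<or> tw (p k) (c (Suc j))" using lk lev unfolding twin_def by auto
    moreover have "c (Suc j) \<noteq> q k"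
    proof
      assume eq: "c (Suc j) = q k"
      have kK: "k < K" using k by simp
      have "p (Suc k) = q (Suc k)"
        using down_unique[OF tw_sym[OF t] _ diamond_step(1)[OF diamond_swap[OF D] kK] _
            diamond_step(2)[OF diamond_swap[OF D] kK], of "p (Suc k)"] adj IH eq k lev by simp
      then show False using diamond_neq[OF D _ k(2)] by blast
    qed
    ultimately have "c (Suc j) = p k" using twin_unique t by metis
    then show ?thesis unfolding k_def .
  qed
qed

text \<open>The descent begins at \<open>p 1\<close>, because the top itself has at least two lower
  neighbours; from there on \<open>down_unique\<close> decides each step.\<close>

lemma chain_down:
  assumes D: "diamond z K p q"
    and c: "\<And>j. j < J \<Longrightarrow> adj C (c (Suc j)) (c j)" "\<And>j. j \<le> J \<Longrightarrow> lev (c j) = j"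
    and J: "lev z = Suc J" "c J = p 1"
  shows "1 \<le> k \<Longrightarrow> k \<le> K \<Longrightarrow> c (lev z - k) = p k"
proof (induction k rule: dec_induct)
  case base then show ?case using J by simp
next
  case (step k)
  have IH: "c (lev z - k) = p k" and k: "k < K" "0 < k" using step by auto
  have "Suc k \<le> lev z" using diamond_lev[OF D step.prems] by simp
  then have s: "lev z - k = Suc (lev z - Suc k)" "lev z - Suc k < J" using J step.hyps by auto
  then have "adj C (p k) (c (lev z - Suc k))" "lev (p k) = lev (c (lev z - Suc k)) + 1"
    using c(1)[of "lev z - Suc k"] c(2)[of "lev z - Suc k"] c(2)[of "lev z - k"] IH by auto
  then show ?case
    using down_unique[OF diamond_twin[OF D k(2,1)] _ diamond_step(1)[OF D k(1)] _ diamond_step(2)[OF D k(1)]]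
    by blast
qed

text \<open>Reaching a lowest vertex \<open>f m\<close> and coming back up takes at least the sum of
  the two level differences; the additive form avoids truncated subtraction.\<close>

lemma walk_lev:
  assumes f: "\<And>i. i < l \<Longrightarrow> adj C (f i) (f (Suc i))"
  shows "\<exists>m\<le>l. (\<forall>i\<le>l. lev (f m) \<le> lev (f i)) \<and> lev (f 0) + lev (f l) \<le> l + 2 * lev (f m) \<and>
    (f 0 \<in> verts C \<longrightarrow> linked C (up (lev (f m))) (f 0) (f l))"
proof -
  have "Min ((lev \<circ> f) ` {..l}) \<in> (lev \<circ> f) ` {..l}" by (intro Min_in) auto
  then obtain m where "m \<in> {..l}" "Min ((lev \<circ> f) ` {..l}) = (lev \<circ> f) m" by (rule imageE) simp
  then have m: "m \<le> l" "lev (f m) = Min ((lev \<circ> f) ` {..l})" by auto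
  have min: "lev (f m) \<le> lev (f i)" if "i \<le> l" for i unfolding m(2) using that by (intro Min_le) auto
  have "i + k \<le> l \<longrightarrow> lev (f i) \<le> lev (f (i + k)) + k \<and> lev (f (i + k)) \<le> lev (f i) + k" for i k
  proof (induction k)
    case (Suc k) then show ?case using lev_adj[OF f[of "i + k"]] by auto
  qed simp
  from this[of 0 m] this[of m "l - m"] have "lev (f 0) + lev (f l) \<le> l + 2 * lev (f m)" using m by auto
  moreover have "i \<le> l \<longrightarrow> linked C (up (lev (f m))) (f 0) (f i)" if "f 0 \<in> verts C" for i
  proof (induction i)
    case 0 then show ?case using that min by (simp add: linked_refl upper_def)
  next
    case (Suc i)
    then show ?case using linked_step[OF _ f[of i]] adj_verts(2)[OF f[of i]] min[of "Suc i"]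
      by (auto simp: upper_def)
  qed
  ultimately show ?thesis using m(1) min by blast
qed

end

section \<open>The cactus of pieces\<close>

context theta_free_ugraph
begin

text \<open>A chosen representative of the piece; the component 0 places it in the vertex type
  \<open>'a \<times> nat\<close> of the cactus.\<close>

definition node :: "'a \<Rightarrow> 'a \<times> nat" where
  "node x = (SOME y. piece_rel x y, 0)"

definition pieces :: "('a \<times> nat) ugraph" where
  "pieces = \<lparr>verts = node ` verts G, edges = {{node x, node y} | x y. adj G x y \<and> node x \<noteq> node y}\<rparr>"

definition level :: "'a \<times> nat \<Rightarrow> nat" where
  "level a = height (fst a)"

lemma node_rel: "x \<in> verts G \<Longrightarrow> piece_rel x (fst (node x))"
  unfolding node_def using someI[of "piece_rel x", OF piece_rel_refl] by simp

lemma node_eq_iff: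
  assumes "x \<in> verts G" "y \<in> verts G"
  shows "node x = node y \<longleftrightarrow> piece_rel x y"
proof
  assume "node x = node y"
  then show "piece_rel x y"
    using node_rel[OF assms(1)] node_rel[OF assms(2)] piece_rel_sym piece_rel_trans by metis
next
  assume xy: "piece_rel x y"
  then have "piece_rel x = piece_rel y"
    by (intro ext iffI) (metis piece_rel_sym piece_rel_trans)+
  then show "node x = node y" unfolding node_def by simp
qed

lemma level_node: "x \<in> verts G \<Longrightarrow> level (node x) = height x"
  unfolding level_def using node_rel piece_rel_height by metis

lemma verts_pieces: "verts pieces = node ` verts G"
  by (simp add: pieces_def)

lemma node_verts: "x \<in> verts G \<Longrightarrow> node x \<in> verts pieces"
  by (simp add: verts_pieces)

lemma adj_piecesD:
  assumes "adj pieces a b"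
  obtains x y where "adj G x y" "a = node x" "b = node y" "a \<noteq> b"
proof -
  obtain x y where "adj G x y" "{a, b} = {node x, node y}" "node x \<noteq> node y"
    using assms unfolding adj_def pieces_def by auto
  then show ?thesis using that[of x y] that[of y x] adj_sym[of G x y] by (auto simp: doubleton_eq_iff)
qed

lemma adj_pieces: "adj G x y \<Longrightarrow> node x \<noteq> node y \<Longrightarrow> adj pieces (node x) (node y)"
  by (auto simp: adj_def pieces_def)

lemma adj_pieces_height: "adj G x y \<Longrightarrow> height x = height y + 1 \<Longrightarrow> adj pieces (node x) (node y)"
proof (rule adj_pieces)
  assume "adj G x y" "height x = height y + 1"
  then have "level (node x) \<noteq> level (node y)" using level_node adj_verts by simp
  then show "node x \<noteq> node y" by auto
qed

lemma walk_pieces: "(adj G ^^ n) x y \<Longrightarrow> \<exists>m\<le>n. (adj pieces ^^ m) (node x) (node y)"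
proof (induction n arbitrary: y)
  case (Suc n)
  then obtain w where w: "(adj G ^^ n) x w" "adj G w y" by auto
  then obtain m where m: "m \<le> n" "(adj pieces ^^ m) (node x) (node w)" using Suc by blast
  show ?case
  proof (cases "node w = node y")
    case True then show ?thesis using m by (intro exI[of _ m]) simp
  next
    case False
    then have "(adj pieces ^^ Suc m) (node x) (node y)" using m(2) adj_pieces[OF w(2)] by auto
    then show ?thesis using m by (intro exI[of _ "Suc m"]) simp
  qed
qed auto

lemma connected_pieces: "connected_graph pieces"
  unfolding connected_graph_def
proof (intro conjI ballI)
  show "simple_graph pieces"
    unfolding simple_graph_def pieces_def using adj_verts by auto
  show "verts pieces \<noteq> {}" using node_verts[OF r] by blast
  fix a b assume "a \<in> verts pieces" "b \<in> verts pieces"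
  then obtain x y where xy: "x \<in> verts G" "y \<in> verts G" "a = node x" "b = node y"
    unfolding verts_pieces by blast
  then obtain m where "(adj pieces ^^ m) a b" using walk_pieces gdist_walk by metis
  then show "(\<lambda>a b. {a, b} \<in> edges pieces)\<^sup>*\<^sup>* a b"
    unfolding adj_def[abs_def] by (rule relpowp_imp_rtranclp)
qed

lemma linked_pieces:
  assumes "linked G (above n) x y"
  shows "linked pieces (upper pieces level n) (node x) (node y)"
  using assms
proof (induction rule: linked_induct)
  case refl
  then show ?case using node_verts level_node by (auto intro!: linked_refl simp: upper_def above_def)
next
  case (step y z)
  have "node z \<in> upper pieces level n"
    using step.hyps node_verts level_node by (auto simp: upper_def above_def)
  then show ?case using step.IH linked_step[OF step.IH adj_pieces[OF step.hyps(2)]] by (cases "node y = node z") auto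
qed

text \<open>A walk of the quotient lifts although consecutive edges need not share an end in
  \<open>G\<close>: the gap lies inside a piece, whose vertices are linked at or above their own
  height.\<close>

lemma linked_of_pieces:
  assumes x: "x \<in> verts G" and "linked pieces (upper pieces level n) (node x) b"
  shows "\<forall>y\<in>verts G. node y = b \<longrightarrow> linked G (above n) x y"
  using assms(2)
proof (induction rule: linked_induct)
  case refl
  have n: "n \<le> height x" using refl level_node[OF x] by (simp add: upper_def)
  show ?case
  proof (intro ballI impI)
    fix y assume "y \<in> verts G" "node y = node x"
    then have "same_cluster x y" using node_eq_iff x piece_rel_cluster by metis
    then show "linked G (above n) x y" using linked_above_mono n unfolding same_cluster_def by metis
  qed
next
  case (step b c)
  obtain u v where uv: "adj G u v" "b = node u" "c = node v" "b \<noteq> c" by (rule adj_piecesD[OF step.hyps(2)])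
  have V: "u \<in> verts G" "v \<in> verts G" using adj_verts uv by auto
  have hv: "n \<le> height v" using step.hyps(3) uv(3) level_node[OF V(2)] by (simp add: upper_def)
  have xv: "linked G (above n) x v"
    using linked_step[OF _ uv(1)] step.IH uv V hv by (simp add: above_def)
  show ?case
  proof (intro ballI impI)
    fix y assume "y \<in> verts G" "node y = c"
    then have "same_cluster v y" using node_eq_iff V uv(3) piece_rel_cluster by metis
    then have "linked G (above n) v y" using linked_above_mono hv unfolding same_cluster_def by metis
    then show "linked G (above n) x y" using xv linked_trans by metis
  qed
qed

lemma linked_pieces_iff:
  "x \<in> verts G \<Longrightarrow> y \<in> verts G \<Longrightarrow>
    linked pieces (upper pieces level n) (node x) (node y) \<longleftrightarrow> linked G (above n) x y"
  using linked_pieces linked_of_pieces by blast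

lemma twin_iff:
  assumes "x \<in> verts G" "y \<in> verts G"
  shows "twin pieces level (node x) (node y) \<longleftrightarrow> same_cluster x y \<and> \<not> piece_rel x y"
  unfolding twin_def same_cluster_def
  using assms node_eq_iff linked_pieces_iff level_node by auto

lemma twinD:
  assumes "twin pieces level (node x) b" "x \<in> verts G"
  obtains y where "y \<in> verts G" "b = node y" "same_cluster x y" "\<not> piece_rel x y"
proof -
  have "b \<in> verts pieces" using assms linked_in[of pieces _ "node x" b] unfolding twin_def upper_def by auto
  then obtain y where "y \<in> verts G" "b = node y" unfolding verts_pieces by blast
  then show ?thesis using that assms twin_iff by blast
qed

text \<open>An edge between vertices of equal height stays within a piece and collapses.\<close>

lemma adj_pieces_level:
  assumes "adj pieces a b"
  shows "level a = level b + 1 \<or> level b = level a + 1"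
proof -
  obtain x y where xy: "adj G x y" "a = node x" "b = node y" "a \<noteq> b" by (rule adj_piecesD[OF assms])
  have V: "x \<in> verts G" "y \<in> verts G" using adj_verts xy by auto
  have "height x \<noteq> height y"
  proof
    assume h: "height x = height y"
    have "linked G (above (height x)) x y"
      using linked_step[OF linked_refl xy(1)] V h by (simp add: above_def)
    then have "same_cluster x y" unfolding same_cluster_def using h by simp
    moreover have "d x y \<le> 9 * M" using gdist_adj[OF xy(1)] M by linarith
    ultimately show False using piece_relI node_eq_iff V xy by blast
  qed
  then show ?thesis
    using height_adj[OF xy(1)] height_adj[of y x] xy adj_sym[of G x y] level_node V by auto
qed

end

text \<open>\<open>down_unique\<close> comes from \<open>parent_piece\<close>,
  \<open>twin_unique\<close> from \<open>two_pieces\<close>, \<open>twin_parents\<close> from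
  \<open>parents_apart\<close> and \<open>bridge_unique\<close> from \<open>crossing_unique\<close>.
  Each adjacency of nodes brings its own representatives, which is why these facts allow varying
  members of a piece.\<close>

sublocale theta_free_ugraph \<subseteq> Q: cactus_layering pieces level
proof (unfold_locales)
  show "connected_graph pieces" by (rule connected_pieces)
next
  fix a b assume "adj pieces a b"
  then show "level a = level b + 1 \<or> level b = level a + 1" by (rule adj_pieces_level)
next
  fix a assume a: "a \<in> verts pieces" "0 < level a"
  then obtain x where x: "x \<in> verts G" "a = node x" unfolding verts_pieces by blast
  have "0 < height x" using a x level_node by simp
  then have "r \<noteq> x" unfolding height_def by auto
  then obtain w where w: "w \<in> verts G" "adj G w x" "d r x = Suc (d r w)" using gdist_prev[OF r x(1)] by blast
  then have "height x = height w + 1" unfolding height_def by simp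
  then have "adj pieces a (node w)" "level a = level (node w) + 1"
    using adj_pieces_height w adj_sym[of G w x] x level_node by auto
  then show "\<exists>b. adj pieces a b \<and> level a = level b + 1" by blast
next
  fix a b assume "a \<in> verts pieces" "b \<in> verts pieces" "level a = 0" "level b = 0"
  then obtain x y where "x \<in> verts G" "y \<in> verts G" "a = node x" "b = node y" "height x = 0" "height y = 0"
    unfolding verts_pieces using level_node by auto
  then show "a = b" using gdist_eq_0[OF r] unfolding height_def by metis
next
  fix a b u v
  assume ab: "twin pieces level a b" and adj: "adj pieces a u" "adj pieces a v"
    and lev: "level a = level u + 1" "level a = level v + 1"
  obtain x u0 where u: "adj G x u0" "a = node x" "u = node u0" by (rule adj_piecesD[OF adj(1)])
  obtain x' v0 where v: "adj G x' v0" "a = node x'" "v = node v0" by (rule adj_piecesD[OF adj(2)])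
  have V: "x \<in> verts G" "u0 \<in> verts G" "x' \<in> verts G" "v0 \<in> verts G" using u v adj_verts by auto
  obtain y where y: "same_cluster x y" "\<not> piece_rel x y" using twinD ab u V by metis
  have "piece_rel x x'" using node_eq_iff V u v by metis
  then have "piece_rel u0 v0"
    by (rule parent_piece[OF y _ u(1) v(1)]) (use lev u v V level_node piece_rel_height[OF \<open>piece_rel x x'\<close>] in auto)
  then show "u = v" using node_eq_iff V u v by simp
next
  fix a b c assume ab: "twin pieces level a b" and ac: "twin pieces level a c"
  have "a \<in> verts pieces" using ab linked_in[of pieces _ a b] unfolding twin_def upper_def by auto
  then obtain x where x: "x \<in> verts G" "a = node x" unfolding verts_pieces by blast
  obtain y where y: "y \<in> verts G" "b = node y" "same_cluster x y" "\<not> piece_rel x y" using twinD ab x by metis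
  obtain z where z: "z \<in> verts G" "c = node z" "same_cluster x z" "\<not> piece_rel x z" using twinD ac x by metis
  have "piece_rel z y" using two_pieces[OF y(3,4) z(3)] z(4) piece_rel_sym by blast
  then show "b = c" using node_eq_iff y z by metis
next
  fix a b u w
  assume ab: "twin pieces level a b" and adj: "adj pieces a u" "adj pieces b u"
    and lev: "level a = level u + 1"
  obtain x u0 where u: "adj G x u0" "a = node x" "u = node u0" by (rule adj_piecesD[OF adj(1)])
  obtain y v0 where v: "adj G y v0" "b = node y" "u = node v0" by (rule adj_piecesD[OF adj(2)])
  have V: "x \<in> verts G" "u0 \<in> verts G" "y \<in> verts G" "v0 \<in> verts G" using u v adj_verts by auto
  have xy: "same_cluster x y" "\<not> piece_rel x y" using twin_iff ab u v V by auto
  show "\<not> twin pieces level u w"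
  proof
    assume "twin pieces level u w"
    then obtain w0 where "same_cluster u0 w0" "\<not> piece_rel u0 w0" using twinD u V by metis
    then have "\<not> piece_rel u0 v0" using parents_apart xy u v by blast
    then show False using node_eq_iff V u v by metis
  qed
next
  fix u v x y x' y'
  assume uv: "twin pieces level u v"
    and x: "adj pieces x u" "level x = level u + 1" and y: "adj pieces y v" "level y = level u + 1"
    and xy: "linked pieces (upper pieces level (level u + 1)) x y"
    and x': "adj pieces x' u" "level x' = level u + 1" and y': "adj pieces y' v" "level y' = level u + 1"
    and xy': "linked pieces (upper pieces level (level u + 1)) x' y'"
  obtain x1 u1 where 1: "adj G x1 u1" "x = node x1" "u = node u1" by (rule adj_piecesD[OF x(1)])
  obtain y1 v1 where 2: "adj G y1 v1" "y = node y1" "v = node v1" by (rule adj_piecesD[OF y(1)])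
  obtain x2 u2 where 3: "adj G x2 u2" "x' = node x2" "u = node u2" by (rule adj_piecesD[OF x'(1)])
  obtain y2 v2 where 4: "adj G y2 v2" "y' = node y2" "v = node v2" by (rule adj_piecesD[OF y'(1)])
  have V: "x1 \<in> verts G" "u1 \<in> verts G" "y1 \<in> verts G" "v1 \<in> verts G"
    "x2 \<in> verts G" "u2 \<in> verts G" "y2 \<in> verts G" "v2 \<in> verts G"
    using adj_verts[OF 1(1)] adj_verts[OF 2(1)] adj_verts[OF 3(1)] adj_verts[OF 4(1)] by auto
  have L: "level u = height u1" using level_node V 1 by simp
  have h: "height x1 = Suc (height u1)" "height y1 = Suc (height u1)"
    "height x2 = Suc (height u1)" "height y2 = Suc (height u1)"
    using x(2) y(2) x'(2) y'(2) L level_node V 1 2 3 4 by auto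
  have p: "piece_rel u1 u1" "piece_rel v1 v1" "piece_rel u2 u1" "piece_rel v2 v1"
    using node_eq_iff V 1(3) 2(3) 3(3) 4(3) by metis+
  have c: "same_cluster u1 v1" "\<not> piece_rel u1 v1" using twin_iff[OF V(2,4)] uv 1 2 by auto
  have l: "linked G (above (Suc (height u1))) x1 y1" "linked G (above (Suc (height u1))) x2 y2"
    using xy xy' L linked_pieces_iff V 1 2 3 4 by auto
  have "linked G (above (Suc (height u1))) x1 x2"
    by (rule crossing_unique[OF c refl 1(1) p(1) h(1) 2(1) p(2) h(2) l(1) 3(1) p(3) h(3) 4(1) p(4) h(4) l(2)])
  then show "linked pieces (upper pieces level (level u + 1)) x x'"
    using linked_pieces L 1 3 by simp
qed

section \<open>Lifting geodesics from the cactus to \<open>G\<close>\<close>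

context theta_free_ugraph
begin

lemma gdist_pieces_le: "x \<in> verts G \<Longrightarrow> y \<in> verts G \<Longrightarrow> gdist pieces (node x) (node y) \<le> d x y"
  using walk_pieces[OF gdist_walk, of x y] Q.gdist_le by (meson le_trans)

lemma root_chain:
  "x \<in> verts G \<Longrightarrow> \<exists>c. c (height x) = x \<and>
    (\<forall>j\<le>height x. c j \<in> verts G \<and> height (c j) = j \<and> d x (c j) \<le> height x - j) \<and>
    (\<forall>j<height x. adj G (c (Suc j)) (c j))"
proof (induction "height x" arbitrary: x)
  case 0
  then show ?case by (intro exI[of _ "\<lambda>_. x"]) simp
next
  case (Suc n)
  then have "r \<noteq> x" unfolding height_def by auto
  then obtain w where w: "w \<in> verts G" "adj G w x" "d r x = Suc (d r w)" using gdist_prev[OF r Suc.prems] by blast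
  then have hw: "height w = n" using Suc.hyps(2) unfolding height_def by simp
  obtain c where c: "c n = w" "\<forall>j\<le>n. c j \<in> verts G \<and> height (c j) = j \<and> d w (c j) \<le> n - j"
    "\<forall>j<n. adj G (c (Suc j)) (c j)" using Suc.hyps(1)[of w] w(1) hw by auto
  have xw: "adj G x w" using w(2) adj_sym by metis
  define c' where "c' = c(Suc n := x)"
  have "c' j \<in> verts G \<and> height (c' j) = j \<and> d x (c' j) \<le> Suc n - j" if j: "j \<le> Suc n" for j
  proof (cases "j = Suc n")
    case True then show ?thesis using Suc unfolding c'_def by simp
  next
    case False
    then have "j \<le> n" using j by simp
    moreover have "d x (c j) \<le> d x w + d w (c j)" using gdist_triangle Suc.prems w(1) c(2) calculation by blast
    ultimately show ?thesis using c(2) False gdist_adj[OF xw] unfolding c'_def by fastforce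
  qed
  moreover have "adj G (c' (Suc j)) (c' j)" if "j < Suc n" for j
    using that c(1,3) xw unfolding c'_def by (cases "j = n") auto
  moreover have "c' (Suc n) = x" unfolding c'_def by simp
  ultimately show ?case using Suc.hyps(2) by metis
qed

lemma chain_linked:
  assumes "\<forall>j\<le>J. c j \<in> verts G \<and> height (c j) = j" "\<forall>j<J. adj G (c (Suc j)) (c j)"
  shows "j + k \<le> J \<longrightarrow> linked G (above j) (c j) (c (j + k))"
proof (induction k)
  case 0 then show ?case using assms by (auto intro!: linked_refl simp: above_def)
next
  case (Suc k)
  show ?case
  proof
    assume le: "j + Suc k \<le> J"
    then have "adj G (c (j + k)) (c (j + Suc k))" using assms(2) adj_sym[of G] by simp
    moreover have "c (j + Suc k) \<in> above j" using le assms(1) by (simp add: above_def)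
    ultimately show "linked G (above j) (c j) (c (j + Suc k))" using linked_step Suc.IH le by simp
  qed
qed

lemma chain_desc:
  assumes "\<forall>j\<le>J. c j \<in> verts G \<and> height (c j) = j" "\<forall>j<J. adj G (c (Suc j)) (c j)"
  shows "j + k \<le> J \<longrightarrow> Q.desc (node (c (j + k))) (node (c j))"
proof (induction k)
  case 0 then show ?case by (simp add: Q.desc_def)
next
  case (Suc k)
  show ?case
  proof
    assume le: "j + Suc k \<le> J"
    then have V: "c (j + Suc k) \<in> verts G" "c (j + k) \<in> verts G"
      "height (c (j + Suc k)) = height (c (j + k)) + 1" using assms(1) by auto
    have "adj pieces (node (c (j + Suc k))) (node (c (j + k)))"
      by (rule adj_pieces_height) (use assms(2) le V in auto)
    then show "Q.desc (node (c (j + Suc k))) (node (c j))"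
      using Q.desc_step' Suc.IH le V level_node by simp
  qed
qed

text \<open>Descend from \<open>x\<close> to height \<open>t\<close> towards the root, and likewise
  from a vertex of the piece \<open>z\<close>. Both descents arrive in the same node of side
  \<open>p\<close>, by \<open>chain_left\<close> and \<open>chain_down\<close>, so one sideways move
  of at most \<open>15 * M\<close> joins them.\<close>

lemma top_gdist:
  assumes D: "Q.diamond z K p q" and n: "n < level z" "level z - n < K"
    and x: "x \<in> verts G" and c: "c (height x) = x"
      "\<forall>j\<le>height x. c j \<in> verts G \<and> height (c j) = j \<and> d x (c j) \<le> height x - j"
      "\<forall>j<height x. adj G (c (Suc j)) (c j)"
    and nx: "n \<le> height x" "node (c n) = p (level z - n)"
    and t: "n \<le> t" "t \<le> height x" "t \<le> level z" "linked pieces (upper pieces level t) (node x) z"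
  shows "\<exists>u\<in>verts G. node u = z \<and> d x u + 2 * t \<le> height x + level z + 15 * M"
proof -
  have cV: "c j \<in> verts G" "height (c j) = j" "d x (c j) \<le> height x - j" if "j \<le> height x" for j
    using c(2) that by auto
  have "linked G (above t) (c t) x" using chain_linked[of "height x" c t "height x - t"] c t by simp
  then have ctz: "linked pieces (upper pieces level t) (node (c t)) z"
    using linked_pieces t(4) linked_trans by metis
  have ct: "node (c t) = p (level z - t)"
  proof (rule Q.chain_left[OF D n _ _ _ t(1,2,3), where c = "\<lambda>j. node (c j)"])
    fix j assume j: "j < height x"
    show "adj pieces (node (c (Suc j))) (node (c j))"
      by (rule adj_pieces_height) (use c(3) cV[of j] cV[of "Suc j"] j in auto)
  next
    fix j assume "j \<le> height x"
    then show "level (node (c j)) = j" using level_node cV by simp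
  qed (rule nx(2), rule ctz)
  have lz: "Suc 0 \<le> level z" "0 < K" using n by auto
  have "adj pieces (p 0) (p 1)" "level (p 0) = level (p 1) + 1"
    using Q.diamond_step[OF D lz(2)] by auto
  then have zp: "adj pieces z (p 1)" "level z = level (p 1) + 1" using Q.diamond_start[OF D] by auto
  \<comment> \<open>The vertex \<open>u\<close> is chosen in the piece \<open>z\<close> with a
    neighbour in \<open>p 1\<close>, so that its descent starts along side \<open>p\<close>.\<close>
  obtain u w where uw: "adj G u w" "z = node u" "p 1 = node w" by (rule adj_piecesD[OF zp(1)])
  have V: "u \<in> verts G" "w \<in> verts G" using adj_verts uw by auto
  have hu: "height u = level z" "height w + 1 = level z" using level_node V uw zp by auto
  obtain e where e: "e (height w) = w"
    "\<forall>j\<le>height w. e j \<in> verts G \<and> height (e j) = j \<and> d w (e j) \<le> height w - j"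
    "\<forall>j<height w. adj G (e (Suc j)) (e j)" using root_chain[OF V(2)] by blast
  have eV: "e j \<in> verts G" "height (e j) = j" "d w (e j) \<le> height w - j" if "j \<le> height w" for j
    using e(2) that by auto
  define k where "k = level z - t"
  obtain v where v: "v \<in> verts G" "node v = p k" "d u v \<le> k"
  proof (cases "k = 0")
    case True
    then show ?thesis using that[of u] V uw Q.diamond_start[OF D] by simp
  next
    case False
    have "node (e (level z - k)) = p k"
    proof (rule Q.chain_down[OF D, where c = "\<lambda>j. node (e j)" and J = "height w"])
      fix j assume j: "j < height w"
      show "adj pieces (node (e (Suc j))) (node (e j))"
        by (rule adj_pieces_height) (use e(3) eV[of j] eV[of "Suc j"] j in auto)
    next
      fix j assume "j \<le> height w"
      then show "level (node (e j)) = j" using level_node eV by simp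
    qed (use hu e(1) uw False t n k_def in auto)
    moreover have tw: "t \<le> height w" "level z - k = t" using False hu t unfolding k_def by auto
    moreover have "d u (e t) \<le> d u w + d w (e t)" using gdist_triangle V eV(1)[OF tw(1)] by blast
    ultimately show ?thesis
      using that[of "e t"] eV[OF tw(1)] gdist_adj[OF uw(1)] hu t False unfolding k_def by auto
  qed
  have ctV: "c t \<in> verts G" "d x (c t) \<le> height x - t" using cV[OF t(2)] by auto
  have "piece_rel (c t) v" using node_eq_iff[OF ctV(1) v(1)] v(2) ct unfolding k_def by metis
  then have "d (c t) v \<le> 15 * M" by (rule piece_diam)
  moreover have "d x u \<le> d x (c t) + d (c t) u" "d (c t) u \<le> d (c t) v + d v u"
    using gdist_triangle x ctV v V by blast+
  moreover have "d v u \<le> k" using v gdist_sym[OF v(1) V(1)] by simp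
  ultimately have "d x u + 2 * t \<le> height x + level z + 15 * M"
    using ctV t unfolding k_def by linarith
  then show ?thesis using V uw by blast
qed

text \<open>If the descents from \<open>x\<close> and \<open>y\<close> share a piece not below the
  lowest level \<open>n\<close> of the geodesic, one sideways move suffices. Otherwise they lie on
  the two sides of a diamond with top \<open>z\<close>, and each half, from an end to
  \<open>z\<close>, is lifted by \<open>top_gdist\<close>.\<close>

lemma gdist_le_pieces:
  assumes x: "x \<in> verts G" and y: "y \<in> verts G"
  shows "d x y \<le> gdist pieces (node x) (node y) + 45 * M"
proof -
  define l where "l = gdist pieces (node x) (node y)"
  obtain f where f0: "f 0 = node x" "f l = node y" and f: "\<And>i. i < l \<Longrightarrow> adj pieces (f i) (f (Suc i))"
    using Q.gdist_walk[OF node_verts[OF x] node_verts[OF y]] unfolding l_def relpowp_fun_conv by blast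
  have fV: "f 0 \<in> verts pieces" using node_verts x f0 by simp
  obtain m where m: "m \<le> l" "\<And>i. i \<le> l \<Longrightarrow> level (f m) \<le> level (f i)"
    "level (f 0) + level (f l) \<le> l + 2 * level (f m)"
    "linked pieces (upper pieces level (level (f m))) (f 0) (f l)"
    using Q.walk_lev[of l f] f fV by blast
  define n where "n = level (f m)"
  have n: "n \<le> height x" "n \<le> height y" "height x + height y \<le> l + 2 * n"
    using m(2)[of 0] m(2)[of l] m(3) f0 level_node x y unfolding n_def by auto
  obtain c where c: "c (height x) = x"
    "\<forall>j\<le>height x. c j \<in> verts G \<and> height (c j) = j \<and> d x (c j) \<le> height x - j"
    "\<forall>j<height x. adj G (c (Suc j)) (c j)" using root_chain[OF x] by blast
  obtain e where e: "e (height y) = y"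
    "\<forall>j\<le>height y. e j \<in> verts G \<and> height (e j) = j \<and> d y (e j) \<le> height y - j"
    "\<forall>j<height y. adj G (e (Suc j)) (e j)" using root_chain[OF y] by blast
  show ?thesis
  proof (cases "\<exists>j. n \<le> j \<and> j \<le> height x \<and> j \<le> height y \<and> node (c j) = node (e j)")
    case True
    then obtain j where j: "n \<le> j" "j \<le> height x" "j \<le> height y" "node (c j) = node (e j)" by blast
    have V: "c j \<in> verts G" "e j \<in> verts G" "d x (c j) \<le> height x - j" "d y (e j) \<le> height y - j"
      using c(2) e(2) j by auto
    have "d (c j) (e j) \<le> 15 * M" using piece_diam node_eq_iff V j by blast
    moreover have "d x y \<le> d x (c j) + d (c j) y" "d (c j) y \<le> d (c j) (e j) + d (e j) y"
      using gdist_triangle x y V by blast+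
    moreover have "d (e j) y = d y (e j)" using gdist_sym V y by blast
    ultimately show ?thesis using V n j unfolding l_def[symmetric] by linarith
  next
    case False
    have levn: "level (node (c n)) = n" "level (node (e n)) = n" using c(2) e(2) n level_node by auto
    have desc: "Q.desc (f 0) (node (c n))" "Q.desc (f l) (node (e n))"
      using chain_desc[of "height x" c n "height x - n"] chain_desc[of "height y" e n "height y - n"] c e n f0
      by auto
    have "\<exists>i\<le>l. \<exists>z K p q. Q.diamond z K p q \<and> n < level z \<and> level z - n < K \<and>
      p (level z - n) = node (c n) \<and> q (level z - n) = node (e n) \<and>
      linked pieces (upper pieces level (level z)) (f i) z"
      by (rule Q.walk_fork[OF f _ fV desc(1) levn(1) desc(2) levn(2)]) (use m(2) False n n_def in auto)
    then obtain i z K p q where i: "i \<le> l" and D: "Q.diamond z K p q"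
      and nz: "n < level z" "level z - n < K" and p: "node (c n) = p (level z - n)"
      and q: "node (e n) = q (level z - n)"
      and iz: "linked pieces (upper pieces level (level z)) (f i) z" by metis
    note D' = Q.diamond_swap[OF D]
    \<comment> \<open>Were both ends in the component of \<open>z\<close>, both descents would pass
      through the node \<open>z\<close> itself, a common piece.\<close>
    have "\<not> (linked pieces (upper pieces level (level z)) (f 0) z \<and>
      linked pieces (upper pieces level (level z)) (f l) z)"
    proof
      assume a: "linked pieces (upper pieces level (level z)) (f 0) z \<and>
        linked pieces (upper pieces level (level z)) (f l) z"
      then have "f 0 \<in> upper pieces level (level z)" "f l \<in> upper pieces level (level z)"
        using linked_in by metis+
      then have le: "level z \<le> height x" "level z \<le> height y"
        by (simp_all add: f0 upper_def level_node x y)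
      have "node (c' (level z)) = p' (level z - level z)"
        if "Q.diamond z K p' q'" "v \<in> verts G" "c' (height v) = v"
          "\<forall>j\<le>height v. c' j \<in> verts G \<and> height (c' j) = j" "\<forall>j<height v. adj G (c' (Suc j)) (c' j)"
          "node (c' n) = p' (level z - n)" "level z \<le> height v"
          "linked pieces (upper pieces level (level z)) (node v) z" for v c' p' q'
      proof (rule Q.chain_left[OF that(1) nz, where c = "\<lambda>j. node (c' j)" and J = "height v"])
        have "linked G (above (level z)) (c' (level z)) v"
          using chain_linked[OF that(4,5), of "level z" "height v - level z"] that(3,7) by simp
        then show "linked pieces (upper pieces level (level z)) (node (c' (level z))) z"
          using linked_pieces that(8) linked_trans by metis
        fix j assume j: "j < height v"
        show "adj pieces (node (c' (Suc j))) (node (c' j))"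
          by (rule adj_pieces_height) (use that(4,5) j in auto)
      next
        fix j assume "j \<le> height v"
        then show "level (node (c' j)) = j" using level_node that(4) by simp
      qed (use that nz in auto)
      from this[OF D x c(1) _ c(3) p le(1)] this[OF D' y e(1) _ e(3) q le(2)]
      have "node (c (level z)) = p 0" "node (e (level z)) = q 0" using c(2) e(2) a f0 by auto
      then have "node (c (level z)) = node (e (level z))"
        using Q.diamond_start[OF D] Q.diamond_start[OF D'] by simp
      then show False using False le nz by auto
    qed
    then obtain k where k: "k \<le> l" "f k = z"
      using Q.walk_through_top[OF D f i iz, of 0] Q.walk_through_top[OF D f i iz, of l] by auto
    \<comment> \<open>Each half has its own lowest level. The half stays at or above it, which gives
      the link to \<open>z\<close> that \<open>top_gdist\<close> requires, and its length pays for
      descending there and climbing to \<open>z\<close>.\<close>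
    have "\<And>i. i < k \<Longrightarrow> adj pieces (f i) (f (Suc i))" using f k(1) by simp
    from Q.walk_lev[of k f, OF this]
    obtain m1 where m1: "m1 \<le> k" "\<forall>i\<le>k. level (f m1) \<le> level (f i)"
      "level (f 0) + level (f k) \<le> k + 2 * level (f m1)"
      "linked pieces (upper pieces level (level (f m1))) (f 0) (f k)"
      using fV by blast
    have fkV: "f k \<in> verts pieces" using linked_in[OF m1(4)] by (simp add: upper_def)
    have shift: "k + (l - k) = l" using k(1) by simp
    have "\<And>i. i < l - k \<Longrightarrow> adj pieces (f (k + i)) (f (k + Suc i))" using f by simp
    from Q.walk_lev[of "l - k" "\<lambda>i. f (k + i)", OF this]
    obtain m2 where m2: "m2 \<le> l - k" "\<forall>i\<le>l - k. level (f (k + m2)) \<le> level (f (k + i))"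
      "level (f k) + level (f l) \<le> (l - k) + 2 * level (f (k + m2))"
      "linked pieces (upper pieces level (level (f (k + m2)))) (f k) (f l)"
      using fkV unfolding add_0_right shift by blast
    have t1: "n \<le> level (f m1)" "level (f m1) \<le> height x" "level (f m1) \<le> level z"
      using m(2)[of m1] m1 k f0 level_node x unfolding n_def by auto
    have t2: "n \<le> level (f (k + m2))" "level (f (k + m2)) \<le> height y" "level (f (k + m2)) \<le> level z"
      using m(2)[of "k + m2"] m2(1) m2(2)[rule_format, of 0] m2(2)[rule_format, of "l - k"] k f0 level_node y
      unfolding n_def by auto
    obtain u where u: "u \<in> verts G" "node u = z"
      "d x u + 2 * level (f m1) \<le> height x + level z + 15 * M"
      using top_gdist[OF D nz x c n(1) p t1] m1(4) f0 k by auto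
    have "linked pieces (upper pieces level (level (f (k + m2)))) (node y) z"
      using m2(4) f0 k linked_sym by metis
    then obtain v where v: "v \<in> verts G" "node v = z"
      "d y v + 2 * level (f (k + m2)) \<le> height y + level z + 15 * M"
      using top_gdist[OF D' nz y e n(2) q t2] by auto
    have "d u v \<le> 15 * M" using piece_diam node_eq_iff u v by metis
    moreover have "d x y \<le> d x u + d u y" "d u y \<le> d u v + d v y" using gdist_triangle x y u v by blast+
    moreover have "d v y = d y v" using gdist_sym y v by blast
    moreover have "height x + level z \<le> k + 2 * level (f m1)"
      "level z + height y \<le> (l - k) + 2 * level (f (k + m2))"
      using m1(3) m2(3) f0 k level_node x y by auto
    ultimately show ?thesis using u(3) v(3) k(1) unfolding l_def[symmetric] by linarith
  qed
qed

end

theorem corollary1p2: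
  fixes G :: "'a ugraph" and H :: "'b ugraph"
  assumes "connected_graph G"
    and "connected_graph H"
    and "outerplanar H"
    and "quasi_isometric (points G) (path_dist G) (points H) (path_dist H)"
  shows "\<exists>(K::real) (C :: ('a \<times> nat) ugraph). cactus C \<and>
           one_quasi_isometric K (points G) (path_dist G) (points C) (path_dist C)"
proof -
  obtain f N where f: "\<And>x. x \<in> verts G \<Longrightarrow> f x \<in> verts H"
    "\<And>x y. adj G x y \<Longrightarrow> gdist H (f x) (f y) \<le> N"
    "\<And>x y. x \<in> verts G \<Longrightarrow> y \<in> verts G \<Longrightarrow> gdist G x y \<le> N * gdist H (f x) (f y) + N"
    using quasi_isometric_gdist[OF assms(1,2,4)] by blast
  \<comment> \<open>The smallest value that satisfies the strict bound of \<open>no_fat_K23\<close>;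
    it is also at least one.\<close>
  define M where "M = N * (2 * N + 1) + N + 1"
  have "\<not> fat_K23 G M" by (rule no_fat_K23[OF assms(1-3) f]) (simp_all add: M_def)
  moreover obtain r where "r \<in> verts G" using assms(1) unfolding connected_graph_def by blast
  ultimately interpret theta_free_ugraph G M r
    by unfold_locales (simp_all add: assms(1) M_def)
  have "one_quasi_isometric (real (45 * M) + 4) (points G) (path_dist G) (points pieces) (path_dist pieces)"
    by (rule one_quasi_isometricI[OF assms(1) connected_pieces, of node])
      (use gdist_pieces_le gdist_le_pieces in \<open>auto simp: verts_pieces intro: trans_le_add1\<close>)
  then show ?thesis using Q.cactus by blast
qed

end
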